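(* Let $\digamma(n)$ be a multiplicative function with $\digamma(1)=1$, $\digamma(p)=-1$, $\digamma(p^2)=1$, and $\digamma(p^k)=\epsilon_k\in\{-1,0,1\}$ for $k\geq3$, for every prime $p$, where the $\epsilon_k$ do not depend on $p$. Let $F(x)=\sum_{n=1}^{\lfloor x\rfloor}\digamma(n)$, and let \[ b=\frac{1}{\zeta(1/2)}\prod_p\left(1+\sum_{k\geq3}\frac{\epsilon_{k-1}+\epsilon_k}{p^{k/2}}\right) \] (with $\epsilon_2=1$) denote its apparent bias. Then \[ \liminf_{x\to\infty}\frac{F(x)}{\sqrt x}<b\quad\text{and}\quad\limsup_{x\to\infty}\frac{F(x)}{\sqrt x}>b. \]
   Context: The Dirichlet series $T(s)=\sum_{n\ge1}\digamma(n)n^{-s}$ factors as $T(s)=U(s)\zeta(2s)/\zeta(s)$ with $U(s)=\prod_p\bigl(1+\sum_{k\ge3}(\epsilon_{k-1}+\epsilon_k)p^{-ks}\bigr)$ absolutely convergent for $\operatorname{Re}(s)>1/3$; the apparent bias is $b=2\operatorname{Res}_{s=1/2}T(s)=U(1/2)/\zeta(1/2)$. The product runs over all primes. *)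

theory Defs
  imports "HOL-Complex_Analysis.Complex_Analysis" "HOL-Computational_Algebra.Primes"
begin

text \<open>
  The Riemann zeta function: the analytic continuation of \<open>\<Sum>n\<ge>1. 1 / n\<^sup>s\<close> from the half-plane
  \<open>Re s > 1\<close> to the punctured plane \<open>\<complex> - {1}\<close>. As the punctured plane is connected, the choice
  affects only the value at the pole \<open>s = 1\<close>, which is never used.
\<close>

definition zeta :: "complex \<Rightarrow> complex" where
  "zeta = (SOME f. f holomorphic_on (- {1}) \<and>
                   (\<forall>s. Re s > 1 \<longrightarrow> (\<lambda>n. 1 / of_nat (Suc n) powr s) sums f s))"

definition multiplicative :: "(nat \<Rightarrow> real) \<Rightarrow> bool" where
  "multiplicative f \<longleftrightarrow>
     f 1 = 1 \<and> (\<forall>m n. m > 0 \<longrightarrow> n > 0 \<longrightarrow> coprime m n \<longrightarrow> f (m * n) = f m * f n)"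

definition summatory :: "(nat \<Rightarrow> real) \<Rightarrow> real \<Rightarrow> real" where
  "summatory f x = (\<Sum>n = 1..nat \<lfloor>x\<rfloor>. f n)"

text \<open>
  Only the values \<open>\<epsilon> k\<close> with \<open>k \<ge> 2\<close> are used. The product over primes is the infinite product over
  all naturals with factor 1 at non-primes, and \<open>Re\<close> is a mere coercion, as \<open>zeta (1/2)\<close> is real.
\<close>

definition apparent_bias :: "(nat \<Rightarrow> real) \<Rightarrow> real" where
  "apparent_bias \<epsilon> = 1 / Re (zeta (1/2)) *
     (\<Prod>p. if prime p
           then 1 + (\<Sum>\<^sub>\<infinity>k\<in>{3..}. (\<epsilon> (k - 1) + \<epsilon> k) / real p powr (real k / 2))
           else 1)"

end

theory Submission
  imports Defs "HOL-Real_Asymp.Real_Asymp"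
begin

text \<open>
  Suppose that \<open>F(x) \<le> (b + \<kappa>) \<surd>x\<close> for every \<open>\<kappa> > 0\<close> and all large \<open>x\<close> (the other inequality is
  treated in the same way). Landau's theorem, applied to the Dirichlet series with coefficients
  \<open>((b + \<kappa>) \<surd>n - F(n)) / n\<close>, continues \<open>T(s) = U(s) \<zeta>(2s) / \<zeta>(s)\<close> analytically to \<open>Re s > 1/2\<close>.
  The coefficients are nonnegative, so the series is dominated by its value at \<open>\<sigma> = Re s\<close>, which
  behaves like \<open>\<kappa> / (\<sigma> - 1/2)\<close> because \<open>b\<close> is twice the residue of \<open>T\<close> at \<open>1/2\<close>. As \<open>\<kappa>\<close> is
  arbitrary, \<open>T\<close> has no pole on the line \<open>Re s = 1/2\<close> apart from \<open>s = 1/2\<close>, and it grows only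
  polynomially to the right of this line.

  Hence every zero of \<open>\<zeta>\<close> with \<open>Re s \<ge> 1/2\<close> is a zero of \<open>U\<close>. In this half plane \<open>U\<close> vanishes only
  through its Euler factor at \<open>2\<close>, so these zeros are cancelled by \<open>P(2\<^sup>-\<^sup>s)\<close> for some nonzero
  polynomial \<open>P\<close>. By the functional equation, with \<open>\<xi>\<close> denoting the completed zeta function,
  \<open>Q(s) = P(2\<^sup>-\<^sup>s) P(2\<^sup>s\<^sup>-\<^sup>1) / \<xi>(s)\<close> is then entire, and it is of exponential type. Because of the factor
  \<open>1 / \<Gamma>(s/2)\<close> it decays faster than any exponential in two opposite sectors around the real axis.
  The maximum principle forces such a function to vanish identically, which is absurd.
\<close>

text \<open>No zero of zeta is ever located. The contradiction could be phrased by counting: zeros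
  of zeta become denser with the height, while zeros of a polynomial in \<open>2 powr (-s)\<close>
  have bounded density. The decay of \<open>1 / Gamma\<close> against exponential type expresses
  this contrast without any count. The exceptional Euler factor cannot enter as it stands: its power
  series lives in the unit disc, whereas the functional equation also needs the argument
  \<open>2 powr (s - 1)\<close>, which leaves the disc. A polynomial that lies below the factor in
  modulus for \<open>Re s \<ge> 1 / 2\<close> is defined everywhere and has controlled growth. The
  margin \<open>\<kappa>\<close> cannot be taken to be \<open>0\<close>, since only limits are
  given. It matters solely on the critical line: a pole there is at least simple, and a small
  \<open>\<kappa>\<close> refutes it whatever its order. Reciprocals of \<open>\<zeta>(2s)\<close>
  are bounded by the Euler product for \<open>Re s > 1 / 2\<close>. On the line itself,
  \<open>\<zeta>(2s) \<noteq> 0\<close> is deduced from the continuation, because \<open>U\<close>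
  does not vanish on \<open>Re s = 1\<close>.\<close>

section \<open>Analytic continuation of the zeta function\<close>

text \<open>
  \<open>zeta_reg s\<close> is \<open>(s - 1) \<zeta>(s)\<close>. Up to the factor \<open>s - 1\<close>, \<open>zeta_term n s\<close> is the error of the
  trapezoidal rule for \<open>\<integral> u\<^sup>-\<^sup>s du\<close> between \<open>n + 1\<close> and \<open>n + 2\<close>, so the series converges for \<open>Re s > -1\<close>.
\<close>

definition zeta_term :: "nat \<Rightarrow> complex \<Rightarrow> complex" where
  "zeta_term n s = (s - 1) / 2 * (of_nat (Suc n) powr (-s) + of_nat (Suc (Suc n)) powr (-s))
     + of_nat (Suc (Suc n)) powr (1 - s) - of_nat (Suc n) powr (1 - s)"

definition zeta_reg :: "complex \<Rightarrow> complex" where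
  "zeta_reg s = (s + 1) / 2 + (\<Sum>n. zeta_term n s)"

lemma norm_powr_of_nat:
  assumes "n > 0"
  shows "norm (of_nat n powr (s::complex)) = real n powr Re s"
  using assms by (simp add: norm_powr_real_powr)

text \<open>The mean value inequality is applied twice: \<open>g1\<close> vanishes at
  \<open>0\<close>, so it is bounded by \<open>B\<close> on the segment, and then so is the
  increment of \<open>g\<close>. The variable moves along a complex segment because the functions in
  question are complex powers.\<close>

lemma second_order_remainder:
  fixes g g1 g2 :: "complex \<Rightarrow> complex"
  defines "S \<equiv> closed_segment 0 1"
  assumes d1: "\<And>u. u \<in> S \<Longrightarrow> (g has_field_derivative g1 u) (at u within S)"
    and d2: "\<And>u. u \<in> S \<Longrightarrow> (g1 has_field_derivative g2 u) (at u within S)"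
    and g1_0: "g1 0 = 0" and b2: "\<And>u. u \<in> S \<Longrightarrow> norm (g2 u) \<le> B"
  shows "norm (g 1 - g 0) \<le> B"
proof -
  have cS: "convex S" unfolding S_def by simp
  have i: "0 \<in> S" "1 \<in> S" unfolding S_def by auto
  have B0: "B \<ge> 0" using b2[OF i(1)] norm_ge_zero[of "g2 0"] by linarith
  have b1: "norm (g1 u) \<le> B" if "u \<in> S" for u
  proof -
    have "norm (g1 u - g1 0) \<le> B * norm (u - 0)"
      by (rule field_differentiable_bound[OF cS d2 b2]) (use that i in auto)
    also have "\<dots> \<le> B * 1"
      using that B0 by (intro mult_left_mono) (auto simp: S_def in_segment)
    finally show ?thesis by (simp add: g1_0)
  qed
  have "norm (g 1 - g 0) \<le> B * norm (1 - 0 :: complex)"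
    by (rule field_differentiable_bound[OF cS d1 b1]) (use i in auto)
  thus ?thesis by simp
qed

lemma shifted_powr:
  fixes a :: real
  assumes a: "a > 0" and u: "u \<in> closed_segment 0 1"
  shows "((\<lambda>u. (of_real a + u) powr c) has_field_derivative c * (of_real a + u) powr (c - 1)) (at u within S)"
    and "of_real a + u \<noteq> 0" and "norm u \<le> 1"
    and "Re s \<ge> -2 \<Longrightarrow> norm ((of_real a + u) powr (-s - 2)) \<le> a powr (-Re s - 2)"
proof -
  have S: "Im u = 0" "0 \<le> Re u" "Re u \<le> 1" using u by (auto simp: in_segment)
  have e: "of_real a + u = of_real (a + Re u)" using S by (simp add: complex_eq_iff)
  show "((\<lambda>u. (of_real a + u) powr c) has_field_derivative c * (of_real a + u) powr (c - 1)) (at u within S)"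
    using S a by (auto intro!: derivative_eq_intros simp: complex_nonpos_Reals_iff)
  show "of_real a + u \<noteq> 0" unfolding e of_real_eq_0_iff using S a by simp
  show "norm u \<le> 1" using S by (simp add: cmod_eq_Re)
  assume s: "Re s \<ge> -2"
  have "norm ((of_real a + u) powr (-s - 2)) = (a + Re u) powr (-Re s - 2)"
    unfolding e using S a by (simp add: norm_powr_real_powr)
  also have "\<dots> \<le> a powr (-Re s - 2)" using S a s by (intro powr_mono2') auto
  finally show "norm ((of_real a + u) powr (-s - 2)) \<le> a powr (-Re s - 2)" .
qed

text \<open>With the right endpoint \<open>a + u\<close> variable, the error \<open>g u\<close> has
  a derivative \<open>g1\<close> that vanishes at \<open>0\<close>, and in \<open>g2\<close> the
  terms with exponent \<open>-s - 1\<close> cancel. The gain of two powers of \<open>a\<close> over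
  \<open>a powr (- Re s)\<close> gives convergence of the series for
  \<open>Re s > -1\<close>.\<close>

lemma trapezoid_powr_bound:
  fixes s :: complex and a :: real
  assumes a: "a > 0" and s: "Re s \<ge> -2"
  shows "norm ((s - 1) / 2 * (of_real a powr (-s) + of_real (a + 1) powr (-s))
     + of_real (a + 1) powr (1 - s) - of_real a powr (1 - s))
     \<le> norm ((s - 1) * s * (s + 1)) / 2 * a powr (-Re s - 2)"
proof -
  define A where "A = complex_of_real a"
  define g where "g = (\<lambda>u. (s - 1) / 2 * u * (A powr (-s) + (A + u) powr (-s)) + (A + u) powr (1 - s) - A powr (1 - s))"
  define g1 where "g1 = (\<lambda>u. (s - 1) / 2 * (A powr (-s) - (A + u) powr (-s)) - (s - 1) * s / 2 * u * (A + u) powr (-s - 1))"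
  define g2 where "g2 = (\<lambda>u. (s - 1) * s * (s + 1) / 2 * u * (A + u) powr (-s - 2))"
  note P = shifted_powr[OF a, folded A_def]
  have "norm (g 1 - g 0) \<le> norm ((s - 1) * s * (s + 1)) / 2 * a powr (-Re s - 2)"
  proof (rule second_order_remainder)
    fix u :: complex assume u: "u \<in> closed_segment 0 1"
    define X where "X = (A + u) powr (-s)"
    show "(g has_field_derivative g1 u) (at u within closed_segment 0 1)" unfolding g_def g1_def
      by (rule DERIV_cong, (rule P(1)[OF u] derivative_intros)+, simp add: X_def [symmetric], simp add: field_simps)
    define Y where "Y = (A + u) powr (-s - 2)"
    have 1: "(A + u) powr (-s - 1) = Y * (A + u)"
      using P(2)[OF u] by (simp add: Y_def powr_diff power2_eq_square)
    have 2: "(A + u) powr (-s - 1 - 1) = Y" by (simp add: Y_def diff_diff_eq)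
    show "(g1 has_field_derivative g2 u) (at u within closed_segment 0 1)" unfolding g1_def g2_def
      apply (rule DERIV_cong, (rule P(1)[OF u] derivative_intros)+)
      apply (simp only: 1 2 Y_def [symmetric])
      by (simp add: field_simps)
    have "norm u * norm ((A + u) powr (-s - 2)) \<le> 1 * a powr (-Re s - 2)"
      using P(3,4)[OF u] s by (intro mult_mono) auto
    hence "norm ((s - 1) * s * (s + 1)) / 2 * (norm u * norm ((A + u) powr (-s - 2)))
        \<le> norm ((s - 1) * s * (s + 1)) / 2 * a powr (-Re s - 2)"
      by (intro mult_left_mono) auto
    thus "norm (g2 u) \<le> norm ((s - 1) * s * (s + 1)) / 2 * a powr (-Re s - 2)"
      by (simp add: g2_def norm_mult mult_ac)
  qed (simp add: g1_def)
  thus ?thesis by (simp add: g_def A_def)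
qed

lemma norm_zeta_term_le:
  assumes "Re s \<ge> -2"
  shows "norm (zeta_term n s) \<le> norm ((s - 1) * s * (s + 1)) / 2 * real (Suc n) powr (-Re s - 2)"
  using trapezoid_powr_bound[of "real (Suc n)" s] assms
  by (simp add: zeta_term_def add_ac)

lemma holomorphic_zeta_term: "zeta_term n holomorphic_on A"
  unfolding zeta_term_def [abs_def] by (intro holomorphic_intros) auto

lemma summable_Suc_powr:
  assumes "x < -1"
  shows "summable (\<lambda>n. real (Suc n) powr x)"
  using assms by (subst summable_Suc_iff) (simp add: summable_real_powr_iff)

lemma holomorphic_series_Mtest:
  fixes f :: "nat \<Rightarrow> complex \<Rightarrow> complex"
  assumes "open A" and hol: "\<And>n. f n holomorphic_on A"
    and M: "\<And>z. z \<in> A \<Longrightarrow> \<exists>d>0. \<exists>M. cball z d \<subseteq> A \<and> summable M \<and> (\<forall>n. \<forall>w\<in>cball z d. norm (f n w) \<le> M n)"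
  shows "(\<lambda>z. \<Sum>n. f n z) holomorphic_on A"
proof (rule holomorphic_uniform_sequence[where f = "\<lambda>N z. \<Sum>n<N. f n z"])
  show "open A" by fact
  show "(\<lambda>z. \<Sum>n<N. f n z) holomorphic_on A" for N by (rule holomorphic_on_sum) (rule hol)
  fix z assume "z \<in> A"
  from M[OF this] obtain d M where "d > 0" "cball z d \<subseteq> A" "summable M"
      "\<forall>n. \<forall>w\<in>cball z d. norm (f n w) \<le> M n"
    by (elim exE conjE) (rule that)
  hence "uniform_limit (cball z d) (\<lambda>N z. \<Sum>n<N. f n z) (\<lambda>z. \<Sum>n. f n z) sequentially"
    by (intro Weierstrass_m_test[where M = M]) auto
  thus "\<exists>d>0. cball z d \<subseteq> A \<and> uniform_limit (cball z d) (\<lambda>N z. \<Sum>n<N. f n z) (\<lambda>z. \<Sum>n. f n z) sequentially"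
    using \<open>d > 0\<close> \<open>cball z d \<subseteq> A\<close> by blast
qed

lemma Re_in_cball:
  assumes "w \<in> cball z d"
  shows "Re z - d \<le> Re w" "Re w \<le> Re z + d" "norm w \<le> norm z + d"
  using assms abs_Re_le_cmod[of "z - w"] norm_triangle_ineq3[of w z]
  by (simp_all add: dist_norm norm_minus_commute)

lemma cball_Re_gt: "Re z - d > c \<Longrightarrow> cball z d \<subseteq> {s. Re s > c}"
  using Re_in_cball by fastforce

lemma summable_zeta_term:
  assumes "Re s > -1"
  shows "summable (\<lambda>n. zeta_term n s)"
proof (rule summable_comparison_test')
  show "summable (\<lambda>n. norm ((s - 1) * s * (s + 1)) / 2 * real (Suc n) powr (-Re s - 2))"
    by (intro summable_mult summable_Suc_powr) (use assms in auto)
qed (use norm_zeta_term_le[of s] assms in auto)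

lemma open_Re_gt: "open {s. Re s > c}"
  by (rule open_halfspace_Re_gt)

lemma isCont_holomorphic_Re_gt:
  assumes "g holomorphic_on {s. Re s > c}" "Re z > c"
  shows "isCont g z"
  using assms(2) open_halfspace_Re_gt[of c]
  by (intro continuous_on_interior[OF holomorphic_on_imp_continuous_on[OF assms(1)]]) (auto simp: interior_open)

lemma holomorphic_zeta_reg: "zeta_reg holomorphic_on {s. Re s > -1}"
  unfolding zeta_reg_def [abs_def]
proof (intro holomorphic_intros holomorphic_series_Mtest)
  fix z assume z: "z \<in> {s. Re s > -1}"
  define d where "d = (Re z + 1) / 2"
  have d: "d > 0" "Re z - d > -1" using z by (auto simp: d_def field_simps)
  define K where "K = (norm z + d + 1) * (norm z + d) * (norm z + d + 1) / 2"
  show "\<exists>d>0. \<exists>M. cball z d \<subseteq> {s. Re s > -1} \<and> summable M \<and> (\<forall>n. \<forall>w\<in>cball z d. norm (zeta_term n w) \<le> M n)"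
  proof (intro exI conjI allI ballI)
    show "summable (\<lambda>n. K * real (Suc n) powr (- (Re z - d) - 2))"
      by (intro summable_mult summable_Suc_powr) (use d in auto)
    fix n w assume w: "w \<in> cball z d"
    have "norm (zeta_term n w) \<le> norm ((w - 1) * w * (w + 1)) / 2 * real (Suc n) powr (-Re w - 2)"
      by (rule norm_zeta_term_le) (use Re_in_cball[OF w] d in auto)
    also have "\<dots> \<le> K * real (Suc n) powr (- (Re z - d) - 2)"
      unfolding K_def norm_mult using Re_in_cball[OF w] d norm_triangle_ineq4[of w 1] norm_triangle_ineq[of w 1]
      by (intro mult_mono divide_right_mono powr_mono) auto
    finally show "norm (zeta_term n w) \<le> K * real (Suc n) powr (- (Re z - d) - 2)" .
  qed (use d cball_Re_gt in auto)
qed (auto simp: open_Re_gt holomorphic_zeta_term)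

lemma zeta_reg_1 [simp]: "zeta_reg 1 = 1"
  by (simp add: zeta_reg_def zeta_term_def del: of_nat_Suc)

text \<open>The trapezoidal averages sum to \<open>suminf g - 1 / 2\<close> and the power
  differences telescope to \<open>-1\<close>. The summand \<open>(s + 1) / 2\<close> in
  \<open>zeta_reg\<close> compensates \<open>- (s - 1) / 2 - 1\<close>.\<close>

lemma zeta_reg_sums:
  assumes s: "Re s > 1"
  shows "(\<lambda>n. of_nat (Suc n) powr (-s)) sums (zeta_reg s / (s - 1))"
proof -
  define h where "h = (\<lambda>n. of_nat (Suc n) powr (1 - s) :: complex)"
  define g where "g = (\<lambda>n. of_nat (Suc n) powr (-s) :: complex)"
  have s1: "s \<noteq> 1" using s by auto
  have lim: "(\<lambda>n. real (Suc n) powr x) \<longlonglongrightarrow> 0" if "x < 0" for x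
    using that by real_asymp
  have h0: "h \<longlonglongrightarrow> 0"
    by (rule tendsto_norm_zero_cancel) (use lim[of "1 - Re s"] s in \<open>simp add: h_def norm_powr_of_nat del: of_nat_Suc\<close>)
  have "summable (\<lambda>n. norm (g n))"
    using summable_Suc_powr[of "-Re s"] s by (simp add: g_def norm_powr_of_nat del: of_nat_Suc)
  hence sg: "summable g" by (rule summable_norm_cancel)
  have g1: "g 0 = 1" "h 0 = 1" by (simp_all add: g_def h_def)
  have "(\<lambda>n. g (Suc n)) sums (suminf g - g 0)"
    using sg by (simp add: sums_Suc_iff summable_sums)
  hence "(\<lambda>n. (s - 1) / 2 * (g n + g (Suc n)) + (h (Suc n) - h n)) sums
      ((s - 1) / 2 * (suminf g + (suminf g - g 0)) + (0 - h 0))"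
    by (intro sums_add sums_mult summable_sums sg telescope_sums h0)
  hence "(\<lambda>n. zeta_term n s) sums ((s - 1) / 2 * (suminf g + (suminf g - 1)) - 1)"
    by (simp add: zeta_term_def g_def h_def g1 algebra_simps)
  hence "zeta_reg s = (s - 1) * suminf g"
    unfolding zeta_reg_def by (simp add: sums_iff) (simp add: field_simps)
  hence "suminf g = zeta_reg s / (s - 1)" using s1 by simp
  thus ?thesis using sg unfolding g_def by (simp add: sums_iff)
qed

lemma zeta_term_of_real:
  "zeta_term n (of_real x) = of_real ((x - 1) / 2 * (real (Suc n) powr (-x) + real (Suc (Suc n)) powr (-x))
     + real (Suc (Suc n)) powr (1 - x) - real (Suc n) powr (1 - x))"
  unfolding zeta_term_def 
  using powr_of_real[of "real (Suc n)" "-x"] powr_of_real[of "real (Suc (Suc n))" "-x"]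
        powr_of_real[of "real (Suc n)" "1-x"] powr_of_real[of "real (Suc (Suc n))" "1-x"]
  by simp

lemma zeta_reg_of_real:
  assumes "x > -1"
  shows "zeta_reg (of_real x) = of_real (Re (zeta_reg (of_real x)))"
proof -
  have "zeta_term n (of_real x) \<in> \<real>" for n by (simp add: zeta_term_of_real)
  hence "Im (zeta_reg (of_real x)) = 0"
    using Im_suminf[OF summable_zeta_term[of "of_real x"]] assms
    by (simp add: zeta_reg_def complex_is_Real_iff)
  thus ?thesis by (simp add: complex_eq_iff)
qed

text \<open>For \<open>x > 1\<close> the Dirichlet series has positive terms. For
  \<open>0 < x < 1\<close>, monotonicity of \<open>y powr (-x)\<close> bounds every term below by a
  telescoping one; their sum \<open>(x - 1) / 2\<close> leaves at least \<open>x\<close> after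
  adding \<open>(x + 1) / 2\<close>. Landau's theorem needs this absence of real zeros, and it makes
  division by \<open>zeta_reg (1 / 2)\<close> legitimate.\<close>

lemma zeta_reg_real_pos:
  assumes x: "x > 0"
  shows "Re (zeta_reg (of_real x)) > 0"
proof (cases "x < 1")
  case False
  show ?thesis
  proof (cases "x = 1")
    case False
    with \<open>\<not> x < 1\<close> have x1: "x > 1" by simp
    have "(\<lambda>n. of_nat (Suc n) powr (-of_real x)) sums (zeta_reg (of_real x) / (of_real x - 1))"
      using zeta_reg_sums[of "of_real x"] x1 by simp
    hence "(\<lambda>n. Re (of_nat (Suc n) powr (-of_real x))) sums Re (zeta_reg (of_real x) / (of_real x - 1))"
      by (rule sums_Re)
    moreover have "Re (of_nat (Suc n) powr (-of_real x)) = real (Suc n) powr (-x)" for n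
      using powr_of_real[of "real (Suc n)" "-x"] by (metis Re_complex_of_real of_nat_0_le_iff of_real_minus of_real_of_nat_eq)
    ultimately have "(\<lambda>n. real (Suc n) powr (-x)) sums Re (zeta_reg (of_real x) / (of_real x - 1))"
      by simp
    moreover have "Re (zeta_reg (of_real x) / (of_real x - 1)) = Re (zeta_reg (of_real x)) / (x - 1)"
      by (metis Re_divide_of_real of_real_1 of_real_diff)
    ultimately have "0 < Re (zeta_reg (of_real x)) / (x - 1)"
      by (metis suminf_pos sums_iff of_nat_Suc powr_gt_zero of_nat_neq_0)
    thus ?thesis using x1 by (simp add: zero_less_divide_iff)
  qed simp
next
  case True
  define t where "t = (\<lambda>n. Re (zeta_term n (of_real x)))"
  have t: "t n \<ge> (1 - x) / 2 * (real (Suc (Suc n)) powr (-x) - real (Suc n) powr (-x))" for n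
  proof -
    have d: "((\<lambda>y. y powr (1 - x)) has_real_derivative (1 - x) * y powr (-x)) (at y)" if "y > 0" for y
      using that by (auto intro!: derivative_eq_intros)
    obtain z where z: "z > real (Suc n)" "z < real (Suc (Suc n))"
      "real (Suc (Suc n)) powr (1 - x) - real (Suc n) powr (1 - x) = (real (Suc (Suc n)) - real (Suc n)) * ((1 - x) * z powr (-x))"
      using MVT2[of "real (Suc n)" "real (Suc (Suc n))" "\<lambda>y. y powr (1 - x)" "\<lambda>y. (1 - x) * y powr (-x)"] d by force
    have "(1 - x) * z powr (-x) \<ge> (1 - x) * real (Suc (Suc n)) powr (-x)"
      using z True x by (intro mult_left_mono powr_mono2') auto
    hence "real (Suc (Suc n)) powr (1 - x) - real (Suc n) powr (1 - x) \<ge> (1 - x) * real (Suc (Suc n)) powr (-x)"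
      using z(3) by simp
    moreover have *: "(x - 1) / 2 * (p + q) + (1 - x) * q = (1 - x) / 2 * (q - p)" for p q :: real
      by (simp add: field_simps)
    from *[of "real (Suc n) powr (-x)" "real (Suc (Suc n)) powr (-x)"] calculation
    show ?thesis unfolding t_def zeta_term_of_real Re_complex_of_real by linarith
  qed
  have lim: "(\<lambda>n. real (Suc n) powr (-x)) \<longlonglongrightarrow> 0"
    using x by real_asymp
  have "(\<lambda>n. (1 - x) / 2 * (real (Suc (Suc n)) powr (-x) - real (Suc n) powr (-x))) sums ((1 - x) / 2 * (0 - real (Suc 0) powr (-x)))"
    by (intro sums_mult telescope_sums lim)
  moreover have "t sums Re (\<Sum>n. zeta_term n (of_real x))"
    unfolding t_def by (intro sums_Re summable_sums summable_zeta_term) (use x in auto)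
  ultimately have "(1 - x) / 2 * (0 - real (Suc 0) powr (-x)) \<le> Re (\<Sum>n. zeta_term n (of_real x))"
    by (rule sums_le[OF t])
  hence "Re (\<Sum>n. zeta_term n (of_real x)) \<ge> (x - 1) / 2" by (simp add: field_simps)
  thus ?thesis using x by (simp add: zeta_reg_def field_simps)
qed

lemma zeta_reg_nonzero:
  assumes "x > 0"
  shows "zeta_reg (of_real x) \<noteq> 0"
  using zeta_reg_real_pos[OF assms] by auto

section \<open>The functional equation of the zeta function\<close>

text \<open>The logarithmic derivative of the reflection formula is
  \<open>Digamma (1 - z) - Digamma z = pi * cot (pi * z)\<close>; the series defining
  \<open>Digamma\<close> then yields the partial fractions.\<close>

lemma sums_cot:
  fixes z :: complex
  assumes z: "z \<notin> \<int>"
  shows "(\<lambda>n. 2 * z / (z\<^sup>2 - of_nat (Suc n) ^ 2)) sums (of_real pi * cot (of_real pi * z) - 1 / z)"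
proof -
  have nz: "z \<notin> \<int>\<^sub>\<le>\<^sub>0" "1 - z \<notin> \<int>\<^sub>\<le>\<^sub>0" "z \<noteq> 0" "1 - z \<noteq> 0"
    using z nonpos_Ints_Int Ints_diff[of 1 "1 - z"] by (auto elim: nonpos_Ints_cases)
  have sn: "sin (of_real pi * z) \<noteq> 0"
  proof
    assume "sin (of_real pi * z) = 0"
    then obtain n :: int where "of_real pi * z = of_int n * of_real pi"
      by (auto simp: sin_eq_0 mult_ac)
    hence "z = of_int n" by simp
    thus False using z by auto
  qed
  have 1: "((\<lambda>z. Gamma z * Gamma (1 - z)) has_field_derivative
        (Gamma z * Digamma z * Gamma (1 - z) - Gamma z * (Gamma (1 - z) * Digamma (1 - z)))) (at z)"
    using nz by (auto intro!: derivative_eq_intros)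
  have 2: "((\<lambda>z. of_real pi / sin (of_real pi * z)) has_field_derivative
        (- of_real pi * (of_real pi * cos (of_real pi * z)) / (sin (of_real pi * z))\<^sup>2)) (at z)"
    using sn by (auto intro!: derivative_eq_intros simp: power2_eq_square)
  have "Gamma z * Gamma (1 - z) * (Digamma z - Digamma (1 - z)) =
        - of_real pi * (of_real pi * cos (of_real pi * z)) / (sin (of_real pi * z))\<^sup>2"
    using DERIV_unique[OF 1 2[folded Gamma_reflection_complex]] by (simp add: algebra_simps)
  hence "of_real pi / sin (of_real pi * z) * (Digamma z - Digamma (1 - z)) =
        of_real pi / sin (of_real pi * z) * (- of_real pi * cot (of_real pi * z))"
    by (simp add: Gamma_reflection_complex cot_def power2_eq_square)
  hence "Digamma z - Digamma (1 - z) = - of_real pi * cot (of_real pi * z)"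
    using sn by (subst (asm) mult_left_cancel) auto
  hence D: "Digamma (1 - z) - Digamma z = of_real pi * cot (of_real pi * z)"
    by (simp add: algebra_simps)
  define d where "d = (\<lambda>n. inverse (z + of_nat n))"
  define e where "e = (\<lambda>n. inverse (1 - z + of_nat n))"
  have A: "(\<lambda>n. (inverse (of_nat (Suc n)) - e n) - (inverse (of_nat (Suc n)) - d n)) sums
        ((\<Sum>n. inverse (of_nat (Suc n)) - e n) - (\<Sum>n. inverse (of_nat (Suc n)) - d n))"
    unfolding d_def e_def by (intro sums_diff summable_sums summable_Digamma nz)
  \<comment> \<open>Adding this telescoping series replaces \<open>d n\<close> by
    \<open>d (Suc n)\<close>, so that the poles at \<open>n + 1\<close> and \<open>-(n + 1)\<close>
    meet in one term. Its sum \<open>- d 0\<close> is the \<open>- 1 / z\<close> of the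
    result.\<close>
  have B: "(\<lambda>n. d (Suc n) - d n) sums (0 - d 0)"
    unfolding d_def
    by (intro telescope_sums filterlim_compose[OF tendsto_inverse_0]
              tendsto_add_filterlim_at_infinity[OF tendsto_const] tendsto_of_nat)
  have "(\<lambda>n. ((inverse (of_nat (Suc n)) - e n) - (inverse (of_nat (Suc n)) - d n)) + (d (Suc n) - d n)) sums
     (Digamma (1 - z) - Digamma z + (0 - d 0))"
    using sums_add[OF A B] by (simp add: Digamma_def d_def e_def)
  moreover have "((inverse (of_nat (Suc n)) - e n) - (inverse (of_nat (Suc n)) - d n)) + (d (Suc n) - d n)
      = 2 * z / (z\<^sup>2 - of_nat (Suc n) ^ 2)" for n
  proof -
    have "z \<noteq> of_int (-int (Suc n))" "z \<noteq> of_int (int (Suc n))" using z Ints_of_int by metis+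
    hence "z + of_nat (Suc n) \<noteq> 0" "of_nat (Suc n) - z \<noteq> 0"
      by (metis add.commute add_eq_0_iff of_int_minus of_int_of_nat_eq, metis eq_iff_diff_eq_0 of_int_of_nat_eq)
    moreover define N where "N = complex_of_nat (Suc n)"
    ultimately have nz: "z + N \<noteq> 0" "z - N \<noteq> 0" "N - z \<noteq> 0" by auto
    have "((inverse (of_nat (Suc n)) - e n) - (inverse (of_nat (Suc n)) - d n)) + (d (Suc n) - d n) = d (Suc n) - e n"
      by simp
    also have "\<dots> = inverse (z + N) - inverse (N - z)"
      by (simp add: e_def d_def N_def algebra_simps)
    also have "\<dots> = 2 * z / ((z + N) * (z - N))"
      using nz by (simp add: divide_simps) (simp add: algebra_simps)
    also have "(z + N) * (z - N) = z\<^sup>2 - N\<^sup>2" by (simp add: power2_eq_square algebra_simps)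
    finally show ?thesis unfolding N_def .
  qed
  ultimately show ?thesis unfolding D by (simp add: d_def inverse_eq_divide)
qed

text \<open>The kernel equals \<open>coth (x / 2) / 2 - 1 / x\<close>, so this is the cotangent
  expansion at the imaginary point \<open>z = \<i> * x / (2 * pi)\<close>.\<close>

lemma sums_bernoulli_kernel:
  fixes x :: real
  assumes x: "x > 0"
  shows "(\<lambda>n. 2 * x / (x\<^sup>2 + (2 * pi * real (Suc n))\<^sup>2)) sums (1 / (exp x - 1) - 1 / x + 1 / 2)"
proof -
  define z where "z = \<i> * of_real (x / (2 * pi))"
  have z: "z \<notin> \<int>" using x by (auto elim!: Ints_cases simp: z_def complex_eq_iff)
  have pz: "of_real pi * z = \<i> * of_real (x / 2)" by (simp add: z_def)
  have ex: "exp (x / 2) * exp (x / 2) = exp x" by (simp add: exp_add [symmetric])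
  have e1: "exp x > 1" using x by simp
  have cosh: "cos (\<i> * of_real (x / 2)) = of_real (cosh (x / 2))" "sin (\<i> * of_real (x / 2)) = \<i> * of_real (sinh (x / 2))"
    by (simp_all add: cos_exp_eq sin_exp_eq cosh_def sinh_def exp_of_real[symmetric] field_simps)
  have "sinh (x / 2) \<noteq> 0" using x by simp
  have coth: "cosh (x / 2) / sinh (x / 2) = 2 / (exp x - 1) + 1"
    using e1 by (simp add: cosh_def sinh_def field_simps exp_minus ex)
  have "(\<lambda>n. \<i> / of_real (2 * pi) * (2 * z / (z\<^sup>2 - of_nat (Suc n) ^ 2))) sums
        (\<i> / of_real (2 * pi) * (of_real pi * cot (of_real pi * z) - 1 / z))"
    by (intro sums_mult sums_cot z)
  also have "\<i> / of_real (2 * pi) * (of_real pi * cot (of_real pi * z) - 1 / z) =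
      of_real (cosh (x / 2) / sinh (x / 2) / 2 - 1 / x)"
    unfolding pz cot_def cosh using x \<open>sinh (x / 2) \<noteq> 0\<close> by (simp add: z_def field_simps)
  also have "(\<lambda>n. \<i> / of_real (2 * pi) * (2 * z / (z\<^sup>2 - of_nat (Suc n) ^ 2))) =
      (\<lambda>n. of_real (2 * x / (x\<^sup>2 + (2 * pi * real (Suc n))\<^sup>2)))"
  proof
    fix n
    define N where "N = real (Suc n)"
    have "z\<^sup>2 - of_nat (Suc n) ^ 2 = - of_real ((x\<^sup>2 + (2 * pi * N)\<^sup>2) / (2 * pi)\<^sup>2)"
      by (simp add: z_def N_def power_mult_distrib field_simps del: of_nat_Suc) 
    hence "\<i> / of_real (2 * pi) * (2 * z / (z\<^sup>2 - of_nat (Suc n) ^ 2)) = 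
       of_real (2 * x / (2 * pi)\<^sup>2 / ((x\<^sup>2 + (2 * pi * N)\<^sup>2) / (2 * pi)\<^sup>2))"
      by (simp add: z_def power2_eq_square)
    also have "2 * x / (2 * pi)\<^sup>2 / ((x\<^sup>2 + (2 * pi * N)\<^sup>2) / (2 * pi)\<^sup>2) = 2 * x / (x\<^sup>2 + (2 * pi * N)\<^sup>2)"
      by simp
    finally show "\<i> / of_real (2 * pi) * (2 * z / (z\<^sup>2 - of_nat (Suc n) ^ 2)) = 
        of_real (2 * x / (x\<^sup>2 + (2 * pi * real (Suc n))\<^sup>2))" unfolding N_def .
  qed
  finally have "(\<lambda>n. 2 * x / (x\<^sup>2 + (2 * pi * real (Suc n))\<^sup>2)) sums (cosh (x / 2) / sinh (x / 2) / 2 - 1 / x)"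
    unfolding sums_of_real_iff .
  thus ?thesis unfolding coth by (simp add: field_simps)
qed

section \<open>Integrals evaluated by the Gamma function\<close>

lemma Gamma_absolutely_integrable:
  fixes a :: real
  assumes "a > 0"
  shows "(\<lambda>t. t powr (a - 1) / exp t) absolutely_integrable_on {0<..} \<and>
         integral {0<..} (\<lambda>t. t powr (a - 1) / exp t) = Gamma a"
proof -
  have "((\<lambda>t. t powr (a - 1) / exp t) has_integral Gamma a) {0..}"
    using Gamma_integral_real[OF assms] .
  hence "((\<lambda>t. t powr (a - 1) / exp t) has_integral Gamma a) {0<..}"
    by (subst (asm) has_integral_spike_set_eq[where T = "{0<..}"]) (auto intro: negligible_subset[of "{0}"])
  thus ?thesis by (auto intro!: nonnegative_absolutely_integrable_1 simp: has_integral_iff)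
qed

lemma Gamma_subst:
  fixes a :: real
  assumes "a > 0" "\<And>x. x > 0 \<Longrightarrow> (g has_real_derivative g' x) (at x)" "\<And>x. x > 0 \<Longrightarrow> g' x > 0"
    and "bij_betw g {0<..} {0<..}"
  shows "((\<lambda>x. g' x * (g x powr (a - 1) / exp (g x))) has_integral Gamma a) {0<..}"
proof -
  have "(\<lambda>x. \<bar>g' x\<bar> * (g x powr (a - 1) / exp (g x))) absolutely_integrable_on {0<..} \<and>
      integral {0<..} (\<lambda>x. \<bar>g' x\<bar> * (g x powr (a - 1) / exp (g x))) = Gamma a"
    using Gamma_absolutely_integrable[OF assms(1)] assms
    by (subst has_absolute_integral_change_of_variables_1')
       (auto simp: bij_betw_def intro: has_field_derivative_at_within)
  hence "((\<lambda>x. \<bar>g' x\<bar> * (g x powr (a - 1) / exp (g x))) has_integral Gamma a) {0<..}"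
    using set_lebesgue_integral_eq_integral(1) by (auto simp: has_integral_iff)
  thus ?thesis by (rule has_integral_eq[rotated]) (use assms(3) in force)
qed

lemma Gamma_scaled:
  fixes a r :: real
  assumes "a > 0" "r > 0"
  shows "((\<lambda>x. x powr (a - 1) * exp (- r * x)) has_integral (Gamma a * r powr (-a))) {0<..}"
proof -
  have "bij_betw (\<lambda>x. r * x) {0<..} {0<..}"
    by (rule bij_betwI[of _ _ _ "\<lambda>x. x / r"]) (use assms in auto)
  hence "((\<lambda>x. r * ((r * x) powr (a - 1) / exp (r * x))) has_integral Gamma a) {0<..}"
    using assms by (intro Gamma_subst) (auto intro!: derivative_eq_intros)
  hence "((\<lambda>x. r powr (-a) * (r * ((r * x) powr (a - 1) / exp (r * x)))) has_integral r powr (-a) * Gamma a) {0<..}"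
    by (rule has_integral_mult_right)
  thus ?thesis unfolding mult.commute[of "Gamma a"]
    by (rule has_integral_eq[rotated])
       (use assms in \<open>auto simp: powr_mult powr_diff powr_minus exp_minus field_simps\<close>)
qed

lemma Gamma_gaussian:
  fixes s r :: real
  assumes "s > -1" "r > 0"
  shows "((\<lambda>x. x powr s * exp (- r * x\<^sup>2)) has_integral (Gamma ((1 + s) / 2) / 2 * r powr (-((1 + s) / 2)))) {0<..}"
proof -
  define a where "a = (1 + s) / 2"
  have a: "a > 0" "s = 2 * a - 1" using assms by (auto simp: a_def field_simps)
  have "bij_betw (\<lambda>x. r * x\<^sup>2) {0<..} {0<..}"
    by (rule bij_betwI[of _ _ _ "\<lambda>x. sqrt (x / r)"]) (use assms in \<open>auto simp: real_sqrt_mult\<close>)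
  hence "((\<lambda>x. 2 * r * x * ((r * x\<^sup>2) powr (a - 1) / exp (r * x\<^sup>2))) has_integral Gamma a) {0<..}"
    using assms a by (intro Gamma_subst) (auto intro!: derivative_eq_intros)
  hence "((\<lambda>x. r powr (-a) / 2 * (2 * r * x * ((r * x\<^sup>2) powr (a - 1) / exp (r * x\<^sup>2)))) has_integral r powr (-a) / 2 * Gamma a) {0<..}"
    by (rule has_integral_mult_right)
  hence "((\<lambda>x. x powr s * exp (- r * x\<^sup>2)) has_integral (r powr (-a) / 2 * Gamma a)) {0<..}"
  proof (rule has_integral_eq[rotated])
    fix x :: real assume "x \<in> {0<..}"
    hence x: "x > 0" by simp
    have "(x\<^sup>2) powr (a - 1) = x powr (2 * (a - 1))"
    proof -
      have "x\<^sup>2 = x powr 2" using x by simp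
      thus ?thesis by (simp only: powr_powr)
    qed
    hence "x * (x\<^sup>2) powr (a - 1) = x powr 1 * x powr (2 * (a - 1))" using x by simp
    also have "\<dots> = x powr (1 + 2 * (a - 1))" by (simp only: powr_add)
    also have "1 + 2 * (a - 1) = s" using a(2) by simp
    finally have "x * (x\<^sup>2) powr (a - 1) = x powr s" .
    have c3: "(r * x\<^sup>2) powr (a - 1) = r powr (a - 1) * (x\<^sup>2) powr (a - 1)"
      using x assms by (simp add: powr_mult)
    have "r powr (-a) * r * r powr (a - 1) = 1"
      using assms by (simp add: powr_diff powr_minus field_simps)
    have "r powr (-a) / 2 * (2 * r * x * ((r * x\<^sup>2) powr (a - 1) / exp (r * x\<^sup>2))) =
       (r powr (-a) * r * r powr (a - 1)) * (x * (x\<^sup>2) powr (a - 1)) / exp (r * x\<^sup>2)"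
      unfolding c3 by (simp add: mult_ac)
    also have "\<dots> = x powr s * exp (- r * x\<^sup>2)"
      unfolding \<open>x * (x\<^sup>2) powr (a - 1) = x powr s\<close> \<open>r powr (-a) * r * r powr (a - 1) = 1\<close>
      by (simp add: exp_minus divide_inverse)
    finally show "r powr (-a) / 2 * (2 * r * x * ((r * x\<^sup>2) powr (a - 1) / exp (r * x\<^sup>2))) = x powr s * exp (- r * x\<^sup>2)" .
  qed
  thus ?thesis by (simp add: a_def mult_ac)
qed

text \<open>Writing \<open>1 / (x^2 + c^2)\<close> as the integral of
  \<open>exp (- r * (x^2 + c^2))\<close> over \<open>r > 0\<close> and exchanging the integrals by
  Tonelli leaves a Gaussian moment in \<open>x\<close> and then a Gamma integral in
  \<open>r\<close>.\<close>

lemma nn_integral_powr_over_quadratic: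
  fixes s c :: real
  assumes s: "-1 < s" "s < 1" and c: "c > 0"
  shows "(\<integral>\<^sup>+x. ennreal (x powr s / (x\<^sup>2 + c\<^sup>2)) * indicator {0<..} x \<partial>lborel) =
         ennreal (Gamma ((1 + s) / 2) * Gamma ((1 - s) / 2) / 2 * c powr (s - 1))"
proof -
  define F where "F = (\<lambda>x r::real. ennreal (x powr s * exp (- r * (x\<^sup>2 + c\<^sup>2)) * indicator {0<..} x * indicator {0<..} r))"
  have m: "case_prod F \<in> borel_measurable (lborel \<Otimes>\<^sub>M lborel)"
    unfolding F_def by measurable
  have "(\<integral>\<^sup>+x. ennreal (x powr s / (x\<^sup>2 + c\<^sup>2)) * indicator {0<..} x \<partial>lborel) =
        (\<integral>\<^sup>+x. \<integral>\<^sup>+r. F x r \<partial>lborel \<partial>lborel)"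
  proof (intro nn_integral_cong)
    fix x :: real
    show "ennreal (x powr s / (x\<^sup>2 + c\<^sup>2)) * indicator {0<..} x = (\<integral>\<^sup>+r. F x r \<partial>lborel)"
    proof (cases "x > 0")
      case True
      hence p: "x\<^sup>2 + c\<^sup>2 > 0" by (intro add_pos_nonneg) auto
      have "((\<lambda>r. x powr s * (r powr (1 - 1) * exp (- (x\<^sup>2 + c\<^sup>2) * r))) has_integral
          x powr s * (Gamma 1 * (x\<^sup>2 + c\<^sup>2) powr (-1))) {0<..}"
        by (intro has_integral_mult_right Gamma_scaled p) auto
      from nn_integral_has_integral_lebesgue'[OF _ this]
      have "(\<integral>\<^sup>+r. ennreal (x powr s * (r powr (1 - 1) * exp (- (x\<^sup>2 + c\<^sup>2) * r))) * indicator {0<..} r \<partial>lborel) =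
         ennreal (x powr s * (Gamma 1 * (x\<^sup>2 + c\<^sup>2) powr (-1)))" by simp
      also have "(\<integral>\<^sup>+r. ennreal (x powr s * (r powr (1 - 1) * exp (- (x\<^sup>2 + c\<^sup>2) * r))) * indicator {0<..} r \<partial>lborel) = 
         (\<integral>\<^sup>+r. F x r \<partial>lborel)"
        using True by (intro nn_integral_cong) (auto simp: F_def indicator_def algebra_simps)
      finally show ?thesis using True p by (simp add: powr_minus field_simps)
    qed (simp add: F_def)
  qed
  also have "\<dots> = (\<integral>\<^sup>+r. \<integral>\<^sup>+x. F x r \<partial>lborel \<partial>lborel)"
    using lborel_pair.Fubini'[OF m] by simp
  also have "\<dots> = (\<integral>\<^sup>+r. ennreal (Gamma ((1 + s) / 2) / 2 * r powr (-((1 + s) / 2)) * exp (- c\<^sup>2 * r)) * indicator {0<..} r \<partial>lborel)"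
  proof (intro nn_integral_cong)
    fix r :: real
    show "(\<integral>\<^sup>+x. F x r \<partial>lborel) = ennreal (Gamma ((1 + s) / 2) / 2 * r powr (-((1 + s) / 2)) * exp (- c\<^sup>2 * r)) * indicator {0<..} r"
    proof (cases "r > 0")
      case True
      have "((\<lambda>x. exp (- c\<^sup>2 * r) * (x powr s * exp (- r * x\<^sup>2))) has_integral
          exp (- c\<^sup>2 * r) * (Gamma ((1 + s) / 2) / 2 * r powr (-((1 + s) / 2)))) {0<..}"
        by (intro has_integral_mult_right Gamma_gaussian True s)
      from nn_integral_has_integral_lebesgue'[OF _ this]
      have "(\<integral>\<^sup>+x. ennreal (exp (- c\<^sup>2 * r) * (x powr s * exp (- r * x\<^sup>2))) * indicator {0<..} x \<partial>lborel) =
        ennreal (exp (- c\<^sup>2 * r) * (Gamma ((1 + s) / 2) / 2 * r powr (-((1 + s) / 2))))" by simp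
      also have "(\<integral>\<^sup>+x. ennreal (exp (- c\<^sup>2 * r) * (x powr s * exp (- r * x\<^sup>2))) * indicator {0<..} x \<partial>lborel) =
        (\<integral>\<^sup>+x. F x r \<partial>lborel)"
        using True by (intro nn_integral_cong)
          (auto simp: F_def indicator_def algebra_simps exp_diff exp_minus divide_inverse)
      finally show ?thesis using True by (simp add: mult_ac)
    qed (simp add: F_def)
  qed
  also have "\<dots> = ennreal (Gamma ((1 + s) / 2) / 2 * (Gamma ((1 - s) / 2) * (c\<^sup>2) powr (-((1 - s) / 2))))"
  proof -
    have "((\<lambda>r. Gamma ((1 + s) / 2) / 2 * (r powr ((1 - s) / 2 - 1) * exp (- c\<^sup>2 * r))) has_integral
        Gamma ((1 + s) / 2) / 2 * (Gamma ((1 - s) / 2) * (c\<^sup>2) powr (-((1 - s) / 2)))) {0<..}"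
      by (intro has_integral_mult_right Gamma_scaled) (use s c in auto)
    moreover have "(1 - s) / 2 - 1 = - ((1 + s) / 2)" by (simp add: field_simps)
    moreover have "Gamma ((1 + s) / 2) > 0" using s by (intro Gamma_real_pos) auto
    ultimately show ?thesis
      using nn_integral_has_integral_lebesgue'[where \<Omega> = "{0<..}" and
        f = "\<lambda>r. Gamma ((1 + s) / 2) / 2 * (r powr ((1 - s) / 2 - 1) * exp (- c\<^sup>2 * r))"]
      by (simp add: mult_ac)
  qed
  also have "(c\<^sup>2) powr (-((1 - s) / 2)) = c powr (s - 1)"
  proof -
    have "c\<^sup>2 = c powr 2" using c by simp
    moreover have "2 * (-((1 - s) / 2)) = s - 1" by (simp add: field_simps)
    ultimately show ?thesis by (simp only: powr_powr)
  qed
  finally show ?thesis by (simp add: mult_ac)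
qed

text \<open>Half of \<open>u * (1 - u)\<close> is the Peano kernel of the trapezoidal rule on
  \<open>[0, 1]\<close>, here applied to \<open>exp (- u * x)\<close>, whose second derivative is
  \<open>x^2\<close> times itself. The sign of the kernel lets the later interchanges of sums and
  integrals rest on Tonelli alone.\<close>

lemma has_integral_bernoulli_exp:
  fixes x :: real
  assumes x: "x > 0"
  shows "((\<lambda>u. u * (1 - u) * exp (- u * x)) has_integral
     (2 / x\<^sup>2 * ((1 + exp (-x)) / 2 - (1 - exp (-x)) / x))) {0..1}"
proof -
  define G where "G = (\<lambda>u. exp (- u * x) * (u\<^sup>2 / x + u * (2 / x\<^sup>2 - 1 / x) + (2 / x^3 - 1 / x\<^sup>2)))"
  have "((\<lambda>u. u * (1 - u) * exp (- u * x)) has_integral (G 1 - G 0)) {0..1}"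
  proof (rule fundamental_theorem_of_calculus)
    fix u :: real
    have "(G has_real_derivative u * (1 - u) * exp (- u * x)) (at u within {0..1})"
      unfolding G_def using x
      by (auto intro!: derivative_eq_intros simp: field_simps power2_eq_square power3_eq_cube)
    thus "(G has_vector_derivative u * (1 - u) * exp (- u * x)) (at u within {0..1})"
      by (simp add: has_real_derivative_iff_has_vector_derivative)
  qed simp
  also have "G 1 - G 0 = 2 / x\<^sup>2 * ((1 + exp (-x)) / 2 - (1 - exp (-x)) / x)"
    using x by (simp add: G_def field_simps power2_eq_square power3_eq_cube)
  finally show ?thesis .
qed

text \<open>The trapezoidal error for the integral of \<open>v powr (-s)\<close> over
  \<open>[a, a + 1]\<close>, without the factor \<open>s - 1\<close> of \<open>zeta_term\<close>.
  For \<open>s < 0\<close> also \<open>a = 0\<close> makes sense, and that term accounts for the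
  summand \<open>(s + 1) / 2\<close> of \<open>zeta_reg\<close>.\<close>

definition zeta_trap :: "real \<Rightarrow> real \<Rightarrow> real" where
  "zeta_trap s a = (a powr (-s) + (a + 1) powr (-s)) / 2 - ((a + 1) powr (1 - s) - a powr (1 - s)) / (1 - s)"

text \<open>The same Peano kernel, applied to \<open>v powr (-s)\<close> with second derivative
  \<open>s * (s + 1) * v powr (-s - 2)\<close>. For \<open>n = 0\<close> the integrand is unbounded
  at the left endpoint; hence the fundamental theorem with derivatives in the interior only, and the
  case distinction in \<open>G\<close>, which keeps the antiderivative visibly continuous.\<close>

lemma has_integral_bernoulli_powr:
  fixes s :: real
  assumes s: "-1 < s" "s < 0"
  shows "((\<lambda>u. u * (1 - u) * (real n + u) powr (-s - 2)) has_integral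
     (2 / (s * (s + 1)) * zeta_trap s (real n))) {0..1}"
proof -
  define G where "G = (\<lambda>u. - ((real n + u) powr (1 - s) / (1 - s)) - (2 * real n + 1) * (real n + u) powr (-s) / s
      + (if n = 0 then 0 else real n * (real n + 1) * (real n + u) powr (-s - 1) / (s + 1)))"
  have "((\<lambda>u. u * (1 - u) * (real n + u) powr (-s - 2)) has_integral (G 1 - G 0)) {0..1}"
  proof (rule fundamental_theorem_of_calculus_interior)
    show "continuous_on {0..1} G" 
      unfolding G_def using s by (cases "n = 0") (auto intro!: continuous_intros continuous_on_powr')
    fix u :: real assume u: "u \<in> {0<..<1}"
    define v where "v = real n + u"
    have v: "v > 0" using u by (auto simp: v_def)
    have e: "v powr (-s - 1) = v powr (-s - 2) * v" "v powr (-s) = v powr (-s - 2) * v^2"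
      using v by (simp_all add: powr_diff power2_eq_square)
    have P: "((\<lambda>u. (real n + u) powr c) has_real_derivative c * v powr (c - 1)) (at u)" for c
      using v unfolding v_def by (auto intro!: derivative_eq_intros)
    have d: "((\<lambda>u. - ((real n + u) powr (1 - s) / (1 - s)) - (2 * real n + 1) * (real n + u) powr (-s) / s
      + real n * (real n + 1) * (real n + u) powr (-s - 1) / (s + 1)) has_real_derivative
       - ((1 - s) * v powr (1 - s - 1) / (1 - s)) - (2 * real n + 1) * (-s * v powr (-s - 1)) / s
      + real n * (real n + 1) * ((-s - 1) * v powr (-s - 1 - 1)) / (s + 1)) (at u)"
      by (rule DERIV_add DERIV_diff DERIV_minus DERIV_cdivide DERIV_cmult P)+
    also have "- ((1 - s) * v powr (1 - s - 1) / (1 - s)) - (2 * real n + 1) * (-s * v powr (-s - 1)) / s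
      + real n * (real n + 1) * ((-s - 1) * v powr (-s - 1 - 1)) / (s + 1)
      = -(v powr (-s)) + (2 * real n + 1) * v powr (-s - 1) - real n * (real n + 1) * v powr (-s - 2)"
    proof -
      have "(1 - s) * v powr (1 - s - 1) / (1 - s) = v powr (-s)" using s by simp
      moreover have "(2 * real n + 1) * (-s * v powr (-s - 1)) / s = - ((2 * real n + 1) * v powr (-s - 1))"
        using s by simp
      moreover have "real n * (real n + 1) * ((-s - 1) * v powr (-s - 1 - 1)) / (s + 1) = - real n * (real n + 1) * v powr (-s - 2)"
        using s by (simp add: field_simps)
      ultimately show ?thesis by simp
    qed
    also have "\<dots> = u * (1 - u) * v powr (-s - 2)"
    proof -
      define Y where "Y = v powr (-s - 2)"
      show ?thesis unfolding e Y_def [symmetric] unfolding v_def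
        by (simp add: algebra_simps power2_eq_square)
    qed
    finally have "(G has_real_derivative u * (1 - u) * v powr (-s - 2)) (at u)"
      unfolding G_def by (cases "n = 0") simp_all
    thus "(G has_vector_derivative u * (1 - u) * (real n + u) powr (-s - 2)) (at u)"
      by (simp add: has_real_derivative_iff_has_vector_derivative v_def)
  qed simp
  also have "G 1 - G 0 = 2 / (s * (s + 1)) * zeta_trap s (real n)"
  proof -
    define a b where "a = real n" and "b = real n + 1"
    define A B where "A = a powr (-s)" and "B = b powr (-s)"
    have b: "b > 0" by (simp add: b_def)
    have 1: "b powr (1 - s) = b * B" using b by (simp add: B_def powr_diff powr_minus divide_simps)
    have 2: "a powr (1 - s) = a * A" by (cases "n = 0") (simp_all add: a_def A_def powr_diff powr_minus divide_simps)
    have 3: "(if n = 0 then 0 else a * b * b powr (-s - 1)) = a * B"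
      using b by (simp add: a_def B_def powr_diff powr_minus divide_simps)
    have 4: "(if n = 0 then 0 else a * b * a powr (-s - 1)) = (if n = 0 then 0 else b * A)"
      by (simp add: a_def A_def powr_diff powr_minus divide_simps)
    have 5: "(if n = 0 then 0 else b * A) = b * A" using s by (auto simp: A_def a_def)
    have "G 1 - G 0 = (- (b * B / (1 - s)) - (a + b) * B / s + a * B / (s + 1)) - (- (a * A / (1 - s)) - (a + b) * A / s + b * A / (s + 1))"
    proof -
      have "G 1 = - (b powr (1 - s) / (1 - s)) - (a + b) * B / s + (if n = 0 then 0 else a * b * b powr (-s - 1)) / (s + 1)"
        by (simp add: G_def a_def b_def B_def)
      moreover have "G 0 = - (a powr (1 - s) / (1 - s)) - (a + b) * A / s + (if n = 0 then 0 else a * b * a powr (-s - 1)) / (s + 1)"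
        by (simp add: G_def a_def b_def A_def)
      ultimately show ?thesis unfolding 1 2 3 4 5 by simp
    qed
    also have "b = a + 1" by (simp add: a_def b_def)
    also have "(- ((a+1) * B / (1 - s)) - (a + (a+1)) * B / s + a * B / (s + 1)) - (- (a * A / (1 - s)) - (a + (a+1)) * A / s + (a+1) * A / (s + 1))
      = 2 / (s * (s + 1)) * ((A + B) / 2 - ((a+1) * B - a * A) / (1 - s))"
      using s by (simp add: divide_simps) (simp add: algebra_simps)
    also have "(A + B) / 2 - ((a+1) * B - a * A) / (1 - s) = zeta_trap s (real n)"
      using 1 2 by (simp add: zeta_trap_def a_def b_def A_def B_def add_ac)
    finally show ?thesis .
  qed
  finally show ?thesis .
qed

lemma zeta_trap_sums:
  assumes s: "-1 < s" "s < 0"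
  shows "(\<lambda>n. zeta_trap s (real n)) sums (Re (zeta_reg (of_real s)) / (s - 1))"
proof -
  have "(\<lambda>n. zeta_term n (of_real s)) sums (zeta_reg (of_real s) - (of_real s + 1) / 2)"
    unfolding zeta_reg_def using s by (simp add: summable_sums summable_zeta_term)
  hence "(\<lambda>n. Re (zeta_term n (of_real s)) / (s - 1)) sums (Re (zeta_reg (of_real s) - (of_real s + 1) / 2) / (s - 1))"
    by (intro sums_divide sums_Re)
  moreover have "Re (zeta_term n (of_real s)) / (s - 1) = zeta_trap s (real (Suc n))" for n
    unfolding zeta_term_of_real zeta_trap_def using s 
    by (simp add: add_ac) (simp add: field_simps)
  moreover have "Re (zeta_reg (of_real s) - (of_real s + 1) / 2) / (s - 1) = Re (zeta_reg (of_real s)) / (s - 1) - zeta_trap s (real 0)"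
  proof -
    have "zeta_trap s (real 0) = (s + 1) / 2 / (s - 1)"
      using s by (simp add: zeta_trap_def divide_simps) (simp add: algebra_simps)
    thus ?thesis by (simp add: diff_divide_distrib)
  qed
  ultimately have "(\<lambda>n. zeta_trap s (real (Suc n))) sums (Re (zeta_reg (of_real s)) / (s - 1) - zeta_trap s (real 0))"
    by (simp del: of_nat_Suc)
  from sums_Suc[OF this] show ?thesis by simp
qed

text \<open>
  Both sides are the Mellin transform of \<open>1 / (exp x - 1) - 1 / x + 1 / 2\<close>, which is expanded in
  powers of \<open>exp (- x)\<close> for the left-hand side and in partial fractions for the right-hand side. For
  real \<open>s\<close> in this interval all terms are nonnegative.
\<close>

lemma zeta_functional_real:
  fixes s :: real
  assumes s: "-1 < s" "s < 0"
  shows "Gamma s * (Re (zeta_reg (of_real s)) / (s - 1)) =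
    (2 * pi) powr (s - 1) * Gamma ((1 + s) / 2) * Gamma ((1 - s) / 2) * (Re (zeta_reg (of_real (1 - s))) / (- s))"
proof -
  \<comment> \<open>The interval for \<open>s\<close> is that of convergence: \<open>K x\<close> is
    of order \<open>x\<close> near \<open>0\<close> and tends to \<open>1 / 2\<close> at
    infinity.\<close>
  define K where "K = (\<lambda>x::real. 1 / (exp x - 1) - 1 / x + 1 / 2)"
  define I where "I = (\<integral>\<^sup>+x. ennreal (K x * x powr (s - 1)) * indicator {0<..} x \<partial>lborel)"
  have Gs: "Gamma (s + 2) = (s + 1) * s * Gamma s"
  proof -
    have "Gamma (s + 1 + 1) = (s + 1) * Gamma (s + 1)" using s by (intro Gamma_plus1) (auto elim!: nonpos_Ints_cases)
    moreover have "Gamma (s + 1) = s * Gamma s" using s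
    proof (intro Gamma_plus1 notI)
      assume "s \<in> \<int>\<^sub>\<le>\<^sub>0"
      then obtain k :: int where "s = of_int k" by (auto elim: nonpos_Ints_cases)
      thus False using s by simp
    qed
    ultimately show ?thesis by (simp add: add_ac)
  qed
  have Gpos: "Gamma (s + 2) > 0" using s by (intro Gamma_real_pos) auto
  \<comment> \<open>Integrated over \<open>u\<close> and summed over \<open>n\<close>,
    \<open>F n x u\<close> gives \<open>K x * x powr (s - 1)\<close> for \<open>x > 0\<close>.
    Integrated over \<open>x\<close> first, and then over \<open>u\<close>, it gives
    \<open>Gamma s * zeta_trap s n\<close>.\<close>
  define F where "F = (\<lambda>n x u::real. ennreal (1/2 * u * (1 - u) * (x powr (s + 1) * exp (- (real n + u) * x)) * indicator {0<..} x * indicator {0..1} u))"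
  have m: "case_prod (F n) \<in> borel_measurable (lborel \<Otimes>\<^sub>M lborel)" for n
    unfolding F_def by measurable
  have m1: "(\<lambda>x. \<integral>\<^sup>+u. F n x u \<partial>lborel) \<in> borel_measurable lborel" for n
    using lborel.borel_measurable_nn_integral[OF m] by simp
  have tr: "Gamma s * zeta_trap s (real n) \<ge> 0" and 
    in1: "(\<integral>\<^sup>+x. \<integral>\<^sup>+u. F n x u \<partial>lborel \<partial>lborel) = ennreal (Gamma s * zeta_trap s (real n))" for n
  proof -
    have hi: "((\<lambda>u. Gamma (s + 2) / 2 * (u * (1 - u) * (real n + u) powr (-s - 2))) has_integral
        Gamma (s + 2) / 2 * (2 / (s * (s + 1)) * zeta_trap s (real n))) {0..1}"
      by (intro has_integral_mult_right has_integral_bernoulli_powr s)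
    also have v: "Gamma (s + 2) / 2 * (2 / (s * (s + 1)) * zeta_trap s (real n)) = Gamma s * zeta_trap s (real n)"
      unfolding Gs using s by simp
    finally have hi: "((\<lambda>u. Gamma (s + 2) / 2 * (u * (1 - u) * (real n + u) powr (-s - 2))) has_integral
        Gamma s * zeta_trap s (real n)) {0..1}" .
    show "Gamma s * zeta_trap s (real n) \<ge> 0"
      by (rule has_integral_nonneg[OF hi]) (use Gpos in auto)
    have "(\<integral>\<^sup>+x. \<integral>\<^sup>+u. F n x u \<partial>lborel \<partial>lborel) = (\<integral>\<^sup>+u. \<integral>\<^sup>+x. F n x u \<partial>lborel \<partial>lborel)"
      using lborel_pair.Fubini'[OF m] by simp
    also have "\<dots> = (\<integral>\<^sup>+u. ennreal (Gamma (s + 2) / 2 * (u * (1 - u) * (real n + u) powr (-s - 2))) * indicator {0..1} u \<partial>lborel)"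
    proof (intro nn_integral_cong)
      fix u :: real
      consider "u \<notin> {0..1}" | "u = 0" | "u \<in> {0<..1}" by fastforce
      thus "(\<integral>\<^sup>+x. F n x u \<partial>lborel) = ennreal (Gamma (s + 2) / 2 * (u * (1 - u) * (real n + u) powr (-s - 2))) * indicator {0..1} u"
      proof cases
        case 3
        have "((\<lambda>x. 1/2 * u * (1 - u) * (x powr (s + 2 - 1) * exp (- (real n + u) * x))) has_integral
          1/2 * u * (1 - u) * (Gamma (s + 2) * (real n + u) powr (-(s + 2)))) {0<..}"
          by (intro has_integral_mult_right Gamma_scaled) (use s 3 in auto)
        from nn_integral_has_integral_lebesgue'[OF _ this] 3
        have "(\<integral>\<^sup>+x. ennreal (1/2 * u * (1 - u) * (x powr (s + 2 - 1) * exp (- (real n + u) * x))) * indicator {0<..} x \<partial>lborel) =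
          ennreal (1/2 * u * (1 - u) * (Gamma (s + 2) * (real n + u) powr (-(s + 2))))" by simp
        also have "(\<integral>\<^sup>+x. ennreal (1/2 * u * (1 - u) * (x powr (s + 2 - 1) * exp (- (real n + u) * x))) * indicator {0<..} x \<partial>lborel) =
           (\<integral>\<^sup>+x. F n x u \<partial>lborel)"
          using 3 by (intro nn_integral_cong) (auto simp: F_def indicator_def add_ac)
        finally show ?thesis using 3 by (simp add: mult_ac)
      qed (auto simp: F_def)
    qed
    also have "\<dots> = ennreal (Gamma s * zeta_trap s (real n))"
      by (rule nn_integral_has_integral_lebesgue'[OF _ hi]) (use Gpos in auto)
    finally show "(\<integral>\<^sup>+x. \<integral>\<^sup>+u. F n x u \<partial>lborel \<partial>lborel) = ennreal (Gamma s * zeta_trap s (real n))" .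
  qed
  have "I = (\<integral>\<^sup>+x. (\<Sum>n. \<integral>\<^sup>+u. F n x u \<partial>lborel) \<partial>lborel)"
    unfolding I_def
  proof (intro nn_integral_cong)
    fix x :: real
    show "ennreal (K x * x powr (s - 1)) * indicator {0<..} x = (\<Sum>n. \<integral>\<^sup>+u. F n x u \<partial>lborel)"
    proof (cases "x > 0")
      case True
      define k where "k = (1 + exp (-x)) / 2 - (1 - exp (-x)) / x"
      have hi: "((\<lambda>u. 1/2 * x powr (s + 1) * exp (- real n * x) * (u * (1 - u) * exp (- u * x))) has_integral
        1/2 * x powr (s + 1) * exp (- real n * x) * (2 / x\<^sup>2 * k)) {0..1}" for n
        unfolding k_def by (intro has_integral_mult_right has_integral_bernoulli_exp True)
      have v: "1/2 * x powr (s + 1) * exp (- real n * x) * (2 / x\<^sup>2 * k) = x powr (s - 1) * k * exp (-x) ^ n" for n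
        using True by (simp add: powr_add powr_diff exp_of_nat_mult [symmetric] power2_eq_square)
      have k0: "x powr (s - 1) * k * exp (-x) ^ n \<ge> 0" for n
        unfolding v[symmetric] by (rule has_integral_nonneg[OF hi]) auto
      have "(\<integral>\<^sup>+u. F n x u \<partial>lborel) = ennreal (x powr (s - 1) * k * exp (-x) ^ n)" for n
      proof -
        have "(\<integral>\<^sup>+u. F n x u \<partial>lborel) = (\<integral>\<^sup>+u. ennreal (1/2 * x powr (s + 1) * exp (- real n * x) * (u * (1 - u) * exp (- u * x))) * indicator {0..1} u \<partial>lborel)"
          using True by (intro nn_integral_cong) (auto simp: F_def indicator_def algebra_simps diff_divide_distrib exp_add[symmetric])
        also have "\<dots> = ennreal (x powr (s - 1) * k * exp (-x) ^ n)"
          unfolding v[symmetric] by (rule nn_integral_has_integral_lebesgue'[OF _ hi]) auto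
        finally show ?thesis .
      qed
      moreover have "(\<Sum>n. ennreal (x powr (s - 1) * k * exp (-x) ^ n)) = ennreal (x powr (s - 1) * k * (1 / (1 - exp (-x))))"
        by (intro suminf_ennreal_eq k0 sums_mult geometric_sums) (use True in auto)
      moreover have "x powr (s - 1) * k * (1 / (1 - exp (-x))) = K x * x powr (s - 1)"
      proof -
        have "exp x \<noteq> 1" "exp x \<noteq> 0" using True by auto
        hence "k * (1 / (1 - exp (-x))) = K x"
          using True by (simp add: k_def K_def exp_minus divide_simps) (simp add: algebra_simps)
        thus ?thesis by (simp only: mult.assoc) (simp add: mult.commute)
      qed
      ultimately show ?thesis using True by simp
    qed (simp add: F_def)
  qed
  also have "\<dots> = (\<Sum>n. \<integral>\<^sup>+x. \<integral>\<^sup>+u. F n x u \<partial>lborel \<partial>lborel)"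
    by (rule nn_integral_suminf) (rule m1)
  also have "\<dots> = ennreal (Gamma s * (Re (zeta_reg (of_real s)) / (s - 1)))"
    unfolding in1 by (intro suminf_ennreal_eq tr sums_mult zeta_trap_sums s)
  finally have I1: "I = ennreal (Gamma s * (Re (zeta_reg (of_real s)) / (s - 1)))" .

  define C where "C = Gamma ((1 + s) / 2) * Gamma ((1 - s) / 2)"
  have C: "C > 0" unfolding C_def using s by (intro mult_pos_pos Gamma_real_pos) auto
  define c where "c = (\<lambda>n. 2 * pi * real (Suc n))"
  have c: "c n > 0" for n by (simp add: c_def)
  have "I = (\<integral>\<^sup>+x. (\<Sum>n. ennreal (2 * (x powr s / (x\<^sup>2 + (c n)\<^sup>2))) * indicator {0<..} x) \<partial>lborel)"
    unfolding I_def
  proof (intro nn_integral_cong)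
    fix x :: real
    show "ennreal (K x * x powr (s - 1)) * indicator {0<..} x = (\<Sum>n. ennreal (2 * (x powr s / (x\<^sup>2 + (c n)\<^sup>2))) * indicator {0<..} x)"
    proof (cases "x > 0")
      case True
      have "(\<lambda>n. x powr (s - 1) * (2 * x / (x\<^sup>2 + (c n)\<^sup>2))) sums (x powr (s - 1) * K x)"
        unfolding c_def K_def by (intro sums_mult sums_bernoulli_kernel True)
      moreover have "x powr (s - 1) * (2 * x / (x\<^sup>2 + (c n)\<^sup>2)) = 2 * (x powr s / (x\<^sup>2 + (c n)\<^sup>2))" for n
        using True by (simp add: powr_diff)
      ultimately have "(\<lambda>n. 2 * (x powr s / (x\<^sup>2 + (c n)\<^sup>2))) sums (K x * x powr (s - 1))"
        by (simp only: mult.commute[of "K x"])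
      hence "(\<Sum>n. ennreal (2 * (x powr s / (x\<^sup>2 + (c n)\<^sup>2)))) = ennreal (K x * x powr (s - 1))"
        by (rule suminf_ennreal_eq[rotated]) auto
      thus ?thesis using True by simp
    qed simp
  qed
  also have "\<dots> = (\<Sum>n. \<integral>\<^sup>+x. ennreal (2 * (x powr s / (x\<^sup>2 + (c n)\<^sup>2))) * indicator {0<..} x \<partial>lborel)"
    by (rule nn_integral_suminf) measurable
  also have "\<dots> = (\<Sum>n. ennreal ((2 * pi) powr (s - 1) * C * real (Suc n) powr (-(1 - s))))"
  proof (intro suminf_cong)
    fix n
    have "(\<integral>\<^sup>+x. ennreal (2 * (x powr s / (x\<^sup>2 + (c n)\<^sup>2))) * indicator {0<..} x \<partial>lborel) =
      (\<integral>\<^sup>+x. ennreal 2 * (ennreal (x powr s / (x\<^sup>2 + (c n)\<^sup>2)) * indicator {0<..} x) \<partial>lborel)"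
    proof (intro nn_integral_cong)
      fix x :: real
      have "ennreal (2 * (x powr s / (x\<^sup>2 + (c n)\<^sup>2))) = ennreal 2 * ennreal (x powr s / (x\<^sup>2 + (c n)\<^sup>2))"
        by (rule ennreal_mult') simp
      thus "ennreal (2 * (x powr s / (x\<^sup>2 + (c n)\<^sup>2))) * indicator {0<..} x =
          ennreal 2 * (ennreal (x powr s / (x\<^sup>2 + (c n)\<^sup>2)) * indicator {0<..} x)"
        by (simp only: mult.assoc)
    qed
    also have "\<dots> = ennreal 2 * (\<integral>\<^sup>+x. ennreal (x powr s / (x\<^sup>2 + (c n)\<^sup>2)) * indicator {0<..} x \<partial>lborel)"
      by (rule nn_integral_cmult) measurable
    also have "\<dots> = ennreal 2 * ennreal (C / 2 * c n powr (s - 1))"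
      using s c[of n] unfolding C_def by (subst nn_integral_powr_over_quadratic) auto
    also have "\<dots> = ennreal (2 * (C / 2 * c n powr (s - 1)))"
      by (rule ennreal_mult' [symmetric]) simp
    also have "2 * (C / 2 * c n powr (s - 1)) = (2 * pi) powr (s - 1) * C * real (Suc n) powr (-(1 - s))"
      by (simp add: c_def powr_mult del: of_nat_Suc)
    finally show "(\<integral>\<^sup>+x. ennreal (2 * (x powr s / (x\<^sup>2 + (c n)\<^sup>2))) * indicator {0<..} x \<partial>lborel) = 
      ennreal ((2 * pi) powr (s - 1) * C * real (Suc n) powr (-(1 - s)))" .
  qed
  also have "\<dots> = ennreal ((2 * pi) powr (s - 1) * C * (Re (zeta_reg (of_real (1 - s))) / (- s)))"
  proof (intro suminf_ennreal_eq sums_mult)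
    have "(\<lambda>n. of_nat (Suc n) powr (-of_real (1 - s))) sums (zeta_reg (of_real (1 - s)) / (of_real (1 - s) - 1))"
      using zeta_reg_sums[of "of_real (1 - s)"] s by simp
    also have "(\<lambda>n. of_nat (Suc n) powr (-of_real (1 - s))) = (\<lambda>n. complex_of_real (real (Suc n) powr (-(1 - s))))"
    proof
      fix n show "of_nat (Suc n) powr (-of_real (1 - s)) = complex_of_real (real (Suc n) powr (-(1 - s)))"
        using powr_of_real[of "real (Suc n)" "-(1 - s)"] 
        by (metis of_nat_0_le_iff of_real_minus of_real_of_nat_eq)
    qed
    also have "zeta_reg (of_real (1 - s)) / (of_real (1 - s) - 1) = complex_of_real (Re (zeta_reg (of_real (1 - s))) / (- s))"
      using zeta_reg_of_real[of "1 - s"] s by simp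
    finally show "(\<lambda>n. real (Suc n) powr (-(1 - s))) sums (Re (zeta_reg (of_real (1 - s))) / (- s))"
      unfolding sums_of_real_iff .
  qed (use C in auto)
  finally have I2: "I = ennreal ((2 * pi) powr (s - 1) * C * (Re (zeta_reg (of_real (1 - s))) / (- s)))" .
  have "(2 * pi) powr (s - 1) * C * (Re (zeta_reg (of_real (1 - s))) / (- s)) \<ge> 0"
    using C s zeta_reg_real_pos[of "1 - s"] by (intro mult_nonneg_nonneg divide_nonneg_nonneg) auto
  moreover have "Gamma s * (Re (zeta_reg (of_real s)) / (s - 1)) \<ge> 0"
    by (rule sums_le[OF tr sums_zero sums_mult[OF zeta_trap_sums[OF s]]])
  ultimately show ?thesis using I1 I2 unfolding C_def by (simp add: mult_ac)
qed

section \<open>The completed zeta function\<close>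

text \<open>Riemann's xi function, with the factor \<open>s / 2\<close> absorbed into
  \<open>Gamma (s / 2 + 1)\<close> and \<open>s - 1\<close> into \<open>zeta_reg\<close>. The
  formula represents it only for \<open>Re s > -1\<close>, where \<open>zeta_reg\<close> is known to
  be holomorphic; \<open>Xi\<close> glues it to its reflection, and the dividing line
  \<open>Re s = 0\<close> is one choice inside the strip where both agree.\<close>

definition xi_half :: "complex \<Rightarrow> complex" where
  "xi_half s = zeta_reg s * Gamma (s / 2 + 1) * of_real pi powr (- s / 2)"

definition Xi :: "complex \<Rightarrow> complex" where
  "Xi s = (if Re s > 0 then xi_half s else xi_half (1 - s))"

lemma Re_pos_not_nonpos_Ints: "Re z > 0 \<Longrightarrow> z \<notin> \<int>\<^sub>\<le>\<^sub>0"
  by (auto elim!: nonpos_Ints_cases)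

lemma Gamma_legendre_duplication_real:
  fixes s :: real
  assumes "s / 2 \<notin> \<int>\<^sub>\<le>\<^sub>0" "(1 + s) / 2 \<notin> \<int>\<^sub>\<le>\<^sub>0"
  shows "Gamma (s / 2) * Gamma ((1 + s) / 2) = 2 powr (1 - s) * sqrt pi * Gamma s"
proof -
  have e: "complex_of_real (s / 2) + 1 / 2 = of_real ((1 + s) / 2)" "2 * complex_of_real (s / 2) = of_real s"
    by (simp_all add: field_simps)
  have n: "complex_of_real x \<notin> \<int>\<^sub>\<le>\<^sub>0" if "x \<notin> \<int>\<^sub>\<le>\<^sub>0" for x
  proof
    assume "complex_of_real x \<in> \<int>\<^sub>\<le>\<^sub>0"
    then obtain k where "k \<le> 0" "complex_of_real x = of_int k" by (auto elim!: nonpos_Ints_cases)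
    hence "x = of_int k" by (metis of_real_eq_iff of_real_of_int_eq)
    thus False using that \<open>k \<le> 0\<close> by (simp add: nonpos_Ints_of_int)
  qed
  have "Gamma (complex_of_real (s / 2)) * Gamma (complex_of_real (s / 2) + 1 / 2) = 
      exp ((1 - 2 * complex_of_real (s / 2)) * of_real (ln 2)) * of_real (sqrt pi) * Gamma (2 * complex_of_real (s / 2))"
    by (rule Gamma_legendre_duplication) (use assms in \<open>simp_all only: e n not_False_eq_True\<close>)
  also have "exp ((1 - 2 * complex_of_real (s / 2)) * of_real (ln 2)) = of_real (2 powr (1 - s))"
    by (simp add: powr_def exp_of_real [symmetric])
  finally show ?thesis
    unfolding e Gamma_complex_of_real of_real_mult [symmetric] of_real_eq_iff .
qed

text \<open>Legendre's duplication formula splits \<open>Gamma s\<close> into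
  \<open>Gamma (s / 2)\<close> and \<open>Gamma ((1 + s) / 2)\<close>. The second factor occurs on
  both sides of \<open>zeta_functional_real\<close> and cancels, which leaves the symmetric
  form.\<close>

lemma xi_half_functional_real:
  fixes s :: real
  assumes s: "-1 < s" "s < 0"
  shows "xi_half (of_real s) = xi_half (1 - of_real s)"
proof -
  have ni: "s / 2 \<notin> \<int>\<^sub>\<le>\<^sub>0" "(1 + s) / 2 \<notin> \<int>\<^sub>\<le>\<^sub>0" "(1 - s) / 2 \<notin> \<int>\<^sub>\<le>\<^sub>0"
    using s by (auto elim!: nonpos_Ints_cases)
  define P where "P = Gamma ((1 + s) / 2)"
  define Z0 where "Z0 = Re (zeta_reg (of_real s))"
  define Z1 where "Z1 = Re (zeta_reg (of_real (1 - s)))"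
  have P: "P > 0" unfolding P_def using s by (intro Gamma_real_pos) auto
  have dup: "Gamma s = Gamma (s / 2) * P * 2 powr (s - 1) / sqrt pi"
  proof -
    have "Gamma (s / 2) * P * 2 powr (s - 1) / sqrt pi = (2 powr (1 - s) * 2 powr (s - 1)) * Gamma s"
      unfolding P_def using Gamma_legendre_duplication_real[OF ni(1,2)] by simp
    also have "(2::real) powr (1 - s) * 2 powr (s - 1) = 1" by (simp add: powr_add [symmetric])
    finally show ?thesis by simp
  qed
  have G1: "Gamma (s / 2 + 1) = s / 2 * Gamma (s / 2)" by (rule Gamma_plus1) (fact ni)
  have G2: "Gamma ((1 - s) / 2 + 1) = (1 - s) / 2 * Gamma ((1 - s) / 2)" by (rule Gamma_plus1) (fact ni)
  have "Gamma (s / 2) * P * 2 powr (s - 1) / sqrt pi * (Z0 / (s - 1)) =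
    (2 * pi) powr (s - 1) * P * Gamma ((1 - s) / 2) * (Z1 / (- s))"
    using zeta_functional_real[OF s] unfolding dup P_def Z0_def Z1_def .
  also have "(2 * pi) powr (s - 1) = 2 powr (s - 1) * pi powr (s - 1)" by (simp add: powr_mult)
  finally have "(P * 2 powr (s - 1)) * (Gamma (s / 2) / sqrt pi * (Z0 / (s - 1))) =
      (P * 2 powr (s - 1)) * (pi powr (s - 1) * Gamma ((1 - s) / 2) * (Z1 / (- s)))"
    by (simp only: mult_ac times_divide_eq_right times_divide_eq_left)
  hence "Gamma (s / 2) / sqrt pi * (Z0 / (s - 1)) = pi powr (s - 1) * Gamma ((1 - s) / 2) * (Z1 / (- s))"
    using P by (subst (asm) mult_left_cancel) auto
  hence "Z0 * (s / 2 * Gamma (s / 2)) = Z1 * ((1 - s) / 2 * Gamma ((1 - s) / 2)) * (pi powr (s - 1) * sqrt pi)"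
    using s by (simp add: field_simps)
  hence *: "Z0 * Gamma (s / 2 + 1) = Z1 * Gamma ((1 - s) / 2 + 1) * (pi powr (s - 1) * sqrt pi)"
    unfolding G1 G2 .
  have p: "pi powr (s - 1) * sqrt pi * pi powr (-s / 2) = pi powr (- (1 - s) / 2)"
  proof -
    have "pi powr (s - 1) * sqrt pi * pi powr (-s / 2) = pi powr ((s - 1) + 1 / 2 + (- s / 2))"
      by (simp only: powr_add powr_half_sqrt[OF pi_ge_zero])
    also have "(s - 1) + 1 / 2 + (- s / 2) = - (1 - s) / 2" by (simp add: field_simps)
    finally show ?thesis .
  qed
  have xr: "xi_half (of_real x) = of_real (Re (zeta_reg (of_real x)) * Gamma (x / 2 + 1) * pi powr (-x / 2))" if "x > -1" for x
  proof -
    have "Gamma (complex_of_real x / 2 + 1) = of_real (Gamma (x / 2 + 1))"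
      using Gamma_complex_of_real[of "x / 2 + 1"] by simp
    moreover have "complex_of_real pi powr (- of_real x / 2) = of_real (pi powr (- x / 2))"
      using powr_of_real[of pi "-x/2"] by simp
    ultimately show ?thesis unfolding xi_half_def
      using zeta_reg_of_real[OF that] by simp
  qed
  have "xi_half (of_real s) = of_real (Z0 * Gamma (s / 2 + 1) * pi powr (-s / 2))"
    unfolding Z0_def by (rule xr) (use s in auto)
  also have "Z0 * Gamma (s / 2 + 1) * pi powr (-s / 2) = Z1 * Gamma ((1 - s) / 2 + 1) * pi powr (- (1 - s) / 2)"
    unfolding * mult.assoc p[unfolded mult.assoc] ..
  also have "complex_of_real \<dots> = xi_half (of_real (1 - s))"
    unfolding Z1_def by (rule xr [symmetric]) (use s in auto)
  finally show ?thesis by simp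
qed

lemma holomorphic_xi_half: "xi_half holomorphic_on {s. Re s > -1}"
  unfolding xi_half_def [abs_def]
  by (intro holomorphic_intros holomorphic_zeta_reg Re_pos_not_nonpos_Ints) auto

lemma holomorphic_xi_half': "(\<lambda>s. xi_half (1 - s)) holomorphic_on {s. Re s < 2}"
  by (rule holomorphic_on_compose_gen[OF _ holomorphic_xi_half, unfolded o_def])
     (auto intro!: holomorphic_intros)

text \<open>Both sides are holomorphic in the strip, so agreement on the real segment from
  \<open>-1\<close> to \<open>0\<close>, where the Mellin transform converges, propagates to all of
  it.\<close>

lemma xi_half_functional:
  assumes s: "-1 < Re s" "Re s < 2"
  shows "xi_half s = xi_half (1 - s)"
proof -
  define S where "S = {s. Re s > -1} \<inter> {s. Re s < 2}"
  define A where "A = complex_of_real ` {-1<..<0}"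
  have "xi_half s - xi_half (1 - s) = 0"
  proof (rule analytic_continuation[of "\<lambda>s. xi_half s - xi_half (1 - s)" S A "of_real (-1/2)"])
    show "(\<lambda>s. xi_half s - xi_half (1 - s)) holomorphic_on S" unfolding S_def
      by (intro holomorphic_intros holomorphic_on_subset[OF holomorphic_xi_half] holomorphic_on_subset[OF holomorphic_xi_half']) auto
    show "open S" unfolding S_def by (intro open_Int open_halfspace_Re_gt open_halfspace_Re_lt)
    show "connected S" unfolding S_def
      by (intro convex_connected convex_Int convex_halfspace_Re_gt convex_halfspace_Re_lt)
    show "A \<subseteq> S" by (auto simp: A_def S_def)
    show "of_real (-1/2) \<in> S" by (simp add: S_def)
    show "s \<in> S" using s by (simp add: S_def)
    show "complex_of_real (-1/2) islimpt A"
      unfolding islimpt_approachable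
    proof (intro allI impI)
      fix e :: real assume e: "e > 0"
      define d where "d = min e (1/2) / 2"
      have "d > 0" "d < e" "d < 1/2" using e by (auto simp: d_def min_def)
      hence "-1/2 + d \<in> {-1<..<0}" "dist (complex_of_real (-1/2 + d)) (of_real (-1/2)) < e"
        "complex_of_real (-1/2 + d) \<noteq> of_real (-1/2)"
        by (simp_all only: dist_of_real dist_real_def of_real_eq_iff) auto
      thus "\<exists>x'\<in>A. x' \<noteq> complex_of_real (-1/2) \<and> dist x' (complex_of_real (-1/2)) < e"
        unfolding A_def by blast
    qed
    show "xi_half z - xi_half (1 - z) = 0" if "z \<in> A" for z
      using that xi_half_functional_real by (auto simp: A_def)
  qed
  thus ?thesis by simp
qed

lemma Xi_eq: "Re s > -1 \<Longrightarrow> Xi s = xi_half s"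
  using xi_half_functional[of s] by (auto simp: Xi_def)

lemma Xi_eq': "Re s < 2 \<Longrightarrow> Xi s = xi_half (1 - s)"
  using xi_half_functional[of s] by (auto simp: Xi_def)

lemma Xi_functional: "Xi (1 - s) = Xi s"
  by (cases "Re s > -1") (simp_all add: Xi_eq Xi_eq')

lemma holomorphic_Xi: "Xi holomorphic_on A"
proof -
  have "Xi holomorphic_on ({s. Re s > -1} \<union> {s. Re s < 2})"
  proof (rule holomorphic_on_Un)
    show "Xi holomorphic_on {s. Re s > -1}"
      using holomorphic_xi_half by (rule holomorphic_transform) (simp add: Xi_eq)
    show "Xi holomorphic_on {s. Re s < 2}"
      using holomorphic_xi_half' by (rule holomorphic_transform) (simp add: Xi_eq')
  qed (auto intro: open_halfspace_Re_gt open_halfspace_Re_lt)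
  thus ?thesis by (rule holomorphic_on_subset) auto
qed

text \<open>The choice operator in \<open>zeta\<close> needs a witness. It is \<open>Xi\<close>
  stripped of its Gamma and \<open>pi\<close> factors; dividing by Gamma through the entire function
  \<open>rGamma\<close> leaves \<open>s = 1\<close> as the only exceptional point.\<close>

lemma zeta_spec:
  "zeta holomorphic_on (- {1}) \<and> (\<forall>s. Re s > 1 \<longrightarrow> (\<lambda>n. 1 / of_nat (Suc n) powr s) sums zeta s)"
proof -
  define f where "f = (\<lambda>s. Xi s * of_real pi powr (s / 2) * rGamma (s / 2 + 1) / (s - 1))"
  have "f holomorphic_on (- {1}) \<and> (\<forall>s. Re s > 1 \<longrightarrow> (\<lambda>n. 1 / of_nat (Suc n) powr s) sums f s)"
  proof (intro conjI allI impI)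
  show "f holomorphic_on - {1}"
    unfolding f_def by (intro holomorphic_intros holomorphic_Xi) auto
  fix s :: complex assume s: "Re s > 1"
  have "Gamma (s / 2 + 1) * rGamma (s / 2 + 1) = 1"
    using s Re_pos_not_nonpos_Ints[of "s / 2 + 1"] by (simp add: Gamma_def rGamma_eq_zero_iff)
  moreover have "of_real pi powr (- s / 2) * of_real pi powr (s / 2) = (1 :: complex)"
    by (simp add: powr_add [symmetric])
  moreover have "f s = zeta_reg s * (Gamma (s / 2 + 1) * rGamma (s / 2 + 1)) *
      (of_real pi powr (- s / 2) * of_real pi powr (s / 2)) / (s - 1)"
    using s unfolding f_def by (simp add: Xi_eq xi_half_def)
  ultimately have "f s = zeta_reg s / (s - 1)" by simp
  thus "(\<lambda>n. 1 / of_nat (Suc n) powr s) sums f s"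
    using zeta_reg_sums[OF s] by (simp add: powr_minus inverse_eq_divide)
  qed
  thus ?thesis unfolding zeta_def
    by (rule someI[where P = "\<lambda>f. f holomorphic_on (- {1}) \<and>
      (\<forall>s. Re s > 1 \<longrightarrow> (\<lambda>n. 1 / of_nat (Suc n) powr s) sums f s)"])
qed

lemma zeta_eq_zeta_reg:
  assumes s: "Re s > -1" "s \<noteq> 1"
  shows "zeta s = zeta_reg s / (s - 1)"
proof -
  define S where "S = {s. Re s > -1} - {1}"
  show ?thesis
  proof (rule analytic_continuation_open[of "{s. Re s > 1}" S zeta "\<lambda>s. zeta_reg s / (s - 1)"])
    show "open {s. 1 < Re s}" by (rule open_halfspace_Re_gt)
    show "open S" unfolding S_def by (intro open_Diff open_halfspace_Re_gt) auto
    show "{s. 1 < Re s} \<noteq> {}" by (auto intro: exI[of _ 2])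
    show "connected S" unfolding S_def
      by (intro connected_open_delete open_halfspace_Re_gt convex_connected convex_halfspace_Re_gt) auto
    show "{s. 1 < Re s} \<subseteq> S" by (auto simp: S_def)
    show "zeta holomorphic_on S"
      using zeta_spec unfolding S_def by (auto elim: holomorphic_on_subset)
    show "(\<lambda>s. zeta_reg s / (s - 1)) holomorphic_on S"
      unfolding S_def by (intro holomorphic_intros holomorphic_on_subset[OF holomorphic_zeta_reg]) auto
    show "zeta z = zeta_reg z / (z - 1)" if "z \<in> {s. 1 < Re s}" for z
    proof -
      have "(\<lambda>n. 1 / of_nat (Suc n) powr z) sums zeta z" using zeta_spec that by auto
      moreover have "(\<lambda>n. 1 / of_nat (Suc n) powr z) sums (zeta_reg z / (z - 1))"
        using zeta_reg_sums[of z] that by (simp add: powr_minus inverse_eq_divide)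
      ultimately show ?thesis by (simp add: sums_unique2)
    qed
    show "s \<in> S" using s by (simp add: S_def)
  qed
qed

section \<open>Dirichlet series with nonnegative coefficients\<close>

text \<open>The coefficient of the integer \<open>n + 1\<close> is \<open>a n\<close>; the shift
  keeps powers of \<open>0\<close> out of the series.\<close>

definition dseries :: "(nat \<Rightarrow> real) \<Rightarrow> complex \<Rightarrow> complex" where
  "dseries a s = (\<Sum>n. of_real (a n) * of_nat (Suc n) powr (-s))"

lemma norm_dseries_term:
  "norm (of_real (a n) * of_nat (Suc n) powr (-s)) = \<bar>a n\<bar> * real (Suc n) powr (-Re s)"
  by (simp add: norm_mult norm_powr_of_nat del: of_nat_Suc)

lemma dseries_abs_mono:
  assumes "summable (\<lambda>n. \<bar>a n\<bar> * real (Suc n) powr (-x))" "x \<le> y"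
  shows "summable (\<lambda>n. \<bar>a n\<bar> * real (Suc n) powr (-y))"
  by (rule summable_comparison_test'[OF assms(1)]) (use assms(2) in \<open>auto intro!: mult_left_mono powr_mono\<close>)

lemma dseries_summable:
  assumes "summable (\<lambda>n. \<bar>a n\<bar> * real (Suc n) powr (-x))" "x \<le> Re s"
  shows "summable (\<lambda>n. norm (of_real (a n) * of_nat (Suc n) powr (-s)))"
        "summable (\<lambda>n. of_real (a n) * of_nat (Suc n) powr (-s))"
proof -
  show "summable (\<lambda>n. norm (of_real (a n) * of_nat (Suc n) powr (-s)))"
    unfolding norm_dseries_term by (rule dseries_abs_mono[OF assms])
  thus "summable (\<lambda>n. of_real (a n) * of_nat (Suc n) powr (-s))" by (rule summable_norm_cancel)
qed

lemma holomorphic_dseries: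
  assumes "summable (\<lambda>n. \<bar>a n\<bar> * real (Suc n) powr (-x))"
  shows "dseries a holomorphic_on {s. Re s > x}"
  unfolding dseries_def [abs_def]
proof (rule holomorphic_series_Mtest)
  show "open {s. Re s > x}" by (rule open_halfspace_Re_gt)
  show "(\<lambda>s. of_real (a n) * of_nat (Suc n) powr (-s)) holomorphic_on {s. Re s > x}" for n
    by (intro holomorphic_intros) (auto simp del: of_nat_Suc)
  fix z assume z: "z \<in> {s. Re s > x}"
  define d where "d = (Re z - x) / 2"
  have d: "d > 0" "Re z - d > x" using z by (auto simp: d_def field_simps)
  show "\<exists>d>0. \<exists>M. cball z d \<subseteq> {s. Re s > x} \<and> summable M \<and>
     (\<forall>n. \<forall>w\<in>cball z d. norm (of_real (a n) * of_nat (Suc n) powr (-w)) \<le> M n)"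
  proof (intro exI conjI allI ballI)
    show "summable (\<lambda>n. \<bar>a n\<bar> * real (Suc n) powr (-x))" by fact
    fix n w assume w: "w \<in> cball z d"
    show "norm (of_real (a n) * of_nat (Suc n) powr (-w)) \<le> \<bar>a n\<bar> * real (Suc n) powr (-x)"
      unfolding norm_dseries_term using Re_in_cball[OF w] d
      by (intro mult_left_mono powr_mono) auto
  qed (use d cball_Re_gt in auto)
qed

lemma holomorphic_dseries_Re_gt:
  assumes "\<And>x. x > y \<Longrightarrow> summable (\<lambda>n. \<bar>a n\<bar> * real (Suc n) powr (-x))"
  shows "dseries a holomorphic_on {s. Re s > y}"
proof -
  have "dseries a field_differentiable (at z)" if z: "Re z > y" for z
  proof -
    obtain x where x: "y < x" "x < Re z" using z dense by blast
    show ?thesis using holomorphic_dseries[OF assms[OF x(1)]] x open_halfspace_Re_gt[of x]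
      by (auto intro: holomorphic_on_imp_differentiable_at)
  qed
  thus ?thesis by (auto simp: holomorphic_on_def field_differentiable_at_within)
qed

lemma summable_bounded_powr:
  assumes "\<And>n. \<bar>a n\<bar> \<le> 1" "x > 1"
  shows "summable (\<lambda>n. \<bar>a n\<bar> * real (Suc n) powr (-x))"
proof (rule summable_comparison_test')
  show "summable (\<lambda>n. real (Suc n) powr (-x))" by (rule summable_Suc_powr) (use assms in auto)
  show "norm (\<bar>a n\<bar> * real (Suc n) powr (-x)) \<le> real (Suc n) powr (-x)" for n
    using mult_right_mono[OF assms(1)[of n], of "real (Suc n) powr (-x)"] by (simp add: abs_mult)
qed

lemma infsum_eq_suminf_norm:
  fixes f :: "nat \<Rightarrow> 'a :: banach"
  assumes "summable (\<lambda>n. norm (f n))"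
  shows "infsum f UNIV = suminf f"
  using norm_summable_imp_has_sum[OF assms summable_sums[OF summable_norm_cancel[OF assms]]]
  by (rule infsumI)

text \<open>
  The Taylor coefficients of \<open>h (c - w)\<close> in \<open>w\<close> are nonnegative double sums, so the two summations
  can be interchanged wherever the Taylor series converges.
\<close>

lemma landau_local:
  fixes a :: "nat \<Rightarrow> real" and h :: "complex \<Rightarrow> complex"
  assumes a: "\<And>n. a n \<ge> 0"
    and sm: "summable (\<lambda>n. a n * real (Suc n) powr (-(c - d)))" and d: "d > 0"
    and hol: "h holomorphic_on ball (of_real c) R"
    and eq: "\<And>s. s \<in> ball (of_real c) d \<Longrightarrow> dseries a s = h s"
    and r: "0 \<le> r" "r < R"
  shows "summable (\<lambda>n. a n * real (Suc n) powr (-(c - r)))"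
proof -
  define u where "u = (\<lambda>n. ln (real (Suc n)))"
  have u: "u n \<ge> 0" for n by (simp add: u_def)
  define A where "A = (\<lambda>n. a n * real (Suc n) powr (-c))"
  have A: "A n \<ge> 0" for n using a by (simp add: A_def)
  have Ae: "A n * exp (u n * t) = a n * real (Suc n) powr (-(c - t))" for n t
    by (simp add: A_def u_def powr_def exp_add [symmetric] algebra_simps del: of_nat_Suc)
  define F where "F = (\<lambda>w n k. complex_of_real (A n) * ((of_real (u n) * w) ^ k / fact k))"
  define b where "b = (\<lambda>k. \<Sum>\<^sub>\<infinity>n. complex_of_real (A n * u n ^ k / fact k))"
  have F_sums: "(\<lambda>k. F w n k) sums (complex_of_real (A n) * exp (of_real (u n) * w))" for w n
    unfolding F_def by (intro sums_mult) (use exp_converges[of "of_real (u n) * w"] in \<open>simp add: scaleR_conv_of_real field_simps\<close>)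
  have F_norm: "norm (F w n k) = A n * ((u n * norm w) ^ k / fact k)" for w n k
    using A u by (simp add: F_def norm_mult norm_divide norm_power power_mult_distrib)
  have F_norm_sums: "(\<lambda>k. norm (F w n k)) sums (A n * exp (u n * norm w))" for w n
    unfolding F_norm by (intro sums_mult) (use exp_converges[of "u n * norm w"] in \<open>simp add: field_simps\<close>)
  have F_abs: "(\<lambda>z. norm (case z of (n, k) \<Rightarrow> F w n k)) summable_on (UNIV \<times> UNIV)" if "norm w < d" for w
    unfolding Infinite_Sum.abs_summable_on_Sigma_iff
  proof (intro conjI ballI)
    fix n
    show "(\<lambda>k. norm ((\<lambda>(n, k). F w n k) (n, k))) summable_on UNIV"
      using F_norm_sums[of w n] by (auto intro!: norm_summable_imp_summable_on simp: sums_iff)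
    show "(\<lambda>n. norm (\<Sum>\<^sub>\<infinity>k. norm ((\<lambda>(n, k). F w n k) (n, k)))) summable_on UNIV"
    proof -
      have "(\<Sum>\<^sub>\<infinity>k. norm (F w n k)) = A n * exp (u n * norm w)" for n
        by (rule infsumI, rule sums_nonneg_imp_has_sum) (use F_norm_sums in auto)
      moreover have "summable (\<lambda>n. norm (A n * exp (u n * norm w)))"
      proof (rule summable_comparison_test'[OF sm])
        fix n
        show "norm (norm (A n * exp (u n * norm w))) \<le> a n * real (Suc n) powr (-(c - d))"
          unfolding Ae using a that by (auto simp: abs_mult intro!: mult_left_mono powr_mono)
      qed
      ultimately show ?thesis by (auto intro!: norm_summable_imp_summable_on)
    qed
  qed
  have bF: "(\<Sum>\<^sub>\<infinity>n. F w n k) = b k * w ^ k" for w k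
  proof -
    have "(\<Sum>\<^sub>\<infinity>n. F w n k) = (\<Sum>\<^sub>\<infinity>n. complex_of_real (A n * u n ^ k / fact k) * w ^ k)"
      by (simp add: F_def power_mult_distrib mult.assoc)
    also have "\<dots> = b k * w ^ k" unfolding b_def by (rule infsum_cmult_left')
    finally show ?thesis .
  qed
  define g where "g = (\<lambda>w. h (of_real c - w))"
  have b_sums: "(\<lambda>k. b k * w ^ k) sums g w" if w: "norm w < d" for w
  proof -
    have sw: "(\<lambda>(n, k). F w n k) summable_on (UNIV \<times> UNIV)"
      by (rule abs_summable_summable[OF F_abs[OF w]])
    have inner: "(\<Sum>\<^sub>\<infinity>k. F w n k) = of_real (a n) * of_nat (Suc n) powr (-(of_real c - w))" for n
    proof -
      have "(\<Sum>\<^sub>\<infinity>k. F w n k) = complex_of_real (A n) * exp (of_real (u n) * w)"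
        by (rule infsumI, rule norm_summable_imp_has_sum) (use F_norm_sums[of w n] F_sums in \<open>auto simp: sums_iff\<close>)
      also have "\<dots> = of_real (a n) * of_nat (Suc n) powr (-(of_real c - w))"
        using Ln_of_real[of "real (Suc n)"]
        by (simp add: A_def u_def powr_def exp_of_real[symmetric] exp_add[symmetric] algebra_simps del: of_nat_Suc)
      finally show ?thesis .
    qed
    have "(\<Sum>\<^sub>\<infinity>k. \<Sum>\<^sub>\<infinity>n. F w n k) = (\<Sum>\<^sub>\<infinity>n. \<Sum>\<^sub>\<infinity>k. F w n k)"
      using infsum_swap_banach[OF sw] by simp
    also have "\<dots> = (\<Sum>\<^sub>\<infinity>n. of_real (a n) * of_nat (Suc n) powr (-(of_real c - w)))"
      by (simp only: inner)
    also have "\<dots> = dseries a (of_real c - w)"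
      unfolding dseries_def
      by (intro infsum_eq_suminf_norm dseries_summable[where x = "c - d"])
         (use sm a w complex_Re_le_cmod[of w] in auto)
    also have "\<dots> = g w" unfolding g_def using w by (intro eq) (simp add: dist_norm)
    finally have *: "(\<Sum>\<^sub>\<infinity>k. b k * w ^ k) = g w" unfolding bF .
    have "(\<lambda>(k, n). F w n k) summable_on (UNIV \<times> UNIV)"
      using sw by (subst summable_on_swap) (simp add: case_prod_unfold)
    hence "(\<lambda>k. \<Sum>\<^sub>\<infinity>n. F w n k) summable_on UNIV"
      using summable_on_Sigma_banach[of "\<lambda>k n. F w n k" UNIV "\<lambda>_. UNIV"] by simp
    hence "((\<lambda>k. b k * w ^ k) has_sum g w) UNIV" unfolding bF *[symmetric] by (rule has_sum_infsum)
    thus ?thesis by (rule has_sum_imp_sums)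
  qed
  have ghol: "g holomorphic_on ball 0 R"
    unfolding g_def
    by (rule holomorphic_on_compose_gen[OF _ hol, unfolded o_def])
       (auto intro!: holomorphic_intros simp: dist_norm)
  have "g has_fps_expansion Abs_fps b"
  proof -
    have "fps_conv_radius (Abs_fps b) \<ge> norm (of_real (d / 2) :: complex)"
      unfolding fps_conv_radius_def
      by (rule conv_radius_geI) (use b_sums[of "of_real (d / 2)"] d in \<open>auto simp: sums_iff\<close>)
    hence "fps_conv_radius (Abs_fps b) > 0" using d
      by (metis ereal_less(2) half_gt_zero norm_of_real abs_of_pos less_le_trans)
    moreover have "eventually (\<lambda>w. w \<in> ball 0 d) (nhds (0::complex))"
      using d by (intro eventually_nhds_in_open) auto
    hence "eventually (\<lambda>w. eval_fps (Abs_fps b) w = g w) (nhds 0)"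
      by eventually_elim (use b_sums in \<open>auto simp: eval_fps_def sums_iff\<close>)
    ultimately show ?thesis by (simp add: has_fps_expansion_def)
  qed
  hence bk: "b k = (deriv ^^ k) g 0 / fact k" for k
    using fps_nth_fps_expansion[of g "Abs_fps b" k] by simp
  \<comment> \<open>The Taylor series converges in the whole disc of holomorphy, so \<open>r\<close>
    may lie beyond \<open>d\<close>, where nothing is yet known about the Dirichlet series.\<close>
  have "(\<lambda>k. (deriv ^^ k) g 0 / fact k * (of_real r - 0) ^ k) sums g (of_real r)"
    by (rule holomorphic_power_series[OF ghol]) (use r in auto)
  hence "summable (\<lambda>k. b k * of_real r ^ k)" unfolding bk by (auto simp: sums_iff)
  hence "summable (\<lambda>k. Re (b k * of_real r ^ k))" by (rule summable_Re)
  define G where "G = (\<lambda>k n. A n * ((u n * r) ^ k / fact k))"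
  have G0: "G k n \<ge> 0" for k n using A u r by (simp add: G_def)
  have smA: "(\<lambda>n. A n * u n ^ k / fact k) summable_on UNIV" for k
  proof -
    have "(\<lambda>z. norm (case z of (k, n) \<Rightarrow> F (of_real (d / 2)) n k)) summable_on (UNIV \<times> UNIV)"
      using F_abs[of "of_real (d / 2)"] d by (subst summable_on_swap) (simp add: case_prod_unfold)
    hence "(\<lambda>n. norm (F (of_real (d / 2)) n k)) summable_on UNIV"
      unfolding Infinite_Sum.abs_summable_on_Sigma_iff by simp
    hence "(\<lambda>n. norm (F (of_real (d / 2)) n k) * (1 / (d / 2) ^ k)) summable_on UNIV"
      by (rule summable_on_cmult_left)
    moreover have "norm (F (of_real (d / 2)) n k) * (1 / (d / 2) ^ k) = A n * u n ^ k / fact k" for n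
      unfolding F_norm using d by (simp add: power_mult_distrib power_divide)
    ultimately show ?thesis by simp
  qed
  have Reb: "Re (b k * of_real r ^ k) = (\<Sum>\<^sub>\<infinity>n. G k n)" and smG: "(\<lambda>n. G k n) summable_on UNIV" for k
  proof -
    have "b k = of_real (\<Sum>\<^sub>\<infinity>n. A n * u n ^ k / fact k)"
      unfolding b_def by (rule infsumI) (intro has_sum_of_real has_sum_infsum smA)
    hence "Re (b k * of_real r ^ k) = (\<Sum>\<^sub>\<infinity>n. A n * u n ^ k / fact k) * r ^ k"
      by (metis Re_complex_of_real of_real_mult of_real_power)
    also have "\<dots> = (\<Sum>\<^sub>\<infinity>n. A n * u n ^ k / fact k * r ^ k)"
      by (rule infsum_cmult_left' [symmetric])
    also have "\<dots> = (\<Sum>\<^sub>\<infinity>n. G k n)" by (simp add: G_def power_mult_distrib mult.assoc)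
    finally show "Re (b k * of_real r ^ k) = (\<Sum>\<^sub>\<infinity>n. G k n)" .
    have "(\<lambda>n. A n * u n ^ k / fact k * r ^ k) summable_on UNIV"
      by (rule summable_on_cmult_left) (rule smA)
    thus "(\<lambda>n. G k n) summable_on UNIV" by (simp add: G_def power_mult_distrib mult.assoc)
  qed
  have "(\<lambda>z. norm (case z of (k, n) \<Rightarrow> G k n)) summable_on (UNIV \<times> UNIV)"
    unfolding Infinite_Sum.abs_summable_on_Sigma_iff
    using \<open>summable (\<lambda>k. Re (b k * of_real r ^ k))\<close>[unfolded Reb] G0 smG
    by (auto simp: infsum_nonneg intro!: summable_nonneg_imp_summable_on)
  hence "(\<lambda>z. norm (case z of (n, k) \<Rightarrow> G k n)) summable_on (UNIV \<times> UNIV)"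
    by (subst summable_on_swap) (simp add: case_prod_unfold)
  hence "(\<lambda>n. norm (\<Sum>\<^sub>\<infinity>k. norm (G k n))) summable_on UNIV"
    unfolding Infinite_Sum.abs_summable_on_Sigma_iff by simp
  moreover have "(\<Sum>\<^sub>\<infinity>k. norm (G k n)) = a n * real (Suc n) powr (-(c - r))" for n
  proof -
    have "(\<lambda>k. G k n) sums (A n * exp (u n * r))"
      unfolding G_def by (intro sums_mult) (use exp_converges[of "u n * r"] in \<open>simp add: field_simps\<close>)
    hence "((\<lambda>k. norm (G k n)) has_sum (A n * exp (u n * r))) UNIV"
      using G0 by (intro sums_nonneg_imp_has_sum) auto
    thus ?thesis unfolding Ae by (rule infsumI)
  qed
  ultimately show ?thesis using a by (simp add: summable_on_UNIV_nonneg_real_iff)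
qed

text \<open>If the abscissa of convergence \<open>\<tau>\<close> exceeded \<open>\<sigma>0\<close>,
  then \<open>N / D\<close> would be holomorphic around \<open>\<tau>\<close>, and
  \<open>landau_local\<close> with a centre slightly to the right would yield convergence to the
  left of \<open>\<tau>\<close>. The product form of the identity lets \<open>D\<close> vanish off
  the real axis, as zeta may.\<close>

lemma landau:
  fixes a :: "nat \<Rightarrow> real" and D N :: "complex \<Rightarrow> complex"
  assumes a: "\<And>n. a n \<ge> 0"
    and sm: "summable (\<lambda>n. a n * real (Suc n) powr (-\<sigma>1))"
    and D: "D holomorphic_on {s. Re s > \<sigma>0}" and N: "N holomorphic_on {s. Re s > \<sigma>0}"
    and Dnz: "\<And>x. x > \<sigma>0 \<Longrightarrow> D (of_real x) \<noteq> 0"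
    and eq: "\<And>s. Re s > \<sigma>1 \<Longrightarrow> dseries a s * D s = N s"
    and \<sigma>: "\<sigma>0 < \<sigma>1"
  shows "x > \<sigma>0 \<Longrightarrow> summable (\<lambda>n. a n * real (Suc n) powr (-x))"
    and "Re s > \<sigma>0 \<Longrightarrow> dseries a s * D s = N s"
proof -
  define P where "P = (\<lambda>x. summable (\<lambda>n. a n * real (Suc n) powr (-x)))"
  have Pabs: "P x \<longleftrightarrow> summable (\<lambda>n. \<bar>a n\<bar> * real (Suc n) powr (-x))" for x
    using a by (simp add: P_def)
  have mono: "P x \<Longrightarrow> x \<le> y \<Longrightarrow> P y" for x y unfolding Pabs by (rule dseries_abs_mono)
  have ext: "dseries a s * D s = N s" if "\<And>x. x > y \<Longrightarrow> P x" "\<sigma>0 \<le> y" "Re s > y" for y s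
  proof (cases "Re s > \<sigma>1")
    case False
    have ysig: "y < \<sigma>1" using False that(3) by simp
    show ?thesis
    proof (rule analytic_continuation_open[of "{s. Re s > \<sigma>1}" "{s. Re s > y}" "\<lambda>s. dseries a s * D s" N])
      have "dseries a holomorphic_on {s. Re s > y}"
        by (rule holomorphic_dseries_Re_gt) (use that(1) Pabs in auto)
      thus "(\<lambda>s. dseries a s * D s) holomorphic_on {s. Re s > y}"
        using that(2) by (intro holomorphic_intros holomorphic_on_subset[OF D]) auto
      show "N holomorphic_on {s. Re s > y}" by (rule holomorphic_on_subset[OF N]) (use that(2) in auto)
      show "{s. Re s > \<sigma>1} \<noteq> {}" by (auto intro: exI[of _ "of_real (\<sigma>1 + 1)"])
      show "{s. Re s > \<sigma>1} \<subseteq> {s. Re s > y}" using ysig by auto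
      show "connected {s. Re s > y}" by (intro convex_connected convex_halfspace_Re_gt)
    qed (use eq that open_halfspace_Re_gt in auto)
  qed (use eq in auto)
  have main: "P x" if "x > \<sigma>0" for x
  proof (rule ccontr)
    assume nP: "\<not> P x"
    define \<tau> where "\<tau> = Inf {y. P y}"
    have "P \<sigma>1" using sm by (simp add: P_def)
    have lb: "x \<le> y" if "P y" for y
    proof (rule ccontr)
      assume "\<not> x \<le> y"
      hence "P x" using mono[OF that, of x] by simp
      thus False using nP by simp
    qed
    have bdd: "bdd_below {y. P y}" using lb by (auto intro!: bdd_belowI[of _ x])
    have tx: "x \<le> \<tau>" unfolding \<tau>_def using \<open>P \<sigma>1\<close> lb by (intro cInf_greatest) auto
    have P\<tau>: "P y" if "y > \<tau>" for y
      using cInf_lessD[of "{y. P y}" y] that \<open>P \<sigma>1\<close> mono unfolding \<tau>_def by force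
    have Pge: "\<tau> \<le> y" if "P y" for y unfolding \<tau>_def by (rule cInf_lower) (use that bdd in auto)
    have \<tau>: "\<tau> > \<sigma>0" using tx that by simp
    have "isCont D (of_real \<tau>)" using isCont_holomorphic_Re_gt[OF D] \<tau> by simp
    hence "eventually (\<lambda>s. D s \<noteq> 0) (nhds (of_real \<tau>))"
      using Dnz[OF \<tau>] by (simp add: isCont_def tendsto_imp_eventually_ne eventually_nhds_conv_at)
    moreover have "eventually (\<lambda>s. s \<in> {s. Re s > \<sigma>0}) (nhds (of_real \<tau>))"
      by (intro eventually_nhds_in_open open_halfspace_Re_gt) (use \<tau> in auto)
    ultimately have "eventually (\<lambda>s. D s \<noteq> 0 \<and> Re s > \<sigma>0) (nhds (of_real \<tau>))"
      by eventually_elim auto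
    then obtain e where e: "e > 0" "\<And>s. dist s (of_real \<tau>) < e \<Longrightarrow> D s \<noteq> 0 \<and> Re s > \<sigma>0"
      unfolding eventually_nhds_metric by blast
    \<comment> \<open>The ball of radius \<open>3 * e / 4\<close> around \<open>c\<close> stays
      within distance \<open>e\<close> of \<open>\<tau>\<close>; \<open>c - e / 8\<close> is to the
      right of \<open>\<tau>\<close>, where convergence is known, and \<open>c - e / 2\<close> is to
      the left of it.\<close>
    define c where "c = \<tau> + e / 4"
    have sub: "ball (of_real c) (3 * e / 4) \<subseteq> {s. Re s > \<sigma>0} \<inter> {s. D s \<noteq> 0}"
    proof
      fix s :: complex assume "s \<in> ball (of_real c) (3 * e / 4)"
      moreover have "dist s (of_real \<tau>) \<le> dist (of_real c) s + dist (of_real c) (complex_of_real \<tau>)"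
        by (metis dist_commute dist_triangle)
      moreover have "dist (of_real c) (complex_of_real \<tau>) = e / 4"
        using e(1) unfolding dist_of_real by (simp add: c_def dist_real_def)
      ultimately have "dist s (of_real \<tau>) < e" by simp
      thus "s \<in> {s. Re s > \<sigma>0} \<inter> {s. D s \<noteq> 0}" using e(2) by auto
    qed
    have "summable (\<lambda>n. a n * real (Suc n) powr (-(c - e / 2)))"
    proof (rule landau_local[where d = "e / 8" and R = "3 * e / 4" and h = "\<lambda>s. N s / D s"])
      show "summable (\<lambda>n. a n * real (Suc n) powr (-(c - e / 8)))"
        using P\<tau>[of "c - e / 8"] e(1) by (simp add: P_def c_def)
      show "(\<lambda>s. N s / D s) holomorphic_on ball (of_real c) (3 * e / 4)"
        by (intro holomorphic_intros holomorphic_on_subset[OF N] holomorphic_on_subset[OF D]) (use sub in auto)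
      fix s assume s: "s \<in> ball (complex_of_real c) (e / 8)"
      have "Re s > \<tau>"
      proof -
        have "c - Re s < e / 8"
          using s abs_Re_le_cmod[of "of_real c - s"] abs_ge_self[of "c - Re s"] by (simp add: dist_norm)
        thus ?thesis using e(1) by (simp add: c_def)
      qed
      hence "dseries a s * D s = N s" using P\<tau> \<tau> by (intro ext[of \<tau>]) auto
      moreover have "D s \<noteq> 0" using s sub e(1) by (auto simp: subset_iff)
      ultimately show "dseries a s = N s / D s" by (simp add: field_simps)
    qed (use a e in auto)
    hence "P (c - e / 2)" by (simp add: P_def)
    hence "\<tau> \<le> c - e / 2" by (rule Pge)
    thus False using e(1) by (simp add: c_def)
  qed
  show "x > \<sigma>0 \<Longrightarrow> summable (\<lambda>n. a n * real (Suc n) powr (-x))" using main by (simp add: P_def)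
  show "Re s > \<sigma>0 \<Longrightarrow> dseries a s * D s = N s" using main by (intro ext[of \<sigma>0]) auto
qed

section \<open>Euler products\<close>

definition smooth_numbers :: "nat set \<Rightarrow> nat set" where
  "smooth_numbers S = {n. n > 0 \<and> (\<forall>p. prime p \<longrightarrow> p dvd n \<longrightarrow> p \<in> S)}"

lemma smooth_numbers_empty: "smooth_numbers {} = {1}"
  unfolding smooth_numbers_def using prime_factor_nat by fastforce

text \<open>The exponent of \<open>p\<close> is recovered as a multiplicity. Adding the primes one
  at a time turns unique factorisation into an induction over finite sets of primes.\<close>

lemma bij_betw_smooth_insert:
  assumes p: "prime p" "p \<notin> S"
  shows "bij_betw (\<lambda>(k, m). p ^ k * m) (UNIV \<times> smooth_numbers S) (smooth_numbers (insert p S))"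
proof -
  have cop: "\<not> p dvd m" if "m \<in> smooth_numbers S" for m
    using that p by (auto simp: smooth_numbers_def)
  have p0: "p \<noteq> 0" using p by auto
  show ?thesis unfolding bij_betw_def
  proof
    show "inj_on (\<lambda>(k, m). p ^ k * m) (UNIV \<times> smooth_numbers S)"
    proof (rule inj_onI, clarify)
      fix k m k' m' assume m: "m \<in> smooth_numbers S" "m' \<in> smooth_numbers S" and e: "p ^ k * m = p ^ k' * m'"
      have "multiplicity p (p ^ k * m) = k" "multiplicity p (p ^ k' * m') = k'"
        using cop m p0 by (auto intro!: multiplicity_decomposeI)
      with e have "k = k'" by simp
      with e p0 show "k = k' \<and> m = m'" by simp
    qed
    show "(\<lambda>(k, m). p ^ k * m) ` (UNIV \<times> smooth_numbers S) = smooth_numbers (insert p S)"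
    proof safe
      fix k m assume m: "m \<in> smooth_numbers S"
      have "q \<in> insert p S" if q: "prime q" "q dvd p ^ k * m" for q
      proof -
        have "q dvd p ^ k \<or> q dvd m" using q by (simp add: prime_dvd_mult_iff)
        thus ?thesis
        proof
          assume "q dvd p ^ k"
          hence "q dvd p" using q prime_dvd_power by blast
          thus ?thesis using q p by (simp add: primes_dvd_imp_eq)
        next
          assume "q dvd m" thus ?thesis using m q by (auto simp: smooth_numbers_def)
        qed
      qed
      thus "p ^ k * m \<in> smooth_numbers (insert p S)" using m p0
        by (auto simp: smooth_numbers_def)
    next
      fix n assume n: "n \<in> smooth_numbers (insert p S)"
      hence n0: "n \<noteq> 0" by (auto simp: smooth_numbers_def)
      have "\<not> is_unit p" using p by auto
      from multiplicity_decompose'[OF n0 this] obtain y where y: "n = p ^ multiplicity p n * y" "\<not> p dvd y" .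
      have "y \<in> smooth_numbers S"
        unfolding smooth_numbers_def
      proof (safe intro!: CollectI)
        show "y > 0" using y n0 by (metis gr0I mult_0_right)
        fix q assume q: "prime q" "q dvd y"
        hence "q dvd n" using y(1) by (metis dvd_mult)
        hence "q \<in> insert p S" using n q by (auto simp: smooth_numbers_def)
        thus "q \<in> S" using q y by auto
      qed
      thus "n \<in> (\<lambda>(k, m). p ^ k * m) ` (UNIV \<times> smooth_numbers S)" using y(1) by force
    qed
  qed
qed

lemma infsum_smooth_numbers:
  fixes f :: "nat \<Rightarrow> complex"
  assumes one: "f 1 = 1" and mult: "\<And>m n. m > 0 \<Longrightarrow> n > 0 \<Longrightarrow> coprime m n \<Longrightarrow> f (m * n) = f m * f n"
    and sm: "f summable_on {0<..}"
    and S: "finite S" "\<And>p. p \<in> S \<Longrightarrow> prime p"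
  shows "infsum f (smooth_numbers S) = (\<Prod>p\<in>S. \<Sum>\<^sub>\<infinity>k. f (p ^ k))"
  using S
proof (induction S rule: finite_induct)
  case empty
  show ?case by (simp add: smooth_numbers_empty one[unfolded One_nat_def])
next
  case (insert p S)
  have p: "prime p" using insert.prems by simp
  have cop: "coprime (p ^ k) m" if "m \<in> smooth_numbers S" for m k
  proof -
    have "\<not> p dvd m" using that insert.hyps p by (auto simp: smooth_numbers_def)
    thus ?thesis using p by (simp add: prime_imp_coprime)
  qed
  have f: "f (p ^ k * m) = f (p ^ k) * f m" if "m \<in> smooth_numbers S" for m k
    by (rule mult) (use cop that p in \<open>auto simp: smooth_numbers_def prime_gt_0_nat\<close>)
  note bij = bij_betw_smooth_insert[OF p insert.hyps(2)]
  have "f summable_on smooth_numbers (insert p S)"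
    by (rule summable_on_subset_banach[OF sm]) (auto simp: smooth_numbers_def)
  hence sm2: "(\<lambda>z. f (case z of (k, m) \<Rightarrow> p ^ k * m)) summable_on (UNIV \<times> smooth_numbers S)"
    by (subst summable_on_reindex_bij_betw[OF bij])
  have "infsum f (smooth_numbers (insert p S)) = (\<Sum>\<^sub>\<infinity>z\<in>UNIV \<times> smooth_numbers S. f (case z of (k, m) \<Rightarrow> p ^ k * m))"
    by (rule infsum_reindex_bij_betw[OF bij, symmetric])
  also have "\<dots> = (\<Sum>\<^sub>\<infinity>k. \<Sum>\<^sub>\<infinity>m\<in>smooth_numbers S. f (p ^ k * m))"
    using infsum_Sigma_banach[OF sm2] by simp
  also have "\<dots> = (\<Sum>\<^sub>\<infinity>k. \<Sum>\<^sub>\<infinity>m\<in>smooth_numbers S. f (p ^ k) * f m)"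
    by (intro infsum_cong f)
  also have "\<dots> = (\<Sum>\<^sub>\<infinity>k. f (p ^ k) * infsum f (smooth_numbers S))"
    by (intro infsum_cong infsum_cmult_right')
  also have "\<dots> = (\<Sum>\<^sub>\<infinity>k. f (p ^ k)) * infsum f (smooth_numbers S)"
    by (rule infsum_cmult_left')
  finally show ?case using insert by simp
qed

text \<open>The product over the primes below \<open>N\<close> expands into the sum over the
  integers all of whose prime factors are below \<open>N\<close>. Every fixed integer is eventually
  among them, so Tannery's theorem, with the absolutely convergent full series as majorant, gives
  the limit.\<close>

lemma euler_product:
  fixes f :: "nat \<Rightarrow> complex"
  assumes one: "f 1 = 1" and mult: "\<And>m n. m > 0 \<Longrightarrow> n > 0 \<Longrightarrow> coprime m n \<Longrightarrow> f (m * n) = f m * f n"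
    and sm: "summable (\<lambda>n. norm (f (Suc n)))"
  shows "(\<lambda>N. \<Prod>p<N. if prime p then (\<Sum>k. f (p ^ k)) else 1) \<longlonglongrightarrow> (\<Sum>n. f (Suc n))"
proof -
  define S where "S = (\<lambda>N. {p. prime p \<and> p < N} :: nat set)"
  have Sfin: "finite (S N)" for N by (rule finite_subset[of _ "{..<N}"]) (auto simp: S_def)
  have bij: "bij_betw Suc UNIV {0<..}"
    by (rule bij_betwI[of _ _ _ "\<lambda>n. n - 1"]) auto
  have smo: "f summable_on {0<..}"
    using norm_summable_imp_summable_on[OF sm] summable_on_reindex_bij_betw[OF bij, of f] by simp
  have loc: "(\<Sum>\<^sub>\<infinity>k. f (p ^ k)) = (\<Sum>k. f (p ^ k))" if p: "prime p" for p
  proof -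
    have "inj_on (\<lambda>k. p ^ k) UNIV" using p prime_gt_1_nat[OF p] by (auto intro!: inj_onI dest: power_inject_exp')
    moreover have "range (\<lambda>k. p ^ k) \<subseteq> {0<..}" using p by (auto simp: prime_gt_0_nat)
    ultimately have "(\<lambda>k. f (p ^ k)) summable_on UNIV"
      using summable_on_reindex[of "\<lambda>k. p ^ k" UNIV f] summable_on_subset_banach[OF smo, of "range (\<lambda>k. p ^ k)"]
      by (simp add: o_def)
    thus ?thesis by (metis has_sum_imp_sums has_sum_infsum sums_unique)
  qed
  define g where "g = (\<lambda>n N. if Suc n \<in> smooth_numbers (S N) then f (Suc n) else 0)"
  have "(\<Prod>p<N. if prime p then (\<Sum>k. f (p ^ k)) else 1) = (\<Sum>n. g n N)" for N
  proof -
    have "(\<Prod>p<N. if prime p then (\<Sum>k. f (p ^ k)) else 1) = (\<Prod>p\<in>S N. \<Sum>k. f (p ^ k))"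
      by (rule prod.mono_neutral_cong_right) (auto simp: S_def)
    also have "\<dots> = (\<Prod>p\<in>S N. \<Sum>\<^sub>\<infinity>k. f (p ^ k))"
      by (rule prod.cong) (auto simp: S_def loc)
    also have "\<dots> = infsum f (smooth_numbers (S N))"
      by (rule infsum_smooth_numbers[OF one mult smo Sfin, symmetric]) (auto simp: S_def)
    also have "\<dots> = (\<Sum>\<^sub>\<infinity>n\<in>{0<..}. if n \<in> smooth_numbers (S N) then f n else 0)"
      by (rule infsum_cong_neutral) (auto simp: smooth_numbers_def)
    also have "\<dots> = (\<Sum>\<^sub>\<infinity>n. g n N)"
      unfolding g_def by (rule infsum_reindex_bij_betw[OF bij, symmetric])
    also have "\<dots> = (\<Sum>n. g n N)"
    proof (rule infsum_eq_suminf_norm)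
      show "summable (\<lambda>n. norm (g n N))"
        by (rule summable_comparison_test'[OF sm]) (auto simp: g_def)
    qed
    finally show ?thesis .
  qed
  moreover have "(\<lambda>N. \<Sum>n. g n N) \<longlonglongrightarrow> (\<Sum>n. f (Suc n))"
  proof (rule tannerys_theorem[THEN conjunct2, THEN conjunct2])
    show "summable (\<lambda>n. norm (f (Suc n)))" by fact
    show "eventually (\<lambda>(n, N). norm (g n N) \<le> norm (f (Suc n))) (at_top \<times>\<^sub>F sequentially)"
      by (rule always_eventually) (auto simp: g_def)
    fix n
    have "eventually (\<lambda>N. g n N = f (Suc n)) sequentially"
      using eventually_gt_at_top[of "Suc n"]
    proof eventually_elim
      case (elim N)
      have "Suc n \<in> smooth_numbers (S N)"
        using elim by (auto simp: smooth_numbers_def S_def dest!: dvd_imp_le)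
      thus ?case by (simp add: g_def)
    qed
    thus "(\<lambda>N. g n N) \<longlonglongrightarrow> f (Suc n)" by (rule tendsto_eventually)
  qed auto
  ultimately show ?thesis by simp
qed

lemma of_nat_mult_powr:
  "of_nat (m * n) powr (s::complex) = of_nat m powr s * of_nat n powr s"
  using powr_times_real[of "of_nat m" "of_nat n" s] by simp

lemma of_nat_power_powr:
  "of_nat (p ^ k) powr (s::complex) = (of_nat p powr s) ^ k" if "p > 0"
  using that by (induction k) (simp_all only: power_Suc of_nat_mult_powr power_0 of_nat_1 powr_one_eq_one)

lemma norm_prime_powr_less_1:
  assumes "prime p" "Re s > 0"
  shows "norm (of_nat p powr (-s)) < 1"
proof -
  have "real p powr (-Re s) < real p powr 0"
    using assms prime_gt_1_nat[of p] by (intro powr_less_mono) auto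
  thus ?thesis using assms by (simp add: norm_powr_of_nat prime_gt_0_nat)
qed

lemma euler_product_dirichlet:
  fixes f :: "nat \<Rightarrow> real"
  assumes one: "f 1 = 1" and mult: "\<And>m n. m > 0 \<Longrightarrow> n > 0 \<Longrightarrow> coprime m n \<Longrightarrow> f (m * n) = f m * f n"
    and bd: "\<And>n. n > 0 \<Longrightarrow> \<bar>f n\<bar> \<le> 1" and s: "Re s > 1"
  shows "(\<lambda>N. \<Prod>p<N. if prime p then (\<Sum>k. of_real (f (p ^ k)) * (of_nat p powr (-s)) ^ k) else 1)
     \<longlonglongrightarrow> dseries (\<lambda>n. f (Suc n)) s"
proof -
  define g where "g = (\<lambda>n. of_real (f n) * of_nat n powr (-s))"
  have "(\<lambda>N. \<Prod>p<N. if prime p then (\<Sum>k. g (p ^ k)) else 1) \<longlonglongrightarrow> (\<Sum>n. g (Suc n))"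
  proof (rule euler_product)
    show "g 1 = 1" using one by (simp add: g_def)
    show "g (m * n) = g m * g n" if "m > 0" "n > 0" "coprime m n" for m n
      using mult[OF that] by (simp add: g_def of_nat_mult_powr del: of_nat_mult)
    show "summable (\<lambda>n. norm (g (Suc n)))"
      using summable_bounded_powr[of "\<lambda>n. f (Suc n)", OF bd s] norm_dseries_term[of "\<lambda>n. f (Suc n)" _ s]
      by (simp add: g_def)
  qed
  moreover have "(\<Sum>k. g (p ^ k)) = (\<Sum>k. of_real (f (p ^ k)) * (of_nat p powr (-s)) ^ k)" if "prime p" for p
    using that by (simp add: g_def of_nat_power_powr prime_gt_0_nat del: of_nat_power)
  ultimately show ?thesis
    unfolding dseries_def by (simp add: g_def cong: if_cong)
qed

lemma zeta_reg_euler_product: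
  assumes s: "Re s > 1"
  shows "(\<lambda>N. \<Prod>p<N. if prime p then 1 / (1 - of_nat p powr (-s)) else 1) \<longlonglongrightarrow> zeta_reg s / (s - 1)"
proof -
  have "(\<lambda>N. \<Prod>p<N. if prime p then (\<Sum>k. of_real ((\<lambda>_. 1) (p ^ k)) * (of_nat p powr (-s)) ^ k) else 1)
     \<longlonglongrightarrow> dseries (\<lambda>n. (\<lambda>_. 1) (Suc n)) s"
    by (rule euler_product_dirichlet) (use s in auto)
  moreover have "dseries (\<lambda>n. (\<lambda>_. 1) (Suc n)) s = zeta_reg s / (s - 1)"
    using zeta_reg_sums[OF s] by (simp add: dseries_def sums_iff del: of_nat_Suc)
  moreover have "(\<Sum>k. of_real 1 * (of_nat p powr (-s)) ^ k) = 1 / (1 - of_nat p powr (-s))" if "prime p" for p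
    using suminf_geometric[OF norm_prime_powr_less_1[OF that, of s]] s by simp
  ultimately show ?thesis by (simp cong: if_cong)
qed

text \<open>Factor by factor: with \<open>r = norm z\<close> for \<open>z = p powr (-s)\<close>,
  \<open>norm (1 - z) * (1 - r) \<le> (1 + r) * (1 - r) \<le> 1\<close>. At \<open>2 * s\<close>
  this controls \<open>1 / \<zeta>(2s)\<close> by the value of zeta on the real axis.\<close>

lemma norm_zeta_reg_lower:
  assumes s: "Re s > 1"
  shows "norm (zeta_reg s / (s - 1)) * norm (zeta_reg (of_real (Re s)) / (of_real (Re s) - 1)) \<ge> 1"
proof -
  define P where "P = (\<lambda>s N. \<Prod>p<N. if prime p then 1 / (1 - of_nat p powr (-s)) else (1::complex))"
  have "(\<lambda>N. norm (P s N) * norm (P (of_real (Re s)) N)) \<longlonglongrightarrow>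
     norm (zeta_reg s / (s - 1)) * norm (zeta_reg (of_real (Re s)) / (of_real (Re s) - 1))"
    unfolding P_def by (intro tendsto_mult tendsto_norm zeta_reg_euler_product) (use s in auto)
  moreover have "norm (P s N) * norm (P (of_real (Re s)) N) \<ge> 1" for N
  proof -
    have "norm (P s N) * norm (P (of_real (Re s)) N) =
      (\<Prod>p<N. norm (if prime p then 1 / (1 - of_nat p powr (-s)) else (1::complex)) *
              norm (if prime p then 1 / (1 - of_nat p powr (-of_real (Re s))) else (1::complex)))"
      unfolding P_def prod_norm [symmetric] by (simp add: prod.distrib)
    also have "\<dots> \<ge> 1"
    proof (rule prod_ge_1)
      fix p assume "p \<in> {..<N}"
      show "1 \<le> norm (if prime p then 1 / (1 - of_nat p powr (-s)) else (1::complex)) *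
              norm (if prime p then 1 / (1 - of_nat p powr (-of_real (Re s))) else (1::complex))"
      proof (cases "prime p")
        case True
        define z where "z = complex_of_nat p powr (-s)"
        define r where "r = norm z"
        have r: "r < 1" "r \<ge> 0" unfolding r_def z_def using norm_prime_powr_less_1[OF True, of s] s by auto
        have "complex_of_nat p powr (-of_real (Re s)) = of_real (real p powr (-Re s))"
          using powr_of_real[of "real p" "-Re s"] by simp
        also have "real p powr (-Re s) = r" unfolding r_def z_def
          using True by (simp add: norm_powr_of_nat prime_gt_0_nat)
        finally have e: "complex_of_nat p powr (-of_real (Re s)) = of_real r" .
        have "norm (1 - z) \<le> 1 + r" using norm_triangle_ineq4[of 1 z] by (simp add: r_def)
        moreover have "norm (1 - z) > 0" using r by (auto simp: r_def)
        moreover have "norm (1 - complex_of_real r) = 1 - r"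
          using r by (metis abs_of_pos diff_gt_0_iff_gt norm_of_real of_real_1 of_real_diff)
        ultimately have "norm (1 - z) * norm (1 - complex_of_real r) \<le> (1 + r) * (1 - r)"
          using r by (simp add: mult_right_mono)
        also have "\<dots> \<le> 1" by (simp add: algebra_simps)
        finally have "norm (1 - z) * norm (1 - complex_of_real r) \<le> 1" .
        moreover have "norm (1 - z) * norm (1 - complex_of_real r) > 0"
          using \<open>norm (1 - z) > 0\<close> \<open>norm (1 - complex_of_real r) = 1 - r\<close> r by simp
        ultimately show ?thesis unfolding e z_def[symmetric] using True
          by (simp add: norm_divide divide_simps)
      qed auto
    qed
    finally show ?thesis .
  qed
  ultimately show ?thesis by (intro LIMSEQ_le_const) auto
qed

lemma prodinf_tendsto:
  fixes f :: "nat \<Rightarrow> 'a :: {real_normed_field, banach}"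
  assumes "summable (\<lambda>n. norm (f n - 1))"
  shows "convergent_prod f" and "(\<lambda>N. \<Prod>n<N. f n) \<longlonglongrightarrow> prodinf f"
proof -
  show "convergent_prod f"
    using assms by (intro abs_convergent_prod_imp_convergent_prod summable_imp_abs_convergent_prod)
  thus "(\<lambda>N. \<Prod>n<N. f n) \<longlonglongrightarrow> prodinf f"
    unfolding LIMSEQ_lessThan_iff_atMost by (rule convergent_prod_LIMSEQ)
qed

section \<open>The Dirichlet series of \<open>f\<close> and its Euler factors\<close>

locale fake_mu =
  fixes f \<epsilon> :: "nat \<Rightarrow> real"
  assumes mult: "multiplicative f"
    and f_prime: "\<And>p. prime p \<Longrightarrow> f p = -1"
    and f_prime_square: "\<And>p. prime p \<Longrightarrow> f (p ^ 2) = 1"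
    and f_prime_pow: "\<And>p k. prime p \<Longrightarrow> k \<ge> 3 \<Longrightarrow> f (p ^ k) = \<epsilon> k"
    and eps: "\<And>k. k \<ge> 3 \<Longrightarrow> \<epsilon> k \<in> {-1, 0, 1}"
    and eps2: "\<epsilon> 2 = 1"
begin

definition e :: "nat \<Rightarrow> real" where
  "e k = (if k = 0 then 1 else if k = 1 then -1 else \<epsilon> k)"

text \<open>This is \<open>(1 + z) * (\<Sum>k. e k * z ^ k)\<close> for \<open>norm z < 1\<close>.
  Since \<open>e 0\<close>, \<open>e 1\<close>, \<open>e 2\<close> alternate between
  \<open>1\<close> and \<open>-1\<close>, the coefficients of \<open>z\<close> and
  \<open>z ^ 2\<close> cancel; starting at \<open>z ^ 3\<close>, the factors have a convergent
  product for \<open>Re s > 1 / 3\<close>.\<close>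

definition W :: "complex \<Rightarrow> complex" where
  "W z = 1 + (\<Sum>k. of_real (e (k + 2) + e (k + 3)) * z ^ (k + 3))"

definition U_factor :: "nat \<Rightarrow> complex \<Rightarrow> complex" where
  "U_factor p s = (if prime p then W (of_nat p powr (-s)) else 1)"

definition U :: "complex \<Rightarrow> complex" where
  "U s = (\<Prod>p. U_factor p s)"

lemma abs_e: "\<bar>e k\<bar> \<le> 1"
proof -
  consider "k = 0" | "k = 1" | "k = 2" | "k \<ge> 3" by linarith
  thus ?thesis by cases (use eps[of k] eps2 in \<open>auto simp: e_def\<close>)
qed

lemma f_prime_power: "prime p \<Longrightarrow> f (p ^ k) = e k"
proof -
  assume p: "prime p"
  have f1: "f 1 = 1" using mult by (simp add: multiplicative_def)
  consider "k = 0" | "k = 1" | "k = 2" | "k \<ge> 3" by linarith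
  thus ?thesis
    by cases (use p f1 f_prime f_prime_square f_prime_pow eps2 in \<open>auto simp: e_def\<close>)
qed

lemma f_mult: "m > 0 \<Longrightarrow> n > 0 \<Longrightarrow> coprime m n \<Longrightarrow> f (m * n) = f m * f n"
  using mult by (simp add: multiplicative_def)

lemma f_one: "f 1 = 1"
  using mult by (simp add: multiplicative_def)

lemma abs_f_le_1: "n > 0 \<Longrightarrow> \<bar>f n\<bar> \<le> 1"
proof (induction n rule: less_induct)
  case (less n)
  show ?case
  proof (cases "n = 1")
    case False
    then obtain p where p: "prime p" "p dvd n" using prime_factor_nat by blast
    have n0: "n \<noteq> 0" "\<not> is_unit p" using less.prems p by auto
    obtain y where y: "n = p ^ multiplicity p n * y" "\<not> p dvd y"
      using multiplicity_decompose'[OF n0] .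
    have k: "multiplicity p n > 0" using p n0 by (simp add: prime_multiplicity_gt_zero_iff)
    have y0: "y > 0" using y n0 by (metis gr0I mult_0_right)
    have "p ^ multiplicity p n > 1" using p k by (metis one_less_power prime_gt_1_nat)
    hence "y < p ^ multiplicity p n * y" using y0 by simp
    hence "y < n" using y(1) by linarith
    hence IH: "\<bar>f y\<bar> \<le> 1" using less.IH y0 by blast
    have "coprime (p ^ multiplicity p n) y" using p y by (simp add: prime_imp_coprime)
    hence "f (p ^ multiplicity p n * y) = e (multiplicity p n) * f y"
      using f_mult y0 p by (simp add: f_prime_power prime_gt_0_nat)
    thus ?thesis using y(1) IH abs_e[of "multiplicity p n"]
      by (metis abs_mult mult_le_one abs_ge_zero)
  qed (use f_one in auto)
qed

lemma summable_e_pow: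
  fixes z :: complex
  assumes "norm z < 1"
  shows "summable (\<lambda>k. norm (of_real (e (k + j)) * z ^ (k + i)))"
proof (rule summable_comparison_test')
  show "summable (\<lambda>k. norm z ^ k * norm z ^ i)"
    using assms by (intro summable_mult2 summable_geometric) auto
  show "norm (norm (of_real (e (k + j)) * z ^ (k + i))) \<le> norm z ^ k * norm z ^ i" for k
    using mult_right_mono[OF abs_e[of "k + j"], of "norm z ^ (k + i)"]
    by (simp add: norm_mult norm_power power_add)
qed

lemma W_eq:
  assumes z: "norm z < 1"
  shows "(1 + z) * (\<Sum>k. of_real (e k) * z ^ k) = W z"
proof -
  note sm = summable_norm_cancel[OF summable_e_pow[OF z]]
  define S where "S = (\<Sum>k. of_real (e k) * z ^ k)"
  have S3: "S = (\<Sum>k. of_real (e (k + 3)) * z ^ (k + 3)) + (1 - z + z ^ 2)"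
    unfolding S_def using suminf_split_initial_segment[of "\<lambda>k. of_real (e k) * z ^ k" 3] sm[of 0 0] eps2
    by (simp add: e_def eval_nat_numeral)
  have S2: "S = (\<Sum>k. of_real (e (k + 2)) * z ^ (k + 2)) + (1 - z)"
    unfolding S_def using suminf_split_initial_segment[of "\<lambda>k. of_real (e k) * z ^ k" 2] sm[of 0 0]
    by (simp add: e_def eval_nat_numeral)
  have "z * (\<Sum>k. of_real (e (k + 2)) * z ^ (k + 2)) = (\<Sum>k. z * (of_real (e (k + 2)) * z ^ (k + 2)))"
    by (rule suminf_mult [symmetric]) (use sm[of 2 2] in simp)
  also have "\<dots> = (\<Sum>k. of_real (e (k + 2)) * z ^ (k + 3))"
    by (simp add: eval_nat_numeral mult_ac)
  finally have S2': "z * S = (\<Sum>k. of_real (e (k + 2)) * z ^ (k + 3)) + (z - z ^ 2)"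
    unfolding S2 by (simp add: algebra_simps power2_eq_square)
  have "W z = 1 + ((\<Sum>k. of_real (e (k + 2)) * z ^ (k + 3)) + (\<Sum>k. of_real (e (k + 3)) * z ^ (k + 3)))"
    unfolding W_def by (subst suminf_add) (use sm[of 2 3] sm[of 3 3] in \<open>simp_all add: algebra_simps\<close>)
  also have "\<dots> = S + z * S" unfolding S2' by (subst S3) (simp add: algebra_simps)
  finally show ?thesis by (simp add: S_def algebra_simps)
qed

lemma holomorphic_W: "W holomorphic_on ball 0 1"
proof -
  have "(\<lambda>z. \<Sum>k. of_real (e k) * z ^ k) holomorphic_on ball 0 (1::real)"
  proof (rule power_series_holomorphic)
    fix w :: complex assume "w \<in> ball 0 1"
    thus "(\<lambda>n. of_real (e n) * (w - 0) ^ n) sums (\<Sum>k. of_real (e k) * w ^ k)"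
      using summable_norm_cancel[OF summable_e_pow[of w 0 0]] by (simp add: summable_sums)
  qed
  hence "(\<lambda>z. (1 + z) * (\<Sum>k. of_real (e k) * z ^ k)) holomorphic_on ball 0 1"
    by (intro holomorphic_intros)
  thus ?thesis by (rule holomorphic_transform) (use W_eq in auto)
qed

lemma W_bound:
  assumes z: "norm z < 1"
  shows "norm (W z - 1) \<le> 2 * norm z ^ 3 / (1 - norm z)"
proof -
  have "norm (of_real (e (k + 2) + e (k + 3)) * z ^ (k + 3)) \<le> 2 * norm z ^ 3 * norm z ^ k" for k
  proof -
    have "\<bar>e (k + 2) + e (k + 3)\<bar> \<le> 2" using abs_e[of "k + 2"] abs_e[of "k + 3"] by linarith
    hence "\<bar>e (k + 2) + e (k + 3)\<bar> * norm z ^ (k + 3) \<le> 2 * norm z ^ (k + 3)"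
      by (intro mult_right_mono) auto
    thus ?thesis by (simp add: norm_mult norm_power power_add mult_ac del: of_real_add)
  qed
  moreover have "(\<lambda>k. 2 * norm z ^ 3 * norm z ^ k) sums (2 * norm z ^ 3 * (1 / (1 - norm z)))"
    using z by (intro sums_mult geometric_sums) auto
  ultimately have "norm (\<Sum>k. of_real (e (k + 2) + e (k + 3)) * z ^ (k + 3)) \<le> 2 * norm z ^ 3 * (1 / (1 - norm z))"
    using norm_suminf_le[of "\<lambda>k. of_real (e (k + 2) + e (k + 3)) * z ^ (k + 3)" "\<lambda>k. 2 * norm z ^ 3 * norm z ^ k"]
    by (simp add: sums_iff)
  thus ?thesis by (simp add: W_def)
qed

lemma holomorphic_U_factor: "U_factor n holomorphic_on {s. Re s > 0}"
proof (cases "prime n")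
  case True
  have "(\<lambda>s. W (of_nat n powr (-s))) holomorphic_on {s. Re s > 0}"
    by (rule holomorphic_on_compose_gen[OF _ holomorphic_W, unfolded o_def])
       (use True norm_prime_powr_less_1[OF True] in \<open>auto intro!: holomorphic_intros simp: prime_gt_0_nat\<close>)
  thus ?thesis using True by (simp add: U_factor_def [abs_def])
qed (simp add: U_factor_def [abs_def])

text \<open>The denominator \<open>1 - norm z\<close> of \<open>W_bound\<close> is at least
  \<open>1 - 2 powr (-1/3)\<close>, its value for the prime \<open>2\<close> on the line
  \<open>Re s = 1 / 3\<close>. The majorant depends on \<open>s\<close> through \<open>x\<close>
  only, as uniform convergence requires.\<close>

lemma U_factor_bound:
  assumes s: "Re s \<ge> x" and x: "x \<ge> 1 / 3"
  shows "norm (U_factor n s - 1) \<le> 2 / (1 - 2 powr (-1/3)) * real n powr (- (3 * x))"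
proof (cases "prime n")
  case True
  define z where "z = of_nat n powr (-s)"
  define r where "r = norm z"
  have n: "n \<ge> 2" using True by (rule prime_ge_2_nat)
  have r: "r = real n powr (-Re s)" unfolding r_def z_def using n by (simp add: norm_powr_of_nat)
  have r1: "r \<le> real n powr (-x)" unfolding r using s n by (intro powr_mono) auto
  also have "\<dots> \<le> real n powr (-1/3)" using x n by (intro powr_mono) auto
  also have "\<dots> \<le> 2 powr (-1/3)" using n by (intro powr_mono2') auto
  finally have r2: "r \<le> 2 powr (-1/3)" .
  have q: "2 powr (-1/3) < (1::real)" using powr_less_mono[of "-1/3" 0 "2::real"] by simp
  have "norm (W z - 1) \<le> 2 * r ^ 3 / (1 - r)"
    using W_bound[of z] r2 q unfolding r_def by simp
  also have "\<dots> \<le> 2 * (real n powr (-x)) ^ 3 / (1 - 2 powr (-1/3))"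
    using r1 r2 q n unfolding r by (intro frac_le mult_left_mono power_mono) auto
  also have "(real n powr (-x)) ^ 3 = real n powr (- (3 * x))"
    using n by (simp add: powr_powr mult.commute flip: powr_realpow)
  finally show ?thesis using True by (simp add: U_factor_def z_def)
next
  case False
  have "2 powr (-1/3) < (1::real)" using powr_less_mono[of "-1/3" 0 "2::real"] by simp
  thus ?thesis using False by (simp add: U_factor_def)
qed

lemma U_lim:
  assumes s: "Re s > 1 / 3"
  shows "(\<lambda>N. \<Prod>n<N. U_factor n s) \<longlonglongrightarrow> U s"
proof -
  have "summable (\<lambda>n. norm (U_factor n s - 1))"
  proof (rule summable_comparison_test')
    show "summable (\<lambda>n. 2 / (1 - 2 powr (-1/3)) * real n powr (- (3 * Re s)))"
      using s by (intro summable_mult) (simp add: summable_real_powr_iff)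
    show "norm (norm (U_factor n s - 1)) \<le> 2 / (1 - 2 powr (-1/3)) * real n powr (- (3 * Re s))" for n
      using U_factor_bound[of "Re s" s n] s by simp
  qed
  thus ?thesis unfolding U_def by (rule prodinf_tendsto)
qed

lemma holomorphic_U: "U holomorphic_on {s. Re s > 1 / 3}"
proof (rule holomorphic_uniform_sequence[where f = "\<lambda>N s. \<Prod>n<N. U_factor n s"])
  show "open {s. Re s > 1 / 3}" by (rule open_halfspace_Re_gt)
  show "(\<lambda>s. \<Prod>n<N. U_factor n s) holomorphic_on {s. Re s > 1 / 3}" for N
    by (intro holomorphic_on_prod holomorphic_on_subset[OF holomorphic_U_factor]) auto
  fix z assume z: "z \<in> {s. Re s > 1 / 3}"
  define d where "d = (Re z - 1 / 3) / 2"
  have d: "d > 0" "Re z - d > 1 / 3" using z by (auto simp: d_def field_simps)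
  have sub: "cball z d \<subseteq> {s. Re s > 1 / 3}" using cball_Re_gt d(2) by blast
  have "uniformly_convergent_on (cball z d) (\<lambda>N s. \<Prod>n<N. U_factor n s)"
  proof (rule uniformly_convergent_on_prod')
    show "continuous_on (cball z d) (U_factor n)" for n
      by (rule holomorphic_on_imp_continuous_on[OF holomorphic_on_subset[OF holomorphic_U_factor]]) (use sub in auto)
    show "uniformly_convergent_on (cball z d) (\<lambda>N s. \<Sum>n<N. norm (U_factor n s - 1))"
    proof (rule Weierstrass_m_test')
      show "summable (\<lambda>n. 2 / (1 - 2 powr (-1/3)) * real n powr (- (3 * (Re z - d))))"
        using d by (intro summable_mult) (simp add: summable_real_powr_iff)
      show "norm (norm (U_factor n s - 1)) \<le> 2 / (1 - 2 powr (-1/3)) * real n powr (- (3 * (Re z - d)))" if "s \<in> cball z d" for n s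
        using U_factor_bound[of "Re z - d" s n] d Re_in_cball[OF that] by simp
    qed
  qed auto
  then obtain l where l: "uniform_limit (cball z d) (\<lambda>N s. \<Prod>n<N. U_factor n s) l sequentially"
    by (auto simp: uniformly_convergent_on_def)
  have "l s = U s" if "s \<in> cball z d" for s
    using LIMSEQ_unique[OF tendsto_uniform_limitI[OF l that] U_lim[of s]] that sub by auto
  hence "uniform_limit (cball z d) (\<lambda>N s. \<Prod>n<N. U_factor n s) U sequentially"
    using l by (subst (asm) uniform_limit_cong') auto
  thus "\<exists>d>0. cball z d \<subseteq> {s. Re s > 1 / 3} \<and> uniform_limit (cball z d) (\<lambda>N s. \<Prod>n<N. U_factor n s) U sequentially"
    using d sub by blast
qed

text \<open>For \<open>z = p powr (-s)\<close> the identity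
  \<open>1 / (1 - z) = (1 + z) / (1 - z ^ 2)\<close> turns the Euler factor of \<open>f\<close>
  times that of \<open>\<zeta>(s)\<close> into \<open>W z\<close> times that of
  \<open>\<zeta>(2s)\<close>.\<close>

lemma dirichlet_identity:
  assumes s: "Re s > 1"
  shows "dseries (\<lambda>n. f (Suc n)) s * (zeta_reg s / (s - 1)) = U s * (zeta_reg (2 * s) / (2 * s - 1))"
proof -
  have lim1: "(\<lambda>N. (\<Prod>p<N. if prime p then (\<Sum>k. of_real (f (p ^ k)) * (of_nat p powr (-s)) ^ k) else 1) *
       (\<Prod>p<N. if prime p then 1 / (1 - of_nat p powr (-s)) else 1))
     \<longlonglongrightarrow> dseries (\<lambda>n. f (Suc n)) s * (zeta_reg s / (s - 1))"
    by (intro tendsto_mult zeta_reg_euler_product euler_product_dirichlet s abs_f_le_1 f_one f_mult) 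
  have lim2: "(\<lambda>N. (\<Prod>p<N. U_factor p s) * (\<Prod>p<N. if prime p then 1 / (1 - of_nat p powr (-(2 * s))) else 1))
     \<longlonglongrightarrow> U s * (zeta_reg (2 * s) / (2 * s - 1))"
    by (intro tendsto_mult zeta_reg_euler_product U_lim) (use s in auto)
  have "(if prime p then (\<Sum>k. of_real (f (p ^ k)) * (of_nat p powr (-s)) ^ k) else 1) *
       (if prime p then 1 / (1 - of_nat p powr (-s)) else 1) =
      U_factor p s * (if prime p then 1 / (1 - of_nat p powr (-(2 * s))) else 1)" for p
  proof (cases "prime p")
    case True
    define z where "z = complex_of_nat p powr (-s)"
    have z: "norm z < 1" unfolding z_def using norm_prime_powr_less_1[OF True] s by auto
    have z2: "complex_of_nat p powr (-(2 * s)) = z ^ 2"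
      by (simp add: z_def power2_eq_square flip: powr_add)
    have nz: "1 - z \<noteq> 0" "1 + z \<noteq> 0" 
      using z by (auto simp: add_eq_0_iff)
    have "(\<Sum>k. of_real (f (p ^ k)) * z ^ k) = (\<Sum>k. of_real (e k) * z ^ k)"
      using True by (simp add: f_prime_power)
    moreover have "1 - z ^ 2 = (1 - z) * (1 + z)" by (simp add: power2_eq_square algebra_simps)
    moreover have "S * (1 / (1 - z)) = (1 + z) * S * (1 / ((1 - z) * (1 + z)))" for S
      using nz by (simp add: divide_simps)
    ultimately show ?thesis using True W_eq[OF z, symmetric]
      unfolding z2 U_factor_def z_def[symmetric] by simp
  qed (simp add: U_factor_def)
  hence *: "(\<lambda>N. (\<Prod>p<N. if prime p then (\<Sum>k. of_real (f (p ^ k)) * (of_nat p powr (-s)) ^ k) else 1) *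
       (\<Prod>p<N. if prime p then 1 / (1 - of_nat p powr (-s)) else 1)) =
     (\<lambda>N. (\<Prod>p<N. U_factor p s) * (\<Prod>p<N. if prime p then 1 / (1 - of_nat p powr (-(2 * s))) else 1))"
    unfolding prod.distrib [symmetric] by simp
  show ?thesis by (rule LIMSEQ_unique[OF lim1[unfolded *] lim2])
qed

text \<open>
  Only the Euler factor at \<open>2\<close> can vanish for \<open>Re s \<ge> 1 / 2\<close>: for \<open>p \<ge> 3\<close> the bound in \<open>W_bound\<close>
  is at most \<open>2 / (3 (\<surd>3 - 1)) < 1\<close>.
\<close>

lemma U_lower:
  "\<exists>c>0. \<forall>s. Re s \<ge> 1 / 2 \<longrightarrow> c * norm (W (2 powr (-s))) \<le> norm (U s)"
proof -
  define M where "M = (\<lambda>n. 2 * (real n powr (-1/2)) ^ 3 / (1 - real n powr (-1/2)))"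
  define a where "a = (\<lambda>n. if prime n \<and> n \<ge> 3 then 1 - M n else 1)"
  have r: "real n powr (-1/2) \<le> 1 / sqrt 3" if "n \<ge> 3" for n
  proof -
    have "real n powr (-1/2) \<le> 3 powr (-1/2)" using that by (intro powr_mono2') auto
    also have "\<dots> = 1 / sqrt 3"
      using powr_minus[of "3::real" "1/2"] powr_half_sqrt[of "3::real"] by (simp add: inverse_eq_divide)
    finally show ?thesis .
  qed
  \<comment> \<open>The value \<open>5 / 3\<close> serves two purposes: it gives
    \<open>2 / (3 * (sqrt 3 - 1)) < 1\<close>, and through \<open>1 / sqrt 3 < 3 / 5\<close> the
    constant \<open>5 = 2 / (1 - 3 / 5)\<close> of the summable bound.\<close>
  have s3: "sqrt 3 > 5 / 3" by (rule real_less_rsqrt) (simp add: power2_eq_square)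
  have s3': "1 / sqrt 3 < 3 / 5" using s3 by (simp add: field_simps)
  have M1: "M n \<ge> 0" "M n < 1" "M n \<le> 5 * real n powr (-3/2)" if n: "n \<ge> 3" for n
  proof -
    define t where "t = real n powr (-1/2)"
    have t: "0 < t" "t \<le> 1 / sqrt 3" using r[OF n] n by (auto simp: t_def)
    have t1: "t < 3 / 5" using t s3' by simp
    have Mt: "M n = 2 * t ^ 3 / (1 - t)" by (simp add: M_def t_def)
    show "M n \<ge> 0" unfolding Mt using t t1 by auto
    have "M n \<le> 2 * (1 / sqrt 3) ^ 3 / (1 - 1 / sqrt 3)"
      unfolding Mt using t s3' by (intro frac_le mult_left_mono power_mono diff_mono) auto
    also have "\<dots> = 2 / (3 * (sqrt 3 - 1))"
      using s3 by (simp add: field_simps power3_eq_cube)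
    also have "\<dots> < 1" using s3 by (simp add: field_simps)
    finally show "M n < 1" .
    have "M n \<le> 2 * t ^ 3 / (1 - 3 / 5)" unfolding Mt using t t1 by (intro frac_le) auto
    also have "\<dots> = 5 * t ^ 3" by simp
    also have "t ^ 3 = real n powr (-3/2)" using n unfolding t_def by (simp add: powr_powr flip: powr_realpow)
    finally show "M n \<le> 5 * real n powr (-3/2)" .
  qed
  have a: "0 < a n" "a n \<le> 1" for n using M1[of n] by (auto simp: a_def)
  have "summable (\<lambda>n. norm (a n - 1))"
  proof (rule summable_comparison_test')
    show "summable (\<lambda>n. 5 * real n powr (-3/2))" by (intro summable_mult) (simp add: summable_real_powr_iff)
    show "norm (norm (a n - 1)) \<le> 5 * real n powr (-3/2)" for n using M1[of n] by (auto simp: a_def)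
  qed
  note cp = prodinf_tendsto[OF this]
  \<comment> \<open>The partial products of \<open>a\<close> decrease to \<open>c\<close>, so
    \<open>c\<close> stays below each of them; it is positive because no factor vanishes. The value
    \<open>a 2 = 1\<close> leaves out the Euler factor at \<open>2\<close>.\<close>
  define c where "c = prodinf a"
  have lim: "(\<lambda>N. \<Prod>n<N. a n) \<longlonglongrightarrow> c" unfolding c_def by (rule cp)
  have dec: "decseq (\<lambda>N. \<Prod>n<N. a n)"
    by (rule decseq_SucI) (use a in \<open>auto intro!: mult_left_le prod_nonneg simp: less_imp_le\<close>)
  have cle: "c \<le> (\<Prod>n<N. a n)" for N using decseq_ge[OF dec lim] .
  have "c \<ge> 0" by (rule LIMSEQ_le_const[OF lim]) (use a in \<open>auto intro!: prod_nonneg simp: less_imp_le\<close>)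
  moreover have "c \<noteq> 0" unfolding c_def by (rule prodinf_nonzero[OF cp(1)]) (metis a(1) less_irrefl)
  ultimately have c: "c > 0" by simp
  have "c * norm (W (2 powr (-s))) \<le> norm (U s)" if s: "Re s \<ge> 1 / 2" for s
  proof -
    have fac: "a n \<le> norm (U_factor n s)" if "n \<noteq> 2" for n
    proof (cases "prime n")
      case True
      hence n: "n \<ge> 3" using that prime_ge_2_nat[of n] by simp
      define z where "z = of_nat n powr (-s)"
      define t where "t = real n powr (-1/2)"
      have "norm z = real n powr (-Re s)" using n by (simp add: z_def norm_powr_of_nat)
      also have "\<dots> \<le> t" unfolding t_def using s n by (intro powr_mono) auto
      finally have zt: "norm z \<le> t" .
      have t1: "t < 3 / 5" using r[OF n] s3' by (simp add: t_def)
      have "norm (W z - 1) \<le> 2 * norm z ^ 3 / (1 - norm z)" using zt t1 by (intro W_bound) auto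
      also have "\<dots> \<le> M n" unfolding M_def t_def[symmetric] using zt t1 order_trans[OF norm_ge_zero zt]
        by (intro frac_le mult_left_mono power_mono diff_mono) auto
      finally have "norm (W z) \<ge> 1 - M n" using norm_triangle_ineq2[of 1 "1 - W z"] by (simp add: norm_minus_commute)
      thus ?thesis using True n by (simp add: a_def U_factor_def z_def)
    qed (simp add: a_def U_factor_def)
    have "c * norm (W (2 powr (-s))) \<le> norm (\<Prod>n<N. U_factor n s)" if N: "N \<ge> 3" for N
    proof -
      have "(\<Prod>n<N. a n) = a 2 * (\<Prod>n\<in>{..<N} - {2}. a n)"
        using N by (subst prod.remove[of _ 2]) auto
      hence "c \<le> (\<Prod>n\<in>{..<N} - {2}. a n)" using cle[of N] by (simp add: a_def)
      also have "\<dots> \<le> (\<Prod>n\<in>{..<N} - {2}. norm (U_factor n s))"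
        by (rule prod_mono) (use fac a in \<open>auto simp: less_imp_le\<close>)
      finally have "c * norm (U_factor 2 s) \<le> (\<Prod>n\<in>{..<N} - {2}. norm (U_factor n s)) * norm (U_factor 2 s)"
        by (intro mult_right_mono) auto
      also have "\<dots> = (\<Prod>n<N. norm (U_factor n s))"
        using N by (subst (2) prod.remove[of _ 2]) (auto simp: mult_ac)
      finally show ?thesis by (simp add: prod_norm U_factor_def)
    qed
    moreover have "(\<lambda>N. norm (\<Prod>n<N. U_factor n s)) \<longlonglongrightarrow> norm (U s)"
      by (intro tendsto_norm U_lim) (use s in auto)
    ultimately show ?thesis by (intro LIMSEQ_le_const) auto
  qed
  thus ?thesis using c by blast
qed

lemma U_half: "U (1 / 2) = of_real (\<Prod>p. if prime p
           then 1 + (\<Sum>\<^sub>\<infinity>k\<in>{3..}. (\<epsilon> (k - 1) + \<epsilon> k) / real p powr (real k / 2)) else 1)"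
proof -
  define a where "a = (\<lambda>p. if prime p
           then 1 + (\<Sum>\<^sub>\<infinity>k\<in>{3..}. (\<epsilon> (k - 1) + \<epsilon> k) / real p powr (real k / 2)) else 1)"
  have ua: "U_factor p (1 / 2) = of_real (a p)" for p
  proof (cases "prime p")
    case True
    define t where "t = real p powr (-1/2)"
    have p: "p > 1" using True by (rule prime_gt_1_nat)
    have z: "complex_of_nat p powr (-(1/2)) = of_real t"
      using powr_of_real[of "real p" "-1/2"] by (simp add: t_def)
    have t1: "0 < t" "t < 1" using p powr_less_mono[of "-1/2" 0 "real p"] by (auto simp: t_def)
    have bij: "bij_betw (\<lambda>k. k + 3) UNIV {3::nat..}"
      by (rule bij_betwI[of _ _ _ "\<lambda>k. k - 3"]) auto
    define g where "g = (\<lambda>k. (e (k + 2) + e (k + 3)) * t ^ (k + 3))"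
    have sm: "summable (\<lambda>k. norm (g k))"
    proof (rule summable_comparison_test')
      show "summable (\<lambda>k. norm (of_real (e (k + 2)) * complex_of_real t ^ (k + 3)) + norm (of_real (e (k + 3)) * complex_of_real t ^ (k + 3)))"
        using t1 by (intro summable_add summable_e_pow) auto
      show "norm (norm (g k)) \<le> norm (of_real (e (k + 2)) * complex_of_real t ^ (k + 3)) + norm (of_real (e (k + 3)) * complex_of_real t ^ (k + 3))" for k
        using norm_triangle_ineq[of "e (k + 2) * t ^ (k + 3)" "e (k + 3) * t ^ (k + 3)"]
        by (simp add: g_def norm_mult norm_power algebra_simps abs_mult power_abs)
    qed
    have "(\<Sum>\<^sub>\<infinity>k\<in>{3..}. (\<epsilon> (k - 1) + \<epsilon> k) / real p powr (real k / 2)) =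
        (\<Sum>\<^sub>\<infinity>k. (\<epsilon> (k + 3 - 1) + \<epsilon> (k + 3)) / real p powr (real (k + 3) / 2))"
      by (rule infsum_reindex_bij_betw[OF bij, symmetric])
    also have "\<dots> = (\<Sum>\<^sub>\<infinity>k. g k)"
    proof (rule infsum_cong)
      fix k
      have "t ^ (k + 3) = t powr real (k + 3)" using powr_realpow[OF t1(1), of "k + 3"] by simp
      also have "\<dots> = real p powr (-(real (k + 3) / 2))" unfolding t_def by (simp add: powr_powr)
      also have "\<dots> = 1 / real p powr (real (k + 3) / 2)" by (rule powr_minus_divide)
      finally show "(\<epsilon> (k + 3 - 1) + \<epsilon> (k + 3)) / real p powr (real (k + 3) / 2) = g k"
        by (simp add: g_def e_def)
    qed
    also have "\<dots> = suminf g" by (rule infsum_eq_suminf_norm[OF sm])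
    finally have "a p = 1 + suminf g" using True by (simp add: a_def)
    moreover have "of_real (suminf g) = (\<Sum>k. complex_of_real (g k))"
      by (intro sums_unique sums_of_real summable_sums summable_norm_cancel[OF sm])
    ultimately show ?thesis using True by (simp add: U_factor_def z W_def g_def)
  qed (simp add: U_factor_def a_def)
  have "summable (\<lambda>n. norm (a n - 1))"
  proof (rule summable_comparison_test')
    show "summable (\<lambda>n. 2 / (1 - 2 powr (-1/3)) * real n powr (- (3 * (1/2))))"
      by (intro summable_mult) (simp add: summable_real_powr_iff)
    show "norm (norm (a n - 1)) \<le> 2 / (1 - 2 powr (-1/3)) * real n powr (- (3 * (1/2)))" for n
      using U_factor_bound[of "1/2" "1/2" n] unfolding ua
      using norm_of_real[of "a n - 1", where 'a = complex] by simp
  qed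
  hence "(\<lambda>N. \<Prod>n<N. a n) \<longlonglongrightarrow> prodinf a" by (rule prodinf_tendsto)
  hence "(\<lambda>N. complex_of_real (\<Prod>n<N. a n)) \<longlonglongrightarrow> of_real (prodinf a)" by (rule tendsto_of_real)
  moreover have "(\<lambda>N. complex_of_real (\<Prod>n<N. a n)) \<longlonglongrightarrow> U (1 / 2)"
    using U_lim[of "1 / 2"] by (simp add: ua)
  ultimately show ?thesis unfolding a_def [symmetric] by (rule LIMSEQ_unique[THEN sym])
qed

end

section \<open>Summatory functions bounded on one side\<close>

text \<open>The quantity is the first-order Taylor remainder of \<open>v powr (-s)\<close> at
  \<open>a\<close>. Its extra power of \<open>a\<close> makes the trivial estimate
  \<open>\<bar>F n\<bar> \<le> n\<close> sufficient for the convergence of \<open>R\<close> in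
  \<open>Re s > 0\<close>.\<close>

lemma powr_difference_bound:
  fixes s :: complex and a :: real
  assumes a: "a > 0" and s: "Re s \<ge> -2"
  shows "norm (s * of_real a powr (-s - 1) - (of_real a powr (-s) - of_real (a + 1) powr (-s)))
     \<le> norm (s * (s + 1)) * a powr (-Re s - 2)"
proof -
  define A where "A = complex_of_real a"
  define g where "g = (\<lambda>u. s * A powr (-s - 1) * u - A powr (-s) + (A + u) powr (-s))"
  define g1 where "g1 = (\<lambda>u. s * A powr (-s - 1) - s * (A + u) powr (-s - 1))"
  define g2 where "g2 = (\<lambda>u. s * (s + 1) * (A + u) powr (-s - 2))"
  note P = shifted_powr[OF a, folded A_def]
  have "norm (g 1 - g 0) \<le> norm (s * (s + 1)) * a powr (-Re s - 2)"
  proof (rule second_order_remainder)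
    fix u :: complex assume u: "u \<in> closed_segment 0 1"
    show "(g has_field_derivative g1 u) (at u within closed_segment 0 1)" unfolding g_def g1_def
      by (rule DERIV_cong, (rule P(1)[OF u] derivative_intros)+, simp add: algebra_simps)
    show "(g1 has_field_derivative g2 u) (at u within closed_segment 0 1)" unfolding g1_def g2_def
      by (rule DERIV_cong, (rule P(1)[OF u] derivative_intros)+, simp add: algebra_simps diff_diff_eq)
    show "norm (g2 u) \<le> norm (s * (s + 1)) * a powr (-Re s - 2)"
      unfolding g2_def norm_mult using P(4)[OF u s] by (intro mult_left_mono) auto
  qed (simp add: g1_def)
  thus ?thesis by (simp add: g_def A_def algebra_simps)
qed

lemma dseries_real_nonneg:
  assumes a: "\<And>n. a n \<ge> 0" and sm: "summable (\<lambda>n. a n * real (Suc n) powr (-x))"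
  shows "dseries a (of_real x) = of_real (\<Sum>n. a n * real (Suc n) powr (-x))"
proof -
  have *: "of_real (a n) * of_nat (Suc n) powr (- of_real x) = complex_of_real (a n * real (Suc n) powr (-x))" for n
    using powr_of_real[of "real (Suc n)" "-x"] by simp
  hence "dseries a (of_real x) = (\<Sum>n. complex_of_real (a n * real (Suc n) powr (-x)))"
    unfolding dseries_def by (simp only: *)
  also have "\<dots> = of_real (\<Sum>n. a n * real (Suc n) powr (-x))"
    by (intro sums_unique[symmetric] sums_of_real summable_sums sm)
  finally show ?thesis .
qed

lemma norm_dseries_le:
  assumes a: "\<And>n. a n \<ge> 0" and sm: "summable (\<lambda>n. a n * real (Suc n) powr (-Re s))"
  shows "norm (dseries a s) \<le> (\<Sum>n. a n * real (Suc n) powr (-Re s))"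
  unfolding dseries_def
  by (rule norm_suminf_le[OF _ sm]) (use norm_dseries_term[of a _ s] a in auto)

text \<open>Near \<open>1 / 2\<close> the limit bounds \<open>h\<close>, and further to the right
  monotonicity does, by the value at one fixed point \<open>y'\<close>.\<close>

lemma pole_bound:
  fixes h :: "real \<Rightarrow> real"
  assumes dec: "\<And>x y. 1 / 2 < x \<Longrightarrow> x \<le> y \<Longrightarrow> h y \<le> h x"
    and lim: "((\<lambda>x. (x - 1 / 2) * h x) \<longlongrightarrow> L) (at_right (1 / 2))"
  shows "\<exists>K\<ge>0. \<forall>x>1 / 2. h x \<le> K * (1 + 1 / (x - 1 / 2))"
proof -
  have "eventually (\<lambda>x. (x - 1 / 2) * h x < \<bar>L\<bar> + 1) (at_right (1 / 2))"
    by (rule order_tendstoD[OF lim]) auto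
  then obtain y where y: "y > 1 / 2" "\<And>x. 1 / 2 < x \<Longrightarrow> x < y \<Longrightarrow> (x - 1 / 2) * h x < \<bar>L\<bar> + 1"
    unfolding eventually_at_right_field by blast
  define y' where "y' = (y + 1 / 2) / 2"
  have y': "1 / 2 < y'" "y' < y" using y(1) by (auto simp: y'_def)
  define K where "K = \<bar>L\<bar> + 1 + \<bar>h y'\<bar>"
  have K: "K \<ge> 0" by (simp add: K_def)
  have "h x \<le> K * (1 + 1 / (x - 1 / 2))" if x: "x > 1 / 2" for x
  proof (cases "x < y")
    case True
    have "h x \<le> (\<bar>L\<bar> + 1) / (x - 1 / 2)" using y(2)[OF x True] x by (simp add: field_simps)
    also have "\<dots> \<le> K / (x - 1 / 2)" using x by (intro divide_right_mono) (auto simp: K_def)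
    also have "\<dots> \<le> K * (1 + 1 / (x - 1 / 2))" using K by (simp add: algebra_simps)
    finally show ?thesis .
  next
    case False
    have "h x \<le> h y'" using False y' by (intro dec) auto
    also have "\<dots> \<le> K * 1" by (simp add: K_def)
    also have "\<dots> \<le> K * (1 + 1 / (x - 1 / 2))" using x K by (intro mult_left_mono) auto
    finally show ?thesis .
  qed
  thus ?thesis using K by blast
qed

section \<open>Partial summation\<close>

context fake_mu
begin

definition F :: "nat \<Rightarrow> real" where "F n = (\<Sum>k = 1..n. f k)"

text \<open>Partial summation would naturally lead to an integral of the step function. Dividing
  \<open>F\<close> by the argument keeps a Dirichlet series, for which Landau's theorem is
  available; the price is the correction \<open>R\<close>, holomorphic for
  \<open>Re s > 0\<close>.\<close>

definition Fc :: "nat \<Rightarrow> real" where "Fc n = F (Suc n) / real (Suc n)"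

definition R_term :: "nat \<Rightarrow> complex \<Rightarrow> complex" where
  "R_term n s = of_real (F (Suc n)) * (s * of_nat (Suc n) powr (-s - 1) -
     (of_nat (Suc n) powr (-s) - of_nat (Suc (Suc n)) powr (-s)))"

definition R :: "complex \<Rightarrow> complex" where "R s = (\<Sum>n. R_term n s)"

lemma abs_F_le: "\<bar>F n\<bar> \<le> real n"
proof -
  have "\<bar>F n\<bar> \<le> (\<Sum>k = 1..n. \<bar>f k\<bar>)" unfolding F_def by (rule sum_abs)
  also have "\<dots> \<le> (\<Sum>k = 1..n. 1)" by (intro sum_mono abs_f_le_1) auto
  finally show ?thesis by simp
qed

lemma abs_Fc_le: "\<bar>Fc n\<bar> \<le> 1"
  using abs_F_le[of "Suc n"] by (simp add: Fc_def divide_simps del: of_nat_Suc)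

lemma R_term_bound:
  assumes "Re s \<ge> 0"
  shows "norm (R_term n s) \<le> norm (s * (s + 1)) * real (Suc n) powr (-Re s - 1)"
proof -
  define X where "X = s * of_nat (Suc n) powr (-s - 1) - (of_nat (Suc n) powr (-s) - of_nat (Suc (Suc n)) powr (-s))"
  have "norm X \<le> norm (s * (s + 1)) * real (Suc n) powr (-Re s - 2)"
    using powr_difference_bound[of "real (Suc n)" s] assms by (simp add: X_def add_ac)
  hence "\<bar>F (Suc n)\<bar> * norm X \<le> real (Suc n) * (norm (s * (s + 1)) * real (Suc n) powr (-Re s - 2))"
    by (intro mult_mono abs_F_le) auto
  also have "\<dots> = norm (s * (s + 1)) * (real (Suc n) powr 1 * real (Suc n) powr (-Re s - 2))" by simp
  also have "real (Suc n) powr 1 * real (Suc n) powr (-Re s - 2) = real (Suc n) powr (-Re s - 1)"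
  proof -
    have "1 + (-Re s - 2) = -Re s - 1" by simp
    thus ?thesis by (metis powr_add)
  qed
  finally show ?thesis by (simp add: R_term_def X_def norm_mult)
qed

lemma summable_R_term:
  assumes "Re s > 0"
  shows "summable (\<lambda>n. R_term n s)"
proof (rule summable_comparison_test')
  show "summable (\<lambda>n. norm (s * (s + 1)) * real (Suc n) powr (-Re s - 1))"
    by (intro summable_mult summable_Suc_powr) (use assms in auto)
qed (use R_term_bound assms in auto)

lemma holomorphic_R: "R holomorphic_on {s. Re s > 0}"
  unfolding R_def [abs_def]
proof (rule holomorphic_series_Mtest)
  show "open {s. Re s > 0}" by (rule open_halfspace_Re_gt)
  show "R_term n holomorphic_on {s. Re s > 0}" for n
    unfolding R_term_def by (intro holomorphic_intros) (auto simp del: of_nat_Suc)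
  fix z assume z: "z \<in> {s. Re s > 0}"
  define d where "d = Re z / 2"
  have d: "d > 0" "Re z - d > 0" using z by (auto simp: d_def)
  define K where "K = (norm z + d) * (norm z + d + 1)"
  show "\<exists>d>0. \<exists>M. cball z d \<subseteq> {s. Re s > 0} \<and> summable M \<and> (\<forall>n. \<forall>w\<in>cball z d. norm (R_term n w) \<le> M n)"
  proof (intro exI conjI allI ballI)
    show "summable (\<lambda>n. K * real (Suc n) powr (- (Re z - d) - 1))"
      by (intro summable_mult summable_Suc_powr) (use d in auto)
    fix n w assume w: "w \<in> cball z d"
    have "norm (R_term n w) \<le> norm (w * (w + 1)) * real (Suc n) powr (-Re w - 1)"
      by (rule R_term_bound) (use Re_in_cball[OF w] d in auto)
    also have "\<dots> \<le> K * real (Suc n) powr (- (Re z - d) - 1)"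
      unfolding K_def norm_mult using Re_in_cball[OF w] d norm_triangle_ineq[of w 1]
      by (intro mult_mono powr_mono) auto
    finally show "norm (R_term n w) \<le> K * real (Suc n) powr (- (Re z - d) - 1)" .
  qed (use d cball_Re_gt in auto)
qed

lemma R_bound: "\<exists>C\<ge>0. \<forall>s. Re s \<ge> 1 / 2 \<longrightarrow> norm (R s) \<le> C * (1 + norm s)\<^sup>2"
proof -
  define C where "C = (\<Sum>n. real (Suc n) powr (-3/2))"
  have smC: "summable (\<lambda>n. real (Suc n) powr (-3/2))" by (rule summable_Suc_powr) simp
  have "norm (R s) \<le> C * (1 + norm s)\<^sup>2" if s: "Re s \<ge> 1 / 2" for s
  proof -
    have b: "norm (R_term n s) \<le> norm (s * (s + 1)) * real (Suc n) powr (-3/2)" for n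
    proof -
      have "norm (R_term n s) \<le> norm (s * (s + 1)) * real (Suc n) powr (-Re s - 1)"
        by (rule R_term_bound) (use s in auto)
      also have "\<dots> \<le> norm (s * (s + 1)) * real (Suc n) powr (-3/2)"
        using s by (intro mult_left_mono powr_mono) auto
      finally show ?thesis .
    qed
    have "norm (R s) \<le> (\<Sum>n. norm (s * (s + 1)) * real (Suc n) powr (-3/2))"
      unfolding R_def by (rule norm_suminf_le[OF b summable_mult[OF smC]])
    also have "\<dots> = norm (s * (s + 1)) * C" unfolding C_def by (rule suminf_mult[OF smC])
    also have "\<dots> \<le> ((1 + norm s) * (1 + norm s)) * C" unfolding norm_mult C_def
      using norm_triangle_ineq[of s 1] by (intro mult_right_mono mult_mono suminf_nonneg smC) auto
    finally show ?thesis by (simp add: power2_eq_square mult_ac)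
  qed
  moreover have "C \<ge> 0" unfolding C_def by (intro suminf_nonneg smC) auto
  ultimately show ?thesis by blast
qed

lemma summable_Fc:
  assumes "x > 1"
  shows "summable (\<lambda>n. \<bar>Fc n\<bar> * real (Suc n) powr (-x))"
  by (rule summable_bounded_powr[OF abs_Fc_le assms])

text \<open>Partial summation writes the series of \<open>f\<close> as the sum of
  \<open>F n * (n powr (-s) - (n + 1) powr (-s))\<close>. Replacing each difference by
  \<open>s * n powr (-s - 1)\<close> produces \<open>s * dseries Fc s\<close>, and \<open>R\<close>
  records the change.\<close>

lemma abel_summation:
  assumes s: "Re s > 1"
  shows "s * dseries Fc s = dseries (\<lambda>n. f (Suc n)) s + R s"
proof -
  define g where "g = (\<lambda>n. of_nat (Suc n) powr (-s) :: complex)"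
  have g_lim: "(\<lambda>n. of_real (F (Suc n)) * g (Suc n)) \<longlonglongrightarrow> 0"
  proof (rule Lim_null_comparison)
    show "eventually (\<lambda>n. norm (of_real (F (Suc n)) * g (Suc n)) \<le> real (Suc (Suc n)) powr (1 - Re s)) sequentially"
    proof (rule always_eventually, rule allI)
      fix n
      have "norm (of_real (F (Suc n)) * g (Suc n)) = \<bar>F (Suc n)\<bar> * real (Suc (Suc n)) powr (-Re s)"
        by (simp add: g_def norm_mult norm_powr_of_nat del: of_nat_Suc)
      also have "\<dots> \<le> real (Suc (Suc n)) powr 1 * real (Suc (Suc n)) powr (-Re s)"
        using abs_F_le[of "Suc n"] by (intro mult_right_mono) auto
      also have "\<dots> = real (Suc (Suc n)) powr (1 - Re s)" by (simp only: powr_add [symmetric]) simp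
      finally show "norm (of_real (F (Suc n)) * g (Suc n)) \<le> real (Suc (Suc n)) powr (1 - Re s)" .
    qed
    show "(\<lambda>n. real (Suc (Suc n)) powr (1 - Re s)) \<longlonglongrightarrow> 0" using s by real_asymp
  qed
  have smT: "summable (\<lambda>n. of_real (f (Suc n)) * g n)"
    unfolding g_def
    by (rule dseries_summable(2)[OF summable_bounded_powr[OF abs_f_le_1 s]]) auto
  have part: "(\<Sum>n<N. of_real (F (Suc n)) * (g n - g (Suc n))) =
      (\<Sum>n<N. of_real (f (Suc n)) * g n) - of_real (F N) * g N" for N
  proof (induction N)
    case (Suc N)
    have "F (Suc N) = F N + f (Suc N)" by (simp add: F_def)
    thus ?case using Suc by (simp add: algebra_simps)
  qed (simp add: F_def)
  have "(\<lambda>N. of_real (F N) * g N) \<longlonglongrightarrow> 0"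
    using g_lim by (subst (asm) filterlim_sequentially_Suc)
  hence "(\<lambda>N. (\<Sum>n<N. of_real (f (Suc n)) * g n) - of_real (F N) * g N) \<longlonglongrightarrow>
     (\<Sum>n. of_real (f (Suc n)) * g n) - 0"
    using smT by (intro tendsto_diff) (simp_all add: summable_LIMSEQ)
  hence 1: "(\<lambda>n. of_real (F (Suc n)) * (g n - g (Suc n))) sums dseries (\<lambda>n. f (Suc n)) s"
    unfolding sums_def part by (simp add: dseries_def g_def)
  have 2: "(\<lambda>n. R_term n s) sums R s"
    unfolding R_def using s by (intro summable_sums summable_R_term) auto
  have "(\<lambda>n. of_real (F (Suc n)) * (g n - g (Suc n)) + R_term n s) sums (dseries (\<lambda>n. f (Suc n)) s + R s)"
    by (rule sums_add[OF 1 2])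
  moreover have "of_real (F (Suc n)) * (g n - g (Suc n)) + R_term n s = s * (of_real (Fc n) * of_nat (Suc n) powr (-s))" for n
  proof -
    have "of_nat (Suc n) powr (-s - 1) = of_nat (Suc n) powr (-s) / (of_nat (Suc n) :: complex)"
      by (simp add: powr_diff del: of_nat_Suc)
    thus ?thesis by (simp add: g_def R_term_def Fc_def algebra_simps del: of_nat_Suc)
  qed
  ultimately have "(\<lambda>n. s * (of_real (Fc n) * of_nat (Suc n) powr (-s))) sums (dseries (\<lambda>n. f (Suc n)) s + R s)"
    by simp
  moreover have "(\<lambda>n. s * (of_real (Fc n) * of_nat (Suc n) powr (-s))) sums (s * dseries Fc s)"
    unfolding dseries_def
    by (intro sums_mult summable_sums dseries_summable(2)[OF summable_Fc[of "Re s"]]) (use s in auto)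
  ultimately show ?thesis by (rule sums_unique2[symmetric])
qed

end

context fake_mu
begin

text \<open>The denominator is \<open>\<zeta>(1/2)\<close>, because
  \<open>zeta_reg s = (s - 1) * \<zeta>(s)\<close>.\<close>

definition bias :: real where
  "bias = Re (U (1 / 2)) / (-2 * Re (zeta_reg (1 / 2)))"

lemma U_half_bias: "U (1 / 2) = - 2 * of_real bias * zeta_reg (1 / 2)"
proof -
  have "zeta_reg (1 / 2) = of_real (Re (zeta_reg (1 / 2)))"
    using zeta_reg_of_real[of "1 / 2"] by simp
  moreover have "Re (zeta_reg (1 / 2)) \<noteq> 0" using zeta_reg_real_pos[of "1 / 2"] by simp
  moreover have "U (1 / 2) = of_real (Re (U (1 / 2)))" by (simp add: U_half)
  ultimately show ?thesis
    by (simp add: complex_eq_iff bias_def)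
qed

text \<open>Here \<open>\<delta>\<close> selects the side of the bound, and \<open>Tt\<close> is the
  continuation of \<open>T\<close>. The identity is multiplied out, so it says something at the
  zeros of zeta too. The last clause limits the strength of a possible pole on the critical line by
  a multiple of \<open>\<kappa>\<close>; it is obtained from the residue of the majorizing series at
  \<open>1 / 2\<close>.\<close>

lemma one_sided_continuation:
  fixes \<delta> \<kappa> :: real
  assumes \<delta>: "\<delta> = 1 \<or> \<delta> = -1" and \<kappa>: "\<kappa> > 0"
    and ev: "eventually (\<lambda>n. \<kappa> * sqrt (real n) + \<delta> * (bias * sqrt (real n) - F n) \<ge> 0) sequentially"
  shows "\<exists>Tt. Tt holomorphic_on {s. Re s > 1 / 2} \<and>
     (\<forall>s. Re s > 1 / 2 \<longrightarrow> zeta_reg s * Tt s = (s - 1) * U s * (zeta_reg (2 * s) / (2 * s - 1))) \<and>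
     (\<exists>K. \<forall>s. Re s > 1 / 2 \<longrightarrow> norm (Tt s) \<le> K * (1 + norm s)\<^sup>2 * (1 + 1 / (Re s - 1 / 2))) \<and>
     (\<forall>y. y \<noteq> 0 \<longrightarrow> eventually (\<lambda>x. (x - 1 / 2) * norm (Tt (Complex x y)) \<le> (norm (Complex (1 / 2) y) + 1) * \<kappa>) (at_right (1 / 2)))"
proof -
  define q where "q = (\<lambda>n. real (Suc n) powr (-1/2))"
  define a where "a = (\<lambda>n. \<kappa> * q n + \<delta> * (bias * q n - Fc n))"
  define c where "c = \<kappa> + \<delta> * bias"
  have a_alt: "a n = c * q n - \<delta> * Fc n" for n by (simp add: a_def c_def algebra_simps)
  have a_sq: "a n = (\<kappa> * sqrt (real (Suc n)) + \<delta> * (bias * sqrt (real (Suc n)) - F (Suc n))) / real (Suc n)" for n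
  proof -
    have "q n = 1 / sqrt (real (Suc n))"
      using powr_minus[of "real (Suc n)" "1/2"] powr_half_sqrt[of "real (Suc n)"]
      by (simp add: q_def inverse_eq_divide del: of_nat_Suc)
    also have "\<dots> = sqrt (real (Suc n)) / real (Suc n)"
      by (simp add: field_simps del: of_nat_Suc)
    finally show ?thesis by (simp add: a_def Fc_def field_simps del: of_nat_Suc)
  qed
  obtain n0 where n0: "\<And>n. n \<ge> n0 \<Longrightarrow> \<kappa> * sqrt (real n) + \<delta> * (bias * sqrt (real n) - F n) \<ge> 0"
    using ev unfolding eventually_sequentially by blast
  have a_nonneg: "a n \<ge> 0" if "n \<ge> n0" for n
    unfolding a_sq using n0[of "Suc n"] that by (intro divide_nonneg_nonneg) auto
  \<comment> \<open>Nonnegativity starts at \<open>n0\<close>. The earlier terms form the Dirichlet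
    polynomial \<open>fin\<close>, which is entire and bounded for
    \<open>Re s \<ge> 0\<close>.\<close>
  define ap where "ap = (\<lambda>n. if n < n0 then 0 else a n)"
  have ap: "ap n \<ge> 0" for n using a_nonneg by (simp add: ap_def)
  define fin where "fin = (\<lambda>s. \<Sum>n<n0. of_real (a n) * of_nat (Suc n) powr (-s) :: complex)"
  define B where "B = (\<Sum>n<n0. \<bar>a n\<bar>)"
  have fin_hol: "fin holomorphic_on A" for A
    unfolding fin_def by (intro holomorphic_intros) (auto simp del: of_nat_Suc)
  have fin_bd: "norm (fin s) \<le> B" if "Re s \<ge> 0" for s
  proof -
    have "norm (fin s) \<le> (\<Sum>n<n0. \<bar>a n\<bar> * real (Suc n) powr (-Re s))"
      unfolding fin_def norm_dseries_term[symmetric] by (rule norm_sum)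
    also have "\<dots> \<le> (\<Sum>n<n0. \<bar>a n\<bar> * 1)"
      using that powr_mono[of "-Re s" 0] by (intro sum_mono mult_left_mono) auto
    finally show ?thesis by (simp add: B_def)
  qed
  have q_pow: "q n * real (Suc n) powr (-x) = real (Suc n) powr (-(x + 1/2))" for n x
    unfolding q_def by (simp only: powr_add [symmetric]) (simp add: algebra_simps)
  have smq: "summable (\<lambda>n. q n * real (Suc n) powr (-x))" if "x > 1 / 2" for x
    unfolding q_pow by (rule summable_Suc_powr) (use that in auto)
  have smq': "summable (\<lambda>n. \<bar>q n\<bar> * real (Suc n) powr (-x))" if "x > 1 / 2" for x
    using smq[OF that] by (simp add: q_def)
  have dq: "dseries q s = zeta_reg (s + 1 / 2) / (s - 1 / 2)" if "Re s > 1 / 2" for s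
  proof -
    have "(\<lambda>n. of_nat (Suc n) powr (-(s + 1 / 2))) sums (zeta_reg (s + 1 / 2) / (s + 1 / 2 - 1))"
      by (rule zeta_reg_sums) (use that in simp)
    moreover have "of_nat (Suc n) powr (-(s + 1 / 2)) = of_real (q n) * of_nat (Suc n) powr (-s)" for n
    proof -
      have "complex_of_real (q n) = of_nat (Suc n) powr (-1/2)"
        using powr_of_real[of "real (Suc n)" "-1/2"] by (simp add: q_def)
      thus ?thesis by (simp only: powr_add [symmetric]) (simp add: algebra_simps)
    qed
    moreover have "s + 1 / 2 - 1 = s - 1 / 2" by simp
    ultimately show ?thesis by (simp add: dseries_def sums_iff del: of_nat_Suc)
  qed
  have sma: "summable (\<lambda>n. \<bar>a n\<bar> * real (Suc n) powr (-x))" if "x > 1" for x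
  proof (rule summable_comparison_test')
    show "summable (\<lambda>n. \<bar>c\<bar> * (q n * real (Suc n) powr (-x)) + \<bar>Fc n\<bar> * real (Suc n) powr (-x))"
      by (intro summable_add summable_mult smq summable_Fc) (use that in auto)
    fix n
    have "\<bar>a n\<bar> \<le> \<bar>c\<bar> * q n + \<bar>Fc n\<bar>"
      unfolding a_alt using \<delta> abs_triangle_ineq4[of "c * q n" "\<delta> * Fc n"] by (auto simp: abs_mult q_def)
    hence "\<bar>a n\<bar> * real (Suc n) powr (-x) \<le> (\<bar>c\<bar> * q n + \<bar>Fc n\<bar>) * real (Suc n) powr (-x)"
      by (intro mult_right_mono) auto
    thus "norm (\<bar>a n\<bar> * real (Suc n) powr (-x)) \<le> \<bar>c\<bar> * (q n * real (Suc n) powr (-x)) + \<bar>Fc n\<bar> * real (Suc n) powr (-x)"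
      by (simp add: algebra_simps)
  qed
  have smap: "summable (\<lambda>n. ap n * real (Suc n) powr (-x))" if "x > 1" for x
    by (rule summable_comparison_test'[OF sma[OF that]]) (auto simp: ap_def abs_mult)
  have smap': "summable (\<lambda>n. \<bar>ap n\<bar> * real (Suc n) powr (-x))" if "x > 1" for x
    using smap[OF that] ap by simp
  have split: "dseries ap s + fin s = of_real c * dseries q s - of_real \<delta> * dseries Fc s" if "Re s > 1" for s
  proof -
    have "(\<lambda>n. (if n < n0 then of_real (a n) * of_nat (Suc n) powr (-s) else 0)) sums (\<Sum>n | n < n0. of_real (a n) * of_nat (Suc n) powr (-s) :: complex)"
      by (rule sums_If_finite) auto
    also have "(\<Sum>n | n < n0. of_real (a n) * of_nat (Suc n) powr (-s) :: complex) = fin s"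
      by (simp add: fin_def lessThan_def)
    finally have 1: "(\<lambda>n. (if n < n0 then of_real (a n) * of_nat (Suc n) powr (-s) else 0)) sums fin s" .
    have 2: "(\<lambda>n. of_real (ap n) * of_nat (Suc n) powr (-s)) sums dseries ap s"
      unfolding dseries_def by (intro summable_sums dseries_summable(2)[OF smap'[of "Re s"]]) (use that in auto)
    have 3: "(\<lambda>n. of_real c * (of_real (q n) * of_nat (Suc n) powr (-s)) - of_real \<delta> * (of_real (Fc n) * of_nat (Suc n) powr (-s)))
       sums (of_real c * dseries q s - of_real \<delta> * dseries Fc s)"
      unfolding dseries_def
      by (intro sums_diff sums_mult summable_sums dseries_summable(2)[OF smq'[of "Re s"]] dseries_summable(2)[OF summable_Fc[of "Re s"]])
         (use that in auto)
    have "(\<lambda>n. of_real (ap n) * of_nat (Suc n) powr (-s) + (if n < n0 then of_real (a n) * of_nat (Suc n) powr (-s) else 0)) =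
      (\<lambda>n. of_real c * (of_real (q n) * of_nat (Suc n) powr (-s)) - of_real \<delta> * (of_real (Fc n) * of_nat (Suc n) powr (-s)) :: complex)"
      by (rule ext) (auto simp: ap_def a_alt algebra_simps simp del: of_nat_Suc)
    note * = this
    show ?thesis by (rule sums_unique2[OF sums_add[OF 2 1] 3[folded *]])
  qed
  \<comment> \<open>\<open>D\<close> clears all denominators: \<open>zeta_reg s\<close> from
    \<open>T\<close>, \<open>s\<close> from partial summation, and \<open>s - 1 / 2\<close> from the
    poles of \<open>\<zeta>(s + 1/2)\<close> and \<open>\<zeta>(2s)\<close>. It has no zero on the
    real axis to the right of \<open>1 / 2\<close>. Holomorphy of \<open>N\<close> up to
    \<open>Re s > 1 / 3\<close> allows evaluation at \<open>1 / 2\<close>.\<close>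
  define D where "D = (\<lambda>s. (s - 1 / 2) * s * zeta_reg s)"
  define N where "N = (\<lambda>s. of_real c * s * zeta_reg s * zeta_reg (s + 1 / 2) -
     of_real \<delta> * ((s - 1) * U s * zeta_reg (2 * s) / 2 + (s - 1 / 2) * R s * zeta_reg s) - fin s * D s)"
  have zhol: "zeta_reg holomorphic_on {s. Re s > 1 / 3}"
    by (rule holomorphic_on_subset[OF holomorphic_zeta_reg]) auto
  have zhol1: "(\<lambda>s. zeta_reg (s + 1 / 2)) holomorphic_on {s. Re s > 1 / 3}"
    by (rule holomorphic_on_compose_gen[OF _ holomorphic_zeta_reg, unfolded o_def]) (auto intro!: holomorphic_intros)
  have zhol2: "(\<lambda>s. zeta_reg (2 * s)) holomorphic_on {s. Re s > 1 / 3}"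
    by (rule holomorphic_on_compose_gen[OF _ holomorphic_zeta_reg, unfolded o_def]) (auto intro!: holomorphic_intros)
  have Rhol: "R holomorphic_on {s. Re s > 1 / 3}"
    by (rule holomorphic_on_subset[OF holomorphic_R]) auto
  have Dhol: "D holomorphic_on {s. Re s > 1 / 3}"
    unfolding D_def by (intro holomorphic_intros zhol)
  have Nhol: "N holomorphic_on {s. Re s > 1 / 3}"
    unfolding N_def by (intro holomorphic_intros zhol zhol1 zhol2 Rhol Dhol holomorphic_U fin_hol) auto
  have eq2: "dseries ap s * D s = N s" if s: "Re s > 2" for s
  proof -
    define Z where "Z = zeta_reg s"
    define V where "V = zeta_reg (s + 1 / 2)"
    define T where "T = dseries (\<lambda>n. f (Suc n)) s"
    define u where "u = s - 1 / 2"
    have "Re u > 0" using s by (simp add: u_def)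
    hence u0: "u \<noteq> 0" "s \<noteq> 0" "s \<noteq> 1" using s by auto
    have TZ: "T * Z * u = (s - 1) * U s * zeta_reg (2 * s) / 2"
    proof -
      have "T * (Z / (s - 1)) = U s * (zeta_reg (2 * s) / (2 * s - 1))"
        unfolding T_def Z_def by (rule dirichlet_identity) (use s in auto)
      moreover have "2 * s - 1 = 2 * u" by (simp add: u_def)
      ultimately have "T * (Z / (s - 1)) = U s * (zeta_reg (2 * s) / (2 * u))" by simp
      thus ?thesis using u0 by (simp add: field_simps)
    qed
    have Fs: "s * dseries Fc s = T + R s" unfolding T_def by (rule abel_summation) (use s in auto)
    define v where "v = V / u"
    have A: "dseries ap s = of_real c * v - of_real \<delta> * dseries Fc s - fin s"
      using split[of s] dq[of s] s by (simp add: v_def V_def u_def algebra_simps)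
    have Ds: "D s = u * s * Z" by (simp add: D_def u_def Z_def)
    have "dseries ap s * D s = of_real c * v * (u * s * Z) - of_real \<delta> * (s * dseries Fc s) * u * Z - fin s * D s"
      unfolding A Ds by (simp add: algebra_simps)
    also have "\<dots> = of_real c * s * Z * V - of_real \<delta> * (T * Z * u + u * R s * Z) - fin s * D s"
      unfolding Fs v_def using u0 by (simp add: algebra_simps)
    also have "\<dots> = N s" unfolding TZ unfolding N_def Z_def V_def u_def by (rule refl)
    finally show ?thesis .
  qed
  have Dnz: "D (of_real x) \<noteq> 0" if "x > 1 / 2" for x
  proof -
    have "complex_of_real x - 1 / 2 = of_real (x - 1 / 2)" by simp
    hence "complex_of_real x - 1 / 2 \<noteq> 0" using that by (metis diff_gt_0_iff_gt less_irrefl of_real_eq_0_iff)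
    thus ?thesis using that zeta_reg_nonzero[of x] by (simp add: D_def)
  qed
  have Dh: "D holomorphic_on {s. Re s > 1 / 2}" "N holomorphic_on {s. Re s > 1 / 2}"
    by (rule holomorphic_on_subset[OF Dhol] holomorphic_on_subset[OF Nhol]; force)+
  note L = landau[OF ap smap[of 2] Dh Dnz eq2, simplified]
  have sm: "summable (\<lambda>n. ap n * real (Suc n) powr (-x))" if "x > 1 / 2" for x
    using L(1)[of x] that by simp
  have eq: "dseries ap s * D s = N s" if "Re s > 1 / 2" for s
    using L(2)[of s] that by simp
  define h where "h = (\<lambda>x. \<Sum>n. ap n * real (Suc n) powr (-x))"
  define hq where "hq = (\<lambda>x. \<Sum>n. q n * real (Suc n) powr (-x))"
  have q0: "q n \<ge> 0" for n by (simp add: q_def)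
  have h_dec: "h y \<le> h x" if "1 / 2 < x" "x \<le> y" for x y
    unfolding h_def using that ap by (intro suminf_le sm mult_left_mono powr_mono) auto
  have hq_dec: "hq y \<le> hq x" if "1 / 2 < x" "x \<le> y" for x y
    unfolding hq_def using that q0 by (intro suminf_le smq mult_left_mono powr_mono) auto
  have h0: "h x \<ge> 0" if "x > 1 / 2" for x unfolding h_def using ap sm[OF that] by (intro suminf_nonneg) auto
  have right_eq: "eventually (\<lambda>x::real. x > 1 / 2) (at_right (1 / 2))"
    by (simp add: eventually_at_filter)
  have real_lim: "((\<lambda>x. g (complex_of_real x)) \<longlongrightarrow> g (1 / 2)) (at_right (1 / 2))"
    if "g holomorphic_on {s. Re s > 1 / 3}" for g :: "complex \<Rightarrow> complex"
  proof -
    have "isCont g (1 / 2)" by (rule isCont_holomorphic_Re_gt[OF that]) simp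
    moreover have "((\<lambda>x. complex_of_real x) \<longlongrightarrow> 1 / 2) (at_right (1 / 2))"
      using tendsto_of_real[OF tendsto_ident_at, of "1/2::real" "{1/2<..}", where 'a = complex] by simp
    ultimately show ?thesis by (rule isCont_tendsto_compose)
  qed
  have h_lim: "((\<lambda>x. (x - 1 / 2) * h x) \<longlongrightarrow> \<kappa>) (at_right (1 / 2))"
  proof -
    have znz: "zeta_reg (1 / 2) \<noteq> 0" using zeta_reg_nonzero[of "1 / 2"] by simp
    have "((\<lambda>x. N (of_real x) / (of_real x * zeta_reg (of_real x))) \<longlongrightarrow> N (1 / 2) / (1 / 2 * zeta_reg (1 / 2))) (at_right (1 / 2))"
      using znz by (intro tendsto_divide tendsto_mult real_lim Nhol zhol holomorphic_on_ident) auto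
    \<comment> \<open>The choice of the bias enters here: by \<open>U_half_bias\<close> and
      \<open>zeta_reg 1 = 1\<close>, the term with \<open>U\<close> contributes
      \<open>- \<delta> * bias\<close> to the quotient and reduces
      \<open>c = \<kappa> + \<delta> * bias\<close> to \<open>\<kappa>\<close>.\<close>
    also have "N (1 / 2) / (1 / 2 * zeta_reg (1 / 2)) = of_real \<kappa>"
      using znz unfolding N_def U_half_bias by (simp add: D_def c_def field_simps)
    finally have "((\<lambda>x. Re (N (of_real x) / (of_real x * zeta_reg (of_real x)))) \<longlongrightarrow> Re (of_real \<kappa>)) (at_right (1 / 2))"
      by (rule tendsto_Re)
    moreover have "eventually (\<lambda>x. Re (N (of_real x) / (of_real x * zeta_reg (of_real x))) = (x - 1 / 2) * h x) (at_right (1 / 2))"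
      using right_eq
    proof eventually_elim
      case (elim x)
      have "N (of_real x) = of_real (h x) * D (of_real x)"
        using eq[of "of_real x"] elim dseries_real_nonneg[OF ap sm[OF elim]] by (simp add: h_def)
      moreover have "complex_of_real x \<noteq> 0" "zeta_reg (of_real x) \<noteq> 0" using elim zeta_reg_nonzero[of x] by auto
      ultimately have "N (of_real x) / (of_real x * zeta_reg (of_real x)) = of_real (h x) * (of_real x - 1 / 2)"
        by (simp add: D_def)
      also have "\<dots> = of_real ((x - 1 / 2) * h x)" by simp
      finally show ?case by (simp only: Re_complex_of_real)
    qed
    ultimately show ?thesis by (simp add: tendsto_cong)
  qed
  have hq_lim: "((\<lambda>x. (x - 1 / 2) * hq x) \<longlongrightarrow> 1) (at_right (1 / 2))"
  proof -
    have "((\<lambda>x. Re (zeta_reg (of_real x + 1 / 2))) \<longlongrightarrow> Re (zeta_reg (1 / 2 + 1 / 2))) (at_right (1 / 2))"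
      by (intro tendsto_Re real_lim zhol1)
    moreover have "eventually (\<lambda>x. Re (zeta_reg (of_real x + 1 / 2)) = (x - 1 / 2) * hq x) (at_right (1 / 2))"
      using right_eq
    proof eventually_elim
      case (elim x)
      have "of_real (hq x) = zeta_reg (of_real x + 1 / 2) / of_real (x - 1 / 2)"
        using dq[of "of_real x"] elim dseries_real_nonneg[OF q0 smq[OF elim]] by (simp add: hq_def)
      moreover have "complex_of_real (x - 1 / 2) \<noteq> 0" unfolding of_real_eq_0_iff using elim by simp
      ultimately have "zeta_reg (of_real x + 1 / 2) = of_real (hq x) * of_real (x - 1 / 2)"
        by (metis nonzero_eq_divide_eq)
      hence "zeta_reg (of_real x + 1 / 2) = of_real ((x - 1 / 2) * hq x)"
        by (simp only: of_real_mult mult.commute)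
      thus ?case by (simp only: Re_complex_of_real)
    qed
    ultimately show ?thesis by (simp add: tendsto_cong)
  qed
  \<comment> \<open>This is \<open>T = s * dseries Fc s - R s\<close>, with
    \<open>dseries Fc\<close> expressed through the nonnegative series by \<open>a_alt\<close>;
    since \<open>\<delta> * \<delta> = 1\<close>, multiplying by \<open>\<delta>\<close> inverts the
    sign.\<close>
  define Tt where "Tt = (\<lambda>s. of_real \<delta> * s * (of_real c * (zeta_reg (s + 1 / 2) / (s - 1 / 2)) - fin s - dseries ap s) - R s)"
  have sne: "s - 1 / 2 \<noteq> 0" if "Re s > 1 / 2" for s :: complex using that by (auto simp: complex_eq_iff)
  have aphol: "dseries ap holomorphic_on {s. Re s > 1 / 2}"
    by (rule holomorphic_dseries_Re_gt) (use sm ap in simp)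
  have "Tt holomorphic_on {s. Re s > 1 / 2}"
    unfolding Tt_def
    by (intro holomorphic_intros aphol fin_hol holomorphic_on_subset[OF zhol1] holomorphic_on_subset[OF Rhol])
       (use sne in auto)
  moreover have "zeta_reg s * Tt s = (s - 1) * U s * (zeta_reg (2 * s) / (2 * s - 1))" if s: "Re s > 1 / 2" for s
  proof -
    define u where "u = s - 1 / 2"
    have u0: "u \<noteq> 0" using sne[OF s] by (simp add: u_def)
    have u2: "2 * s - 1 = 2 * u" by (simp add: u_def)
    have d2: "complex_of_real \<delta> * of_real \<delta> = 1" using \<delta> by auto
    have e: "dseries ap s * (u * s * zeta_reg s) = N s" using eq[OF s] by (simp add: D_def u_def)
    have "u * (zeta_reg s * Tt s) = of_real \<delta> * (of_real c * s * zeta_reg s * zeta_reg (s + 1 / 2) - fin s * (u * s * zeta_reg s) - dseries ap s * (u * s * zeta_reg s)) - u * R s * zeta_reg s"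
      using u0 unfolding Tt_def u_def[symmetric] by (simp add: algebra_simps)
    also have "\<dots> = (of_real \<delta> * of_real \<delta>) * ((s - 1) * U s * zeta_reg (2 * s) / 2 + u * R s * zeta_reg s) - u * R s * zeta_reg s"
      unfolding e N_def D_def u_def[symmetric] by (simp add: algebra_simps)
    also have "\<dots> = u * ((s - 1) * U s * (zeta_reg (2 * s) / (2 * s - 1)))"
      unfolding d2 u2 using u0 by simp
    finally show ?thesis using u0 mult_left_cancel by blast
  qed
  moreover have zle: "norm (zeta_reg (s + 1 / 2) / (s - 1 / 2)) \<le> hq (Re s)" if s: "Re s > 1 / 2" for s
    unfolding dq[OF s, symmetric] hq_def by (rule norm_dseries_le[OF q0 smq[OF s]])
  have aple: "norm (dseries ap s) \<le> h (Re s)" if s: "Re s > 1 / 2" for s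
    unfolding h_def by (rule norm_dseries_le[OF ap sm[OF s]])
  have Tt_le: "norm (Tt s) \<le> norm s * (\<bar>c\<bar> * norm (zeta_reg (s + 1 / 2) / (s - 1 / 2)) + B + h (Re s)) + norm (R s)"
    if s: "Re s > 1 / 2" for s
  proof -
    have "norm (Tt s) \<le> norm (of_real \<delta> * s * (of_real c * (zeta_reg (s + 1 / 2) / (s - 1 / 2)) - fin s - dseries ap s)) + norm (R s)"
      unfolding Tt_def by (rule norm_triangle_ineq4)
    also have "norm (of_real \<delta> * s * (of_real c * (zeta_reg (s + 1 / 2) / (s - 1 / 2)) - fin s - dseries ap s)) =
       norm s * norm (of_real c * (zeta_reg (s + 1 / 2) / (s - 1 / 2)) - fin s - dseries ap s)"
      using \<delta> by (auto simp: norm_mult)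
    also have "norm (of_real c * (zeta_reg (s + 1 / 2) / (s - 1 / 2)) - fin s - dseries ap s) \<le>
       norm (of_real c * (zeta_reg (s + 1 / 2) / (s - 1 / 2))) + norm (fin s) + norm (dseries ap s)"
      by (intro order_trans[OF norm_triangle_ineq4] add_mono order_refl)
    also have "\<dots> \<le> \<bar>c\<bar> * norm (zeta_reg (s + 1 / 2) / (s - 1 / 2)) + B + h (Re s)"
      using fin_bd[of s] aple[OF s] s by (intro add_mono) (auto simp: norm_mult norm_divide)
    finally show ?thesis by (simp add: mult_left_mono)
  qed
  moreover have "\<exists>K. \<forall>s. Re s > 1 / 2 \<longrightarrow> norm (Tt s) \<le> K * (1 + norm s)\<^sup>2 * (1 + 1 / (Re s - 1 / 2))"
  proof -
    obtain K1 where K1: "K1 \<ge> 0" "\<And>x. x > 1 / 2 \<Longrightarrow> h x \<le> K1 * (1 + 1 / (x - 1 / 2))"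
      using pole_bound[OF h_dec h_lim] by auto
    obtain K2 where K2: "K2 \<ge> 0" "\<And>x. x > 1 / 2 \<Longrightarrow> hq x \<le> K2 * (1 + 1 / (x - 1 / 2))"
      using pole_bound[OF hq_dec hq_lim] by auto
    obtain C where C: "C \<ge> 0" "\<And>s. Re s \<ge> 1 / 2 \<Longrightarrow> norm (R s) \<le> C * (1 + norm s)\<^sup>2"
      using R_bound by auto
    have B0: "B \<ge> 0" unfolding B_def by (intro sum_nonneg) auto
    have "norm (Tt s) \<le> (\<bar>c\<bar> * K2 + B + K1 + C) * (1 + norm s)\<^sup>2 * (1 + 1 / (Re s - 1 / 2))" if s: "Re s > 1 / 2" for s
    proof -
      define m where "m = 1 + 1 / (Re s - 1 / 2)"
      define n where "n = (1 + norm s)\<^sup>2"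
      have m: "m \<ge> 1" using s by (simp add: m_def)
      have n: "n \<ge> norm s" "n \<ge> 0" unfolding n_def by (simp_all add: power2_eq_square algebra_simps)
      have "norm (zeta_reg (s + 1 / 2) / (s - 1 / 2)) \<le> K2 * m"
        using zle[OF s] K2(2)[OF s] unfolding m_def by linarith
      hence "\<bar>c\<bar> * norm (zeta_reg (s + 1 / 2) / (s - 1 / 2)) \<le> \<bar>c\<bar> * (K2 * m)" by (rule mult_left_mono) simp
      moreover have "B \<le> B * m" using B0 m mult_left_mono[of 1 m B] by simp
      moreover have "h (Re s) \<le> K1 * m" using K1(2)[OF s] by (simp add: m_def)
      ultimately have 1: "\<bar>c\<bar> * norm (zeta_reg (s + 1 / 2) / (s - 1 / 2)) + B + h (Re s) \<le> (\<bar>c\<bar> * K2 + B + K1) * m"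
        by (simp add: algebra_simps)
      have "0 \<le> \<bar>c\<bar> * norm (zeta_reg (s + 1 / 2) / (s - 1 / 2)) + B + h (Re s)"
        using B0 h0[OF s] by simp
      hence "norm s * (\<bar>c\<bar> * norm (zeta_reg (s + 1 / 2) / (s - 1 / 2)) + B + h (Re s)) \<le> n * ((\<bar>c\<bar> * K2 + B + K1) * m)"
        using n 1 by (intro mult_mono) auto
      moreover have "norm (R s) \<le> C * n * m"
      proof -
        have "norm (R s) \<le> C * n * 1" using C(2)[of s] s by (simp add: n_def)
        also have "\<dots> \<le> C * n * m" using m C n by (intro mult_left_mono) auto
        finally show ?thesis .
      qed
      ultimately have "norm (Tt s) \<le> n * ((\<bar>c\<bar> * K2 + B + K1) * m) + C * n * m" using Tt_le[OF s] by linarith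
      thus ?thesis unfolding m_def[symmetric] n_def[symmetric] by (simp add: algebra_simps)
    qed
    thus ?thesis by blast
  qed
  moreover have "eventually (\<lambda>x. (x - 1 / 2) * norm (Tt (Complex x y)) \<le> (norm (Complex (1 / 2) y) + 1) * \<kappa>) (at_right (1 / 2))"
    if y: "y \<noteq> 0" for y
  proof -
    have Clim: "((\<lambda>x. Complex x y) \<longlongrightarrow> Complex (1 / 2) y) (at_right (1 / 2))"
      by (intro tendsto_Complex tendsto_const tendsto_ident_at)
    have gl: "((\<lambda>x. g (Complex x y)) \<longlongrightarrow> g (Complex (1 / 2) y)) (at_right (1 / 2))"
      if "g holomorphic_on {s. Re s > 1 / 3}" for g :: "complex \<Rightarrow> complex"
    proof -
      have "isCont g (Complex (1 / 2) y)" by (rule isCont_holomorphic_Re_gt[OF that]) simp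
      thus ?thesis using Clim by (rule isCont_tendsto_compose)
    qed
    have x0: "((\<lambda>x::real. x - 1 / 2) \<longlongrightarrow> 1 / 2 - 1 / 2) (at_right (1 / 2))"
      by (intro tendsto_intros)
    have nz: "Complex (1 / 2) y - 1 / 2 \<noteq> 0" using y by (simp add: complex_eq_iff)
    \<comment> \<open>Away from the real axis every term except \<open>h x\<close> stays bounded as
      \<open>x\<close> tends to \<open>1 / 2\<close>, so the factor \<open>x - 1 / 2\<close> removes
      it. Only the contribution \<open>norm (Complex (1 / 2) y) * \<kappa>\<close> of
      \<open>h\<close> remains, and the \<open>+ 1\<close> in the claim is the room for a strict
      inequality.\<close>
    have "((\<lambda>x. norm (Complex x y) * (\<bar>c\<bar> * ((x - 1 / 2) * norm (zeta_reg (Complex x y + 1 / 2) / (Complex x y - 1 / 2))) + (x - 1 / 2) * B + (x - 1 / 2) * h x)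
        + (x - 1 / 2) * norm (R (Complex x y))) \<longlongrightarrow>
       norm (Complex (1 / 2) y) * (\<bar>c\<bar> * ((1 / 2 - 1 / 2) * norm (zeta_reg (Complex (1 / 2) y + 1 / 2) / (Complex (1 / 2) y - 1 / 2))) + (1 / 2 - 1 / 2) * B + \<kappa>)
        + (1 / 2 - 1 / 2) * norm (R (Complex (1 / 2) y))) (at_right (1 / 2))"
      by (intro tendsto_add tendsto_mult tendsto_norm tendsto_divide tendsto_diff tendsto_const x0 h_lim Clim gl[OF zhol1] gl[OF Rhol] nz tendsto_ident_at)
    hence "((\<lambda>x. norm (Complex x y) * (\<bar>c\<bar> * ((x - 1 / 2) * norm (zeta_reg (Complex x y + 1 / 2) / (Complex x y - 1 / 2))) + (x - 1 / 2) * B + (x - 1 / 2) * h x)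
        + (x - 1 / 2) * norm (R (Complex x y))) \<longlongrightarrow> norm (Complex (1 / 2) y) * \<kappa>) (at_right (1 / 2))" by simp
    hence "eventually (\<lambda>x. norm (Complex x y) * (\<bar>c\<bar> * ((x - 1 / 2) * norm (zeta_reg (Complex x y + 1 / 2) / (Complex x y - 1 / 2))) + (x - 1 / 2) * B + (x - 1 / 2) * h x)
        + (x - 1 / 2) * norm (R (Complex x y)) < (norm (Complex (1 / 2) y) + 1) * \<kappa>) (at_right (1 / 2))"
      by (rule order_tendstoD) (use \<kappa> in \<open>simp add: algebra_simps\<close>)
    thus ?thesis using right_eq
    proof eventually_elim
      case (elim x)
      have "(x - 1 / 2) * norm (Tt (Complex x y)) \<le> (x - 1 / 2) * (norm (Complex x y) * (\<bar>c\<bar> * norm (zeta_reg (Complex x y + 1 / 2) / (Complex x y - 1 / 2)) + B + h x) + norm (R (Complex x y)))"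
        using Tt_le[of "Complex x y"] elim(2) by (intro mult_left_mono) auto
      also have "\<dots> = norm (Complex x y) * (\<bar>c\<bar> * ((x - 1 / 2) * norm (zeta_reg (Complex x y + 1 / 2) / (Complex x y - 1 / 2))) + (x - 1 / 2) * B + (x - 1 / 2) * h x)
        + (x - 1 / 2) * norm (R (Complex x y))" by (simp only: algebra_simps)
      finally show ?case using elim(1) by linarith
    qed
  qed
  ultimately show ?thesis by blast
qed

end

section \<open>Entire functions of exponential type\<close>

text \<open>Near \<open>z0\<close> the function factors as \<open>(z - z0) ^ n * g z\<close> with
  \<open>g\<close> free of zeros, and \<open>P\<close> is a small multiple of
  \<open>(z - z0) ^ n\<close>. The multiple is also small enough for
  \<open>norm (poly P z) \<le> 1\<close> on all of \<open>K\<close>, so that such polynomials can be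
  multiplied.\<close>

lemma poly_minorant_local:
  fixes W :: "complex \<Rightarrow> complex"
  assumes W: "W holomorphic_on S" "open S" "connected S" "\<exists>w\<in>S. W w \<noteq> 0" and z0: "z0 \<in> S"
    and K: "bounded K"
  shows "\<exists>r>0. \<exists>P. P \<noteq> 0 \<and> (\<forall>z\<in>ball z0 r. norm (poly P z) \<le> norm (W z)) \<and> (\<forall>z\<in>K. norm (poly P z) \<le> 1)"
proof -
  obtain g r n where r: "r > 0" and g: "continuous_on (ball z0 r) g" "\<And>w. w \<in> ball z0 r \<Longrightarrow> g w \<noteq> 0"
    "\<And>w. w \<in> ball z0 r \<Longrightarrow> W w = (w - z0) ^ n * g w"
  proof (cases "W z0 = 0")
    case False
    have "isCont W z0"
      using W z0 by (intro continuous_on_interior[OF holomorphic_on_imp_continuous_on[OF W(1)]]) (auto simp: interior_open)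
    then obtain e where e: "e > 0" "\<forall>y. dist z0 y < e \<longrightarrow> W y \<noteq> 0"
      using continuous_at_avoid[of z0 W 0] False by auto
    obtain e' where e': "e' > 0" "ball z0 e' \<subseteq> S" using W(2) z0 open_contains_ball by blast
    have "ball z0 (min e e') \<subseteq> S" using e'(2) by auto
    hence "continuous_on (ball z0 (min e e')) W"
      by (rule holomorphic_on_imp_continuous_on[OF holomorphic_on_subset[OF W(1)]])
    thus ?thesis by (intro that[of "min e e'" W 0]) (use e e' in auto)
  next
    case True
    have "\<not> W constant_on S" using W(4) True z0 by (metis constant_on_def)
    from holomorphic_factor_zero_nonconstant[OF W(1-3) z0 True this]
    obtain g r n where "0 < n" "0 < r" "ball z0 r \<subseteq> S" "g holomorphic_on ball z0 r"
      "\<And>w. w \<in> ball z0 r \<Longrightarrow> W w = (w - z0) ^ n * g w" "\<And>w. w \<in> ball z0 r \<Longrightarrow> g w \<noteq> 0" by metis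
    thus ?thesis by (intro that[of r g n]) (auto intro: holomorphic_on_imp_continuous_on)
  qed
  have sub: "cball z0 (r / 2) \<subseteq> ball z0 r" using r by auto
  have "\<exists>x\<in>cball z0 (r / 2). \<forall>y\<in>cball z0 (r / 2). norm (g x) \<le> norm (g y)"
    using r by (intro continuous_attains_inf continuous_intros continuous_on_subset[OF g(1) sub]) auto
  then obtain x where x: "x \<in> cball z0 (r / 2)" "\<And>y. y \<in> cball z0 (r / 2) \<Longrightarrow> norm (g x) \<le> norm (g y)" by blast
  have m: "norm (g x) > 0" using g(2) x(1) sub by auto
  obtain M where M: "M > 0" "\<And>z. z \<in> K \<Longrightarrow> norm z \<le> M" using K bounded_pos by blast
  define M' where "M' = M + norm z0"
  have M': "M' > 0" "norm (z - z0) \<le> M'" if "z \<in> K" for z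
    using M(1) M(2)[OF that] norm_triangle_ineq4[of z z0] by (auto simp: M'_def add_pos_nonneg)
  have M'0: "M' > 0" using M(1) by (simp add: M'_def add_pos_nonneg)
  define c where "c = min (norm (g x)) (1 / M' ^ n)"
  have c: "c > 0" "c \<le> norm (g x)" "c * M' ^ n \<le> 1"
  proof -
    have "c * M' ^ n \<le> 1 / M' ^ n * M' ^ n" unfolding c_def using M'0 by (intro mult_right_mono) auto
    thus "c * M' ^ n \<le> 1" using M'0 by simp
  qed (use m M'0 in \<open>auto simp: c_def\<close>)
  define P where "P = smult (of_real c) ([:- z0, 1:] ^ n)"
  have P: "norm (poly P z) = c * norm (z - z0) ^ n" for z
    using c by (simp add: P_def norm_mult norm_power)
  show ?thesis
  proof (intro exI conjI ballI)
    show "r / 2 > 0" using r by simp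
    show "P \<noteq> 0" using c by (simp add: P_def)
    show "norm (poly P z) \<le> norm (W z)" if "z \<in> ball z0 (r / 2)" for z
    proof -
      have "c * norm (z - z0) ^ n \<le> norm (g z) * norm (z - z0) ^ n"
        using c x(2)[of z] that by (intro mult_right_mono) auto
      also have "\<dots> = norm (W z)" using g(3)[of z] that r by (simp add: norm_mult norm_power mult.commute)
      finally show ?thesis unfolding P .
    qed
    show "norm (poly P z) \<le> 1" if "z \<in> K" for z
    proof -
      have "c * norm (z - z0) ^ n \<le> c * M' ^ n" using c M'(2)[OF that] by (intro mult_left_mono power_mono) auto
      thus ?thesis unfolding P using c(3) by linarith
    qed
  qed
qed

text \<open>At each point of \<open>K\<close> one factor of the product over a finite subcover lies
  below \<open>W\<close>, and the others have modulus at most \<open>1\<close>. The product replaces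
  the Euler factor at \<open>2\<close> where an entire function is required.\<close>

lemma poly_minorant:
  fixes W :: "complex \<Rightarrow> complex"
  assumes W: "W holomorphic_on S" "open S" "connected S" "\<exists>w\<in>S. W w \<noteq> 0" and K: "compact K" "K \<subseteq> S"
  shows "\<exists>P. P \<noteq> 0 \<and> (\<forall>z\<in>K. norm (poly P z) \<le> norm (W z))"
proof -
  have "\<forall>z0\<in>K. \<exists>r P. r > 0 \<and> P \<noteq> 0 \<and> (\<forall>z\<in>ball z0 r. norm (poly P z) \<le> norm (W z)) \<and> (\<forall>z\<in>K. norm (poly P z) \<le> 1)"
    using poly_minorant_local[OF W _ compact_imp_bounded[OF K(1)]] K(2) by blast
  then obtain r P where rP: "\<And>z0. z0 \<in> K \<Longrightarrow> r z0 > 0 \<and> P z0 \<noteq> 0 \<and>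
      (\<forall>z\<in>ball z0 (r z0). norm (poly (P z0) z) \<le> norm (W z)) \<and> (\<forall>z\<in>K. norm (poly (P z0) z) \<le> 1)"
    by metis
  have "K \<subseteq> (\<Union>z0\<in>K. ball z0 (r z0))" using rP by force
  then obtain T where T: "T \<subseteq> K" "finite T" "K \<subseteq> (\<Union>z0\<in>T. ball z0 (r z0))"
    using compactE_image[OF K(1), of K "\<lambda>z0. ball z0 (r z0)"] by auto
  define Q where "Q = (\<Prod>z0\<in>T. P z0)"
  have "Q \<noteq> 0" unfolding Q_def using T rP by (auto simp: prod_zero_iff)
  moreover have "norm (poly Q z) \<le> norm (W z)" if z: "z \<in> K" for z
  proof -
    obtain t where t: "t \<in> T" "z \<in> ball t (r t)" using T(3) z by blast
    have "norm (poly Q z) = norm (poly (P t) z) * (\<Prod>z0\<in>T - {t}. norm (poly (P z0) z))"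
      unfolding Q_def poly_prod prod_norm [symmetric] using T(2) t(1) by (rule prod.remove)
    also have "\<dots> \<le> norm (poly (P t) z) * 1"
      using T(1) rP z by (intro mult_left_mono prod_le_1) auto
    also have "\<dots> \<le> norm (W z)" using rP t T(1) by auto
    finally show ?thesis .
  qed
  ultimately show ?thesis by blast
qed

lemma poly_growth:
  fixes P :: "complex poly"
  shows "\<exists>C\<ge>0. \<forall>z. norm (poly P z) \<le> C * (1 + norm z) ^ degree P"
proof -
  define C where "C = (\<Sum>i\<le>degree P. norm (coeff P i))"
  have "norm (poly P z) \<le> C * (1 + norm z) ^ degree P" for z
  proof -
    have "norm (poly P z) \<le> (\<Sum>i\<le>degree P. norm (coeff P i * z ^ i))"
      unfolding poly_altdef by (rule norm_sum)
    also have "\<dots> \<le> (\<Sum>i\<le>degree P. norm (coeff P i) * (1 + norm z) ^ degree P)"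
    proof (rule sum_mono)
      fix i assume "i \<in> {..degree P}"
      have "norm z ^ i \<le> (1 + norm z) ^ i" by (rule power_mono) auto
      also have "\<dots> \<le> (1 + norm z) ^ degree P" using \<open>i \<in> {..degree P}\<close> by (intro power_increasing) auto
      finally show "norm (coeff P i * z ^ i) \<le> norm (coeff P i) * (1 + norm z) ^ degree P"
        by (simp add: norm_mult norm_power mult_left_mono)
    qed
    finally show ?thesis by (simp add: C_def sum_distrib_right)
  qed
  moreover have "C \<ge> 0" unfolding C_def by (intro sum_nonneg) auto
  ultimately show ?thesis by blast
qed

section \<open>The reciprocal Gamma function in the right half-plane\<close>

text \<open>The products increase towards \<open>sinh (pi * y) / (pi * y)\<close>, by the sine
  product at an imaginary point. Enlarging \<open>\<bar>y\<bar>\<close> to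
  \<open>Y = max 1 \<bar>y\<bar>\<close> makes the prefactor \<open>pi * Y\<close> at least
  \<open>1\<close>, so the bound for \<open>p n\<close> bounds the bare product.\<close>

lemma prod_one_plus_le:
  fixes y :: real
  shows "(\<Prod>k=1..n. 1 + y\<^sup>2 / (real k)\<^sup>2) \<le> exp (pi * (1 + \<bar>y\<bar>))"
proof -
  define Y where "Y = max 1 \<bar>y\<bar>"
  have Y: "Y \<ge> 1" "y\<^sup>2 \<le> Y\<^sup>2" "Y \<le> 1 + \<bar>y\<bar>" by (auto simp: Y_def abs_le_square_iff[symmetric])
  define p where "p = (\<lambda>n. pi * Y * (\<Prod>k=1..n. 1 + Y\<^sup>2 / (real k)\<^sup>2))"
  have p0: "p n \<ge> 0" for n unfolding p_def using Y by (intro mult_nonneg_nonneg prod_nonneg) auto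
  have inc: "incseq p"
  proof (rule incseq_SucI)
    fix n
    have "p n * 1 \<le> p n * (1 + Y\<^sup>2 / (real (Suc n))\<^sup>2)" using p0 by (intro mult_left_mono) auto
    thus "p n \<le> p (Suc n)" by (simp add: p_def mult_ac)
  qed
  have "(\<lambda>n. norm (of_real pi * (\<i> * of_real Y) * (\<Prod>k=1..n. 1 - (\<i> * of_real Y)\<^sup>2 / of_nat k ^ 2))) \<longlonglongrightarrow>
     norm (sin (of_real pi * (\<i> * of_real Y)))"
    by (intro tendsto_norm sin_product_formula_complex)
  moreover have "norm (of_real pi * (\<i> * of_real Y) * (\<Prod>k=1..n. 1 - (\<i> * of_real Y)\<^sup>2 / of_nat k ^ 2)) = p n" for n
  proof -
    have *: "(1 - (\<i> * of_real Y)\<^sup>2 / of_nat k ^ 2 :: complex) = of_real (1 + Y\<^sup>2 / (real k)\<^sup>2)" for k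
      by (simp add: power_mult_distrib)
    have eq: "of_real pi * (\<i> * of_real Y) * (\<Prod>k=1..n. 1 - (\<i> * of_real Y)\<^sup>2 / of_nat k ^ 2) = \<i> * of_real (p n)"
      by (simp only: * p_def of_real_mult of_real_prod mult_ac)
    show ?thesis unfolding eq using p0 by (simp add: norm_mult)
  qed
  ultimately have lim: "p \<longlonglongrightarrow> norm (sin (of_real pi * (\<i> * of_real Y)))" by simp
  have "norm (sin (of_real pi * (\<i> * of_real Y))) \<le> exp (pi * Y)"
  proof -
    define t where "t = pi * Y"
    have t: "t \<ge> 0" using Y by (simp add: t_def)
    have "sin (of_real pi * (\<i> * of_real Y)) = (of_real (exp (-t)) - of_real (exp t)) / (2 * \<i>)"
    proof -
      have "\<i> * (of_real pi * (\<i> * of_real Y)) = - complex_of_real t" by (simp add: t_def complex_eq_iff)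
      thus ?thesis unfolding sin_exp_eq by (simp add: exp_of_real[symmetric])
    qed
    hence "norm (sin (of_real pi * (\<i> * of_real Y))) = norm (of_real (exp (-t)) - of_real (exp t) :: complex) / 2"
      by (simp add: norm_divide norm_mult)
    also have "\<dots> \<le> (norm (of_real (exp (-t)) :: complex) + norm (of_real (exp t) :: complex)) / 2"
      by (intro divide_right_mono norm_triangle_ineq4) auto
    also have "\<dots> = (exp (-t) + exp t) / 2" by simp
    also have "\<dots> \<le> exp t" using t by simp
    finally show ?thesis by (simp add: t_def)
  qed
  hence pn: "p n \<le> exp (pi * Y)" using incseq_le[OF inc lim, of n] by linarith
  have "(\<Prod>k=1..n. 1 + y\<^sup>2 / (real k)\<^sup>2) \<le> (\<Prod>k=1..n. 1 + Y\<^sup>2 / (real k)\<^sup>2)"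
    using Y by (intro prod_mono) (auto intro!: divide_right_mono)
  also have "\<dots> \<le> p n"
  proof -
    have "1 \<le> pi * Y" using Y pi_gt3 mult_mono[of 1 pi 1 Y] by simp
    moreover have "(\<Prod>k=1..n. 1 + Y\<^sup>2 / (real k)\<^sup>2) \<ge> 0" by (intro prod_nonneg) auto
    ultimately show ?thesis unfolding p_def using mult_right_mono by fastforce
  qed
  also have "\<dots> \<le> exp (pi * Y)" by (rule pn)
  also have "\<dots> \<le> exp (pi * (1 + \<bar>y\<bar>))" using Y by simp
  finally show ?thesis .
qed

text \<open>Gauss's product is compared with the one at \<open>Re z\<close>: as
  \<open>Re z \<ge> 1\<close>, \<open>norm (z + k) ^ 2\<close> exceeds \<open>(Re z + k) ^ 2\<close>
  at most by the factor \<open>1 + (Im z) ^ 2 / (k + 1) ^ 2\<close>. Rounding \<open>pi\<close> up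
  to \<open>4\<close> and taking a square root gives the constant \<open>2\<close>.\<close>

lemma norm_rGamma_le:
  fixes z :: complex
  assumes x: "Re z \<ge> 1"
  shows "norm (rGamma z) \<le> rGamma (Re z) * exp (2 * (1 + \<bar>Im z\<bar>))"
proof -
  define x where "x = Re z"
  define y where "y = Im z"
  have x1: "x \<ge> 1" using x by (simp add: x_def)
  have bound: "norm (rGamma_series z n) \<le> rGamma_series x n * exp (2 * (1 + \<bar>y\<bar>))" if n: "n > 0" for n
  proof -
    have fac: "norm (z + of_nat k) ^ 2 \<le> (x + real k)\<^sup>2 * (1 + y\<^sup>2 / (real (Suc k))\<^sup>2)" for k
    proof -
      have "norm (z + of_nat k) ^ 2 = (x + real k)\<^sup>2 + y\<^sup>2" by (simp add: cmod_power2 x_def y_def)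
      moreover have "y\<^sup>2 \<le> (x + real k)\<^sup>2 * (y\<^sup>2 / (real (Suc k))\<^sup>2)"
      proof -
        have "(real (Suc k))\<^sup>2 \<le> (x + real k)\<^sup>2" using x1 by (intro power_mono) auto
        hence "(real (Suc k))\<^sup>2 * (y\<^sup>2 / (real (Suc k))\<^sup>2) \<le> (x + real k)\<^sup>2 * (y\<^sup>2 / (real (Suc k))\<^sup>2)"
          by (intro mult_right_mono) auto
        thus ?thesis by (simp del: of_nat_Suc)
      qed
      ultimately show ?thesis by (simp add: distrib_left)
    qed
    have "norm (pochhammer z (Suc n)) ^ 2 = (\<Prod>k<Suc n. norm (z + of_nat k) ^ 2)"
      by (simp add: pochhammer_prod prod_norm[symmetric] prod_power_distrib atLeast0LessThan del: prod.lessThan_Suc prod.op_ivl_Suc)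
    also have "\<dots> \<le> (\<Prod>k<Suc n. (x + real k)\<^sup>2 * (1 + y\<^sup>2 / (real (Suc k))\<^sup>2))"
      by (intro prod_mono conjI fac) auto
    also have "\<dots> = (\<Prod>k<Suc n. x + real k)\<^sup>2 * (\<Prod>k<Suc n. 1 + y\<^sup>2 / (real (Suc k))\<^sup>2)"
      by (simp only: prod.distrib prod_power_distrib)
    also have "(\<Prod>k<Suc n. x + real k) = pochhammer x (Suc n)"
      by (simp add: pochhammer_prod atLeast0LessThan del: prod.lessThan_Suc prod.op_ivl_Suc)
    also have "(\<Prod>k<Suc n. 1 + y\<^sup>2 / (real (Suc k))\<^sup>2) = (\<Prod>k=1..Suc n. 1 + y\<^sup>2 / (real k)\<^sup>2)"
      by (rule prod.reindex_bij_witness[of _ "\<lambda>k. k - 1" Suc]) auto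
    also have "(pochhammer x (Suc n))\<^sup>2 * \<dots> \<le> (pochhammer x (Suc n))\<^sup>2 * exp (pi * (1 + \<bar>y\<bar>))"
      by (intro mult_left_mono prod_one_plus_le) auto
    also have "\<dots> \<le> (pochhammer x (Suc n))\<^sup>2 * exp (4 * (1 + \<bar>y\<bar>))"
      using mult_right_mono[of pi 4 "1 + \<bar>y\<bar>"] pi_less_4 by (intro mult_left_mono) auto
    also have "exp (4 * (1 + \<bar>y\<bar>)) = (exp (2 * (1 + \<bar>y\<bar>)))\<^sup>2"
      by (simp add: power2_eq_square flip: exp_add)
    finally have "norm (pochhammer z (Suc n)) ^ 2 \<le> (pochhammer x (Suc n) * exp (2 * (1 + \<bar>y\<bar>)))\<^sup>2"
      by (simp add: power_mult_distrib)
    hence "norm (pochhammer z (Suc n)) \<le> pochhammer x (Suc n) * exp (2 * (1 + \<bar>y\<bar>))"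
      by (rule power2_le_imp_le) (use x1 in \<open>auto intro!: mult_nonneg_nonneg pochhammer_nonneg\<close>)
    hence "norm (pochhammer z (Suc n)) / (fact n * exp (x * ln (real n))) \<le>
       pochhammer x (Suc n) * exp (2 * (1 + \<bar>y\<bar>)) / (fact n * exp (x * ln (real n)))"
      by (intro divide_right_mono) auto
    thus ?thesis using n
      by (simp add: rGamma_series_def norm_divide norm_mult x_def)
  qed
  have "eventually (\<lambda>n. norm (rGamma_series z n) \<le> rGamma_series x n * exp (2 * (1 + \<bar>y\<bar>))) sequentially"
    by (rule eventually_mono[OF eventually_gt_at_top[of 0]]) (rule bound)
  thus ?thesis unfolding x_def[symmetric] y_def[symmetric]
    by (intro tendsto_le[OF _ tendsto_mult[OF rGamma_series_LIMSEQ tendsto_const] tendsto_norm[OF rGamma_series_LIMSEQ]]) auto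
qed

text \<open>Euler's integral restricted to \<open>[A, A + 1]\<close> gives
  \<open>Gamma x \<ge> A powr (x - 1) * exp (- (A + 1))\<close>, and \<open>A = exp M\<close> makes
  the rate equal to \<open>M\<close>.\<close>

lemma rGamma_superexponential:
  fixes M :: real
  shows "\<exists>C>0. \<forall>x\<ge>1. rGamma x \<le> C * exp (- M * x)"
proof -
  define A where "A = exp M"
  have A: "A > 0" by (simp add: A_def)
  have G: "Gamma x \<ge> A powr (x - 1) * exp (- (A + 1))" if x: "x \<ge> 1" for x
  proof -
    have "((\<lambda>t. A powr (x - 1) * exp (- (A + 1))) has_integral (A powr (x - 1) * exp (- (A + 1)))) {A..A + 1}"
      using has_integral_const_real[of "A powr (x - 1) * exp (- (A + 1))" A "A + 1"] by simp
    hence "((\<lambda>t. if t \<in> {A..A + 1} then A powr (x - 1) * exp (- (A + 1)) else 0) has_integral (A powr (x - 1) * exp (- (A + 1)))) {0..}"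
      using A by (subst has_integral_restrict) auto
    moreover have "((\<lambda>t. t powr (x - 1) / exp t) has_integral Gamma x) {0..}"
      by (rule Gamma_integral_real) (use x in auto)
    ultimately show ?thesis
    proof (rule has_integral_le)
      fix t :: real assume "t \<in> {0..}"
      have "A powr (x - 1) * exp (- (A + 1)) \<le> t powr (x - 1) * exp (- t)" if "t \<in> {A..A + 1}"
        using that A x by (intro mult_mono powr_mono2) auto
      thus "(if t \<in> {A..A + 1} then A powr (x - 1) * exp (- (A + 1)) else 0) \<le> t powr (x - 1) / exp t"
        by (auto simp: exp_minus divide_inverse)
    qed
  qed
  have "rGamma x \<le> (A * exp (A + 1)) * exp (- M * x)" if x: "x \<ge> 1" for x
  proof -
    have pos: "A powr (x - 1) * exp (- (A + 1)) > 0" using A by simp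
    have "rGamma x = inverse (Gamma x)" by (simp add: Gamma_def)
    also have "\<dots> \<le> inverse (A powr (x - 1) * exp (- (A + 1)))"
      using G[OF x] pos by (rule le_imp_inverse_le)
    also have "A powr (x - 1) = exp (M * (x - 1))" using A by (simp add: powr_def A_def)
    also have "inverse (exp (M * (x - 1)) * exp (- (A + 1))) = exp (A + 1) * exp (M - M * x)"
      by (simp add: exp_minus[symmetric] algebra_simps flip: exp_add)
    also have "\<dots> = (A * exp (A + 1)) * exp (- M * x)" by (simp add: A_def flip: exp_add)
    finally show ?thesis .
  qed
  thus ?thesis using A by (intro exI[of _ "A * exp (A + 1)"]) auto
qed

text \<open>
  The product \<open>Q (w0 + v) * Q (w0 + \<i> * v)\<close> is small on large circles, because for each \<open>v\<close>
  one of the two arguments lies in the sectors where \<open>Q\<close> decays super-exponentially.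
\<close>

lemma entire_eq_zero_if_sectorial_decay:
  fixes Q :: "complex \<Rightarrow> complex"
  assumes hol: "Q holomorphic_on UNIV"
    and growth: "\<And>w. norm (Q w) \<le> C * exp (k * norm w)" and k: "k \<ge> 0"
    and decay: "\<And>M. \<exists>C. \<forall>w. \<bar>Im w\<bar> \<le> 2 * \<bar>Re w\<bar> \<longrightarrow> norm (Q w) \<le> C * exp (- M * norm w)"
  shows "Q w0 = 0"
proof (rule ccontr)
  assume nz: "Q w0 \<noteq> 0"
  \<comment> \<open>One factor of \<open>P\<close> decays at rate \<open>M\<close> while the other
    grows at rate at most \<open>k\<close>; a surplus of \<open>1\<close> leaves
    \<open>exp (- R)\<close>.\<close>
  define M where "M = k + 1"
  obtain D where D: "\<And>w. \<bar>Im w\<bar> \<le> 2 * \<bar>Re w\<bar> \<Longrightarrow> norm (Q w) \<le> D * exp (- M * norm w)"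
    using decay[of M] by blast
  define P where "P = (\<lambda>v. Q (w0 + v) * Q (w0 + \<i> * v))"
  have Phol: "P holomorphic_on A" for A
    unfolding P_def
    by (intro holomorphic_intros holomorphic_on_compose_gen[OF _ hol, unfolded o_def]) auto
  define a where "a = norm w0"
  have C0: "C \<ge> 0" using order_trans[OF norm_ge_zero growth[of 0]] by simp
  have D0: "D \<ge> 0" using order_trans[OF norm_ge_zero D[of 0]] by simp
  have key: "norm (Q (w0 + u) * Q (w0 + u')) \<le> D * C * exp ((M + k) * a) * exp (- R)"
    if u: "norm u = R" "norm u' = R" "\<bar>Im u\<bar> \<le> \<bar>Re u\<bar>" "R \<ge> 8 * a + 1" for u u' R
  proof -
    have "R \<le> \<bar>Re u\<bar> + \<bar>Im u\<bar>" using cmod_le[of u] u(1) by simp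
    hence Re: "\<bar>Re u\<bar> \<ge> R / 2" using u(3) by linarith
    have ab: "\<bar>Re w0\<bar> \<le> a" "\<bar>Im w0\<bar> \<le> a" unfolding a_def by (rule abs_Re_le_cmod abs_Im_le_cmod)+
    have a0: "a \<ge> 0" by (simp add: a_def)
    \<comment> \<open>The shift by \<open>w0\<close> carries
      \<open>\<bar>Im u\<bar> \<le> \<bar>Re u\<bar>\<close> into the wider sector as soon as
      \<open>\<bar>Re u\<bar> \<ge> 3 * a\<close>, which \<open>R \<ge> 8 * a + 1\<close>
      guarantees.\<close>
    have "\<bar>Im (w0 + u)\<bar> \<le> 2 * \<bar>Re (w0 + u)\<bar>"
    proof -
      have "\<bar>Im (w0 + u)\<bar> \<le> a + \<bar>Re u\<bar>" using ab u(3) by simp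
      moreover have "\<bar>Re (w0 + u)\<bar> \<ge> \<bar>Re u\<bar> - a" using ab by simp
      ultimately show ?thesis using Re u(4) a0 by linarith
    qed
    hence "norm (Q (w0 + u)) \<le> D * exp (- M * norm (w0 + u))" by (rule D)
    also have "\<dots> \<le> D * exp (- M * (R - a))"
    proof -
      have "norm (w0 + u) \<ge> R - a" using norm_diff_ineq[of u w0] u(1) by (simp add: a_def add.commute)
      hence "- M * norm (w0 + u) \<le> - M * (R - a)" using k by (simp add: M_def)
      thus ?thesis using D0 by (intro mult_left_mono) auto
    qed
    finally have 1: "norm (Q (w0 + u)) \<le> D * exp (- M * (R - a))" .
    have "norm (Q (w0 + u')) \<le> C * exp (k * norm (w0 + u'))" by (rule growth)
    also have "\<dots> \<le> C * exp (k * (R + a))"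
      using norm_triangle_ineq[of w0 u'] u(2) k C0 by (intro mult_left_mono) (auto simp: a_def intro!: mult_left_mono)
    finally have 2: "norm (Q (w0 + u')) \<le> C * exp (k * (R + a))" .
    have "norm (Q (w0 + u) * Q (w0 + u')) \<le> (D * exp (- M * (R - a))) * (C * exp (k * (R + a)))"
      unfolding norm_mult using 1 2 D0 by (intro mult_mono) auto
    also have "\<dots> = D * C * (exp (- M * (R - a)) * exp (k * (R + a)))" by (simp only: mult_ac)
    also have "exp (- M * (R - a)) * exp (k * (R + a)) = exp ((M + k) * a) * exp (- R)"
      by (simp add: M_def algebra_simps flip: exp_add)
    finally show ?thesis by (simp only: mult.assoc)
  qed
  define B where "B = D * C * exp ((M + k) * a)"
  have le: "norm (Q w0) ^ 2 \<le> B * exp (- R)" if R: "R \<ge> 8 * a + 1" for R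
  proof -
    have R0: "R > 0" using R norm_ge_zero[of w0] unfolding a_def by linarith
    have "norm (P 0) \<le> B * exp (- R)"
    proof (rule maximum_modulus_frontier[of P "cball 0 R" _ 0])
      show "P holomorphic_on interior (cball 0 R)" by (rule Phol)
      show "continuous_on (closure (cball 0 R)) P" by (rule holomorphic_on_imp_continuous_on[OF Phol])
      fix v :: complex assume "v \<in> frontier (cball 0 R)"
      hence v: "norm v = R" using R0 by (simp add: frontier_cball)
      have iv: "norm (\<i> * v) = R" using v by (simp add: norm_mult)
      show "norm (P v) \<le> B * exp (- R)"
      proof (cases "\<bar>Im v\<bar> \<le> \<bar>Re v\<bar>")
        case True
        thus ?thesis using key[OF v iv True R] by (simp add: P_def B_def)
      next
        case False
        hence "\<bar>Im (\<i> * v)\<bar> \<le> \<bar>Re (\<i> * v)\<bar>" by simp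
        thus ?thesis using key[OF iv v _ R] by (simp add: P_def B_def mult.commute)
      qed
    qed (use R0 in auto)
    thus ?thesis by (simp add: P_def norm_mult power2_eq_square)
  qed
  have "((\<lambda>R. B * exp (- R)) \<longlongrightarrow> B * 0) (at_top :: real filter)"
    by (intro tendsto_mult tendsto_const) real_asymp
  hence "norm (Q w0) ^ 2 \<le> B * 0"
  proof (rule tendsto_lowerbound)
    show "eventually (\<lambda>R. norm (Q w0) ^ 2 \<le> B * exp (- R)) at_top"
      by (rule eventually_mono[OF eventually_ge_at_top[of "8 * a + 1"]]) (rule le)
  qed simp
  thus False using nz by simp
qed

text \<open>
  On the circle \<open>\<bar>v - c\<bar> = 2\<close> around a point \<open>c\<close> of the imaginary axis, \<open>(v - c)\<^sup>2 + 4\<close> has modulus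
  \<open>4 \<bar>Re v\<bar>\<close>. Its square therefore compensates the singularity of the bound on the axis.
\<close>

lemma strip_bound:
  fixes Q :: "complex \<Rightarrow> complex"
  assumes hol: "Q holomorphic_on UNIV" and k: "k \<ge> 0"
    and bd: "\<And>w. Re w \<noteq> 0 \<Longrightarrow> norm w > 3 / 2 \<Longrightarrow> norm (Q w) \<le> C * exp (k * \<bar>Im w\<bar>) * (1 + 1 / \<bar>Re w\<bar>)\<^sup>2"
  shows "\<exists>D. \<forall>w. norm (Q w) \<le> D * exp (k * \<bar>Im w\<bar>)"
proof -
  \<comment> \<open>Beyond radius \<open>6\<close>, a point with \<open>\<bar>Re w\<bar> < 1\<close>
    has \<open>\<bar>Im w\<bar> > 5\<close>, so the circle of radius \<open>2\<close> used below
    avoids the disc of radius \<open>3 / 2\<close>, where \<open>bd\<close> gives no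
    information.\<close>
  have "compact (Q ` cball 0 6)"
    by (intro compact_continuous_image holomorphic_on_imp_continuous_on holomorphic_on_subset[OF hol]) auto
  then obtain B where B: "B > 0" "\<And>w. norm w \<le> 6 \<Longrightarrow> norm (Q w) \<le> B"
    using compact_imp_bounded bounded_pos by (metis (no_types, lifting) image_eqI mem_cball_0)
  have C0: "C \<ge> 0"
  proof -
    have "0 \<le> C * exp (k * \<bar>Im 2\<bar>) * (1 + 1 / \<bar>Re 2\<bar>)\<^sup>2"
      by (rule order_trans[OF norm_ge_zero bd]) auto
    thus ?thesis by (simp add: zero_le_mult_iff)
  qed
  \<comment> \<open>\<open>9 = 144 / 16\<close>: on the circle \<open>(4 * \<bar>p\<bar>)\<^sup>2 *
    (1 + 1 / \<bar>p\<bar>)\<^sup>2 \<le> 16 * 9\<close>, and at \<open>w\<close> itself the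
    compensating factor is at least \<open>16\<close>. The factor \<open>exp (2 * k)\<close> pays
    for the radius of the circle.\<close>
  define D where "D = max B (9 * C * exp (2 * k))"
  have B_le: "norm (Q w) \<le> D * exp (k * \<bar>Im w\<bar>)" if "norm w \<le> 6" for w
  proof -
    have "norm (Q w) \<le> D * 1" using B(2)[OF that] by (simp add: D_def)
    also have "\<dots> \<le> D * exp (k * \<bar>Im w\<bar>)" using k B(1) by (intro mult_left_mono) (auto simp: D_def)
    finally show ?thesis .
  qed
  have "norm (Q w) \<le> D * exp (k * \<bar>Im w\<bar>)" for w
  proof (cases "norm w \<le> 6")
    case False
    show ?thesis
    proof (cases "\<bar>Re w\<bar> \<ge> 1")
      case True
      have "(1 + 1 / \<bar>Re w\<bar>)\<^sup>2 \<le> 2\<^sup>2" using True by (intro power_mono) (auto simp: field_simps)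
      have "norm (Q w) \<le> C * exp (k * \<bar>Im w\<bar>) * (1 + 1 / \<bar>Re w\<bar>)\<^sup>2" using bd[of w] True False by auto
      also have "\<dots> \<le> C * exp (k * \<bar>Im w\<bar>) * 2\<^sup>2"
        using C0 \<open>(1 + 1 / \<bar>Re w\<bar>)\<^sup>2 \<le> 2\<^sup>2\<close> by (intro mult_left_mono) auto
      also have "\<dots> = (4 * C * 1) * exp (k * \<bar>Im w\<bar>)" by simp
      also have "\<dots> \<le> (9 * C * exp (2 * k)) * exp (k * \<bar>Im w\<bar>)"
        using C0 k by (intro mult_right_mono mult_mono) auto
      also have "\<dots> \<le> D * exp (k * \<bar>Im w\<bar>)" by (intro mult_right_mono) (auto simp: D_def)
      finally show ?thesis .
    next
      case x: False
      define c where "c = \<i> * of_real (Im w)"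
      have wc: "w - c = of_real (Re w)" by (simp add: c_def complex_eq_iff)
      define H where "H = (\<lambda>v. Q v * ((v - c)\<^sup>2 + 4)\<^sup>2)"
      define Bd where "Bd = 144 * C * exp (k * (\<bar>Im w\<bar> + 2))"
      have "norm w \<le> \<bar>Re w\<bar> + \<bar>Im w\<bar>" by (rule cmod_le)
      hence Im5: "\<bar>Im w\<bar> > 5" using x False by linarith
      have "norm (H w) \<le> Bd"
      proof (rule maximum_modulus_frontier[of H "cball c 2" _ w])
        show "H holomorphic_on interior (cball c 2)"
          unfolding H_def by (intro holomorphic_intros holomorphic_on_subset[OF hol]) auto
        show "continuous_on (closure (cball c 2)) H"
          unfolding H_def by (intro continuous_intros holomorphic_on_imp_continuous_on holomorphic_on_subset[OF hol]) auto
        show "w \<in> cball c 2" using x wc by (simp add: dist_norm norm_minus_commute[of c])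
        fix v assume "v \<in> frontier (cball c 2)"
        hence v: "norm (v - c) = 2" by (simp add: frontier_cball dist_norm norm_minus_commute)
        define p q where "p = Re (v - c)" and "q = Im (v - c)"
        have pq: "p\<^sup>2 + q\<^sup>2 = 4" using v cmod_power2[of "v - c"] by (simp add: p_def q_def)
        have Rev: "Re v = p" by (simp add: p_def c_def)
        have Imv: "\<bar>Im v\<bar> \<le> \<bar>Im w\<bar> + 2"
          using abs_Im_le_cmod[of "v - c"] v by (simp add: c_def)
        have p2: "\<bar>p\<bar> \<le> 2" using abs_Re_le_cmod[of "v - c"] v by (simp add: p_def)
        have nf: "norm ((v - c)\<^sup>2 + 4) = 4 * \<bar>p\<bar>"
        proof -
          have vc: "v - c = Complex p q" by (simp add: p_def q_def complex_eq_iff)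
          have "(v - c)\<^sup>2 + 4 = Complex (p\<^sup>2 - q\<^sup>2 + (p\<^sup>2 + q\<^sup>2)) (2 * p * q)"
            unfolding pq by (simp add: vc complex_eq_iff power2_eq_square)
          also have "\<dots> = of_real (2 * p) * Complex p q" by (simp add: complex_eq_iff power2_eq_square)
          finally show ?thesis using v unfolding vc by (simp add: norm_mult)
        qed
        show "norm (H v) \<le> Bd"
        proof (cases "p = 0")
          case True
          thus ?thesis using nf C0 by (simp add: H_def Bd_def norm_mult norm_power)
        next
          case p: False
          have "norm v > 3 / 2"
            using norm_triangle_ineq4[of v "v - c"] v Im5 by (simp add: c_def norm_mult)
          hence "norm (Q v) \<le> C * exp (k * \<bar>Im v\<bar>) * (1 + 1 / \<bar>p\<bar>)\<^sup>2" using bd[of v] p Rev by simp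
          also have "\<dots> \<le> C * exp (k * (\<bar>Im w\<bar> + 2)) * (1 + 1 / \<bar>p\<bar>)\<^sup>2"
            using Imv k C0 by (intro mult_right_mono mult_left_mono) (auto intro!: mult_left_mono)
          finally have "norm (H v) \<le> C * exp (k * (\<bar>Im w\<bar> + 2)) * (1 + 1 / \<bar>p\<bar>)\<^sup>2 * (4 * \<bar>p\<bar>)\<^sup>2"
            unfolding H_def norm_mult norm_power nf by (intro mult_right_mono) auto
          also have "\<dots> = 16 * C * exp (k * (\<bar>Im w\<bar> + 2)) * ((1 + 1 / \<bar>p\<bar>) * \<bar>p\<bar>)\<^sup>2"
            by (simp add: power_mult_distrib)
          also have "(1 + 1 / \<bar>p\<bar>) * \<bar>p\<bar> = \<bar>p\<bar> + 1" using p by (simp add: field_simps)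
          also have "16 * C * exp (k * (\<bar>Im w\<bar> + 2)) * (\<bar>p\<bar> + 1)\<^sup>2 \<le> 16 * C * exp (k * (\<bar>Im w\<bar> + 2)) * 3\<^sup>2"
            using p2 C0 by (intro mult_left_mono power_mono) auto
          also have "\<dots> = Bd" by (simp add: Bd_def)
          finally show ?thesis .
        qed
      qed auto
      have "norm (Q w) * 16 \<le> norm (Q w) * norm (((w - c)\<^sup>2 + 4)\<^sup>2)"
      proof (rule mult_left_mono)
        have "norm ((w - c)\<^sup>2 + 4) = (Re w)\<^sup>2 + 4"
        proof -
          have "(w - c)\<^sup>2 + 4 = of_real ((Re w)\<^sup>2 + 4)" unfolding wc by simp
          thus ?thesis by (simp only: norm_of_real) simp
        qed
        hence "norm (((w - c)\<^sup>2 + 4)\<^sup>2) = ((Re w)\<^sup>2 + 4)\<^sup>2" by (simp add: norm_power)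
        moreover have "4\<^sup>2 \<le> ((Re w)\<^sup>2 + 4)\<^sup>2" by (intro power_mono) auto
        ultimately show "16 \<le> norm (((w - c)\<^sup>2 + 4)\<^sup>2)" by simp
      qed auto
      also have "\<dots> = norm (H w)" by (simp add: H_def norm_mult)
      finally have "norm (Q w) \<le> Bd / 16" using \<open>norm (H w) \<le> Bd\<close> by simp
      also have "\<dots> = 9 * C * exp (2 * k) * exp (k * \<bar>Im w\<bar>)"
        by (simp add: Bd_def algebra_simps flip: exp_add)
      also have "\<dots> \<le> D * exp (k * \<bar>Im w\<bar>)" by (intro mult_right_mono) (auto simp: D_def)
      finally show ?thesis .
    qed
  qed (rule B_le)
  thus ?thesis by blast
qed

section \<open>The zeros of the zeta function\<close>

lemma le_at_by_continuity:
  fixes f g :: "complex \<Rightarrow> real"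
  assumes "isCont f z" "isCont g z" "eventually (\<lambda>s. f s \<le> g s) (at z)"
  shows "f z \<le> g z"
  using assms unfolding isCont_def by (intro tendsto_le[of "at z" g "g z" f "f z"]) auto

lemma not_is_pole_if_bounded:
  fixes q :: "complex \<Rightarrow> complex"
  assumes "eventually (\<lambda>s. norm (q s) \<le> B) (at z)"
  shows "\<not> is_pole q z"
proof
  assume "is_pole q z"
  hence "filterlim (\<lambda>s. norm (q s)) at_top (at z)"
    unfolding is_pole_def by (rule filterlim_at_infinity_imp_norm_at_top)
  hence "eventually (\<lambda>s. norm (q s) \<ge> B + 1) (at z)" by (simp add: filterlim_at_top)
  with assms have "eventually (\<lambda>s. False) (at z)" by eventually_elim auto
  thus False by simp
qed

text \<open>A pole of order \<open>n \<ge> 1\<close> is at least as strong as a simple one, since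
  \<open>t ^ n \<le> t\<close> for \<open>0 < t < 1\<close>. Thus simple and multiple zeros of zeta
  are handled alike.\<close>

lemma pole_lower_bound:
  fixes q :: "complex \<Rightarrow> complex"
  assumes "isolated_singularity_at q z" "is_pole q z"
  shows "\<exists>c>0. eventually (\<lambda>s. norm (s - z) * norm (q s) \<ge> c) (at z)"
proof -
  obtain r0 where r0: "r0 > 0" "q analytic_on ball z r0 - {z}"
    using assms(1) by (auto simp: isolated_singularity_at_def)
  have hol: "q holomorphic_on ball z r0 - {z}" using r0(2) by (rule analytic_imp_holomorphic)
  define n where "n = nat (- zorder q z)"
  define g where "g = zor_poly q z"
  from zorder_exist_pole[OF hol open_ball _ assms(2)] r0(1)
  obtain r where r: "zorder q z < 0" "g z \<noteq> 0" "r > 0" "g holomorphic_on cball z r"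
      "\<And>w. w \<in> cball z r - {z} \<Longrightarrow> q w = g w / (w - z) ^ n"
    unfolding n_def g_def by auto
  have n: "n > 0" using r(1) by (simp add: n_def)
  have "isCont g z"
    using r by (intro continuous_on_interior[OF holomorphic_on_imp_continuous_on[OF r(4)]]) auto
  hence "((\<lambda>s. norm (g s)) \<longlongrightarrow> norm (g z)) (at z)" unfolding isCont_def by (rule tendsto_norm)
  hence "eventually (\<lambda>s. norm (g s) > norm (g z) / 2) (at z)"
    by (rule order_tendstoD) (use r in auto)
  moreover have "eventually (\<lambda>s. s \<in> ball z (min r 1) - {z}) (at z)"
    using r by (intro eventually_at_in_open) auto
  ultimately have "eventually (\<lambda>s. norm (s - z) * norm (q s) \<ge> norm (g z) / 2) (at z)"
  proof eventually_elim
    case (elim s)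
    define t where "t = norm (s - z)"
    have t: "0 < t" "t < 1" using elim by (auto simp: t_def dist_norm norm_minus_commute)
    have q: "norm (q s) = norm (g s) / t ^ n"
      using r(5)[of s] elim by (auto simp: t_def norm_divide norm_power dist_norm)
    have "t ^ n \<le> t ^ 1" using t n by (intro power_decreasing) auto
    hence "norm (g s) * t ^ n \<le> norm (g s) * t" by (intro mult_left_mono) auto
    hence "norm (g s) \<le> t * (norm (g s) / t ^ n)" using t by (simp add: field_simps)
    thus ?case using elim unfolding q t_def[symmetric] by linarith
  qed
  thus ?thesis using r(2) by (intro exI[of _ "norm (g z) / 2"]) auto
qed

lemma Xi_nonzero_iff:
  assumes "Re s > -1"
  shows "Xi s = 0 \<longleftrightarrow> zeta_reg s = 0"
  using assms Re_pos_not_nonpos_Ints[of "s / 2 + 1"]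
  by (simp add: Xi_eq xi_half_def Gamma_eq_zero_iff)

lemma Xi_real_nonzero:
  assumes "x > 0"
  shows "Xi (of_real x) \<noteq> 0"
  using assms by (simp add: Xi_nonzero_iff zeta_reg_nonzero)

lemma eventually_Xi_nonzero: "eventually (\<lambda>s. Xi s \<noteq> 0) (at z)"
proof (cases "Xi z = 0")
  case True
  have "Xi 1 \<noteq> 0" using Xi_real_nonzero[of 1] by simp
  from isolated_zeros[OF holomorphic_Xi open_UNIV connected_UNIV UNIV_I True UNIV_I this]
  obtain r where r: "0 < r" "\<And>w. w \<in> ball z r - {z} \<Longrightarrow> Xi w \<noteq> 0" by metis
  have "eventually (\<lambda>s. s \<in> ball z r - {z}) (at z)"
    using r by (intro eventually_at_in_open) auto
  thus ?thesis by eventually_elim (use r in auto)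
next
  case False
  have "isCont Xi z"
    using holomorphic_on_imp_continuous_on[OF holomorphic_Xi[of UNIV]] by (simp add: continuous_on_eq_continuous_at)
  thus ?thesis using False by (simp add: isCont_def tendsto_imp_eventually_ne)
qed

text \<open>The modulus of the argument of \<open>P\<close> is strictly monotone in
  \<open>x\<close>, so each of the finitely many roots is hit at most once.\<close>

lemma finite_real_powr_poly:
  fixes P :: "complex poly"
  assumes "P \<noteq> 0" and c: "c = 1 \<or> c = -1"
  shows "finite {x::real. poly P (2 powr (c * of_real x + d)) = 0}"
proof -
  have "inj (\<lambda>x::real. (2::complex) powr (c * of_real x + d))"
  proof (rule injI)
    fix x y :: real assume "(2::complex) powr (c * of_real x + d) = 2 powr (c * of_real y + d)"
    hence "norm ((2::complex) powr (c * of_real x + d)) = norm ((2::complex) powr (c * of_real y + d))" by simp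
    thus "x = y" using c powr_inj[of 2] by (auto simp: norm_powr_real_powr)
  qed
  hence "finite ((\<lambda>x::real. (2::complex) powr (c * of_real x + d)) -` {z. poly P z = 0})"
    by (intro finite_vimageI poly_roots_finite assms)
  thus ?thesis by (simp add: vimage_def)
qed

section \<open>Cancellation of the zeros and the contradiction\<close>

context fake_mu
begin

text \<open>\<open>W_bound\<close> gives \<open>norm (W z - 1) \<le> 1 / 2\<close> on this circle.
  It is the image of the line \<open>Re s = 1\<close> under \<open>2 powr (-s)\<close>, so
  \<open>U\<close> has no zero on that line.\<close>

lemma W_half_circle:
  assumes "norm z = 1 / 2"
  shows "W z \<noteq> 0"
proof
  assume "W z = 0"
  hence "norm (W z - 1) = 1" by simp
  moreover have "norm (W z - 1) \<le> 2 * norm z ^ 3 / (1 - norm z)" by (rule W_bound) (use assms in auto)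
  ultimately show False using assms by (simp add: power3_eq_cube)
qed

text \<open>The continuations obtained for different \<open>\<kappa>\<close> are never identified
  with each other; they share the property \<open>is_T\<close>. The one for
  \<open>\<kappa> = 1\<close> excludes poles to the right of the critical line and controls the
  growth of \<open>Q\<close>, while small \<open>\<kappa>\<close> serve on the line itself.\<close>

lemma no_one_sided_bound:
  fixes \<delta> :: real
  assumes \<delta>: "\<delta> = 1 \<or> \<delta> = -1"
    and ev: "\<And>\<kappa>. \<kappa> > 0 \<Longrightarrow> eventually (\<lambda>n. \<kappa> * sqrt (real n) + \<delta> * (bias * sqrt (real n) - F n) \<ge> 0) sequentially"
  shows False
proof -
  define H where "H = {s::complex. Re s > 1 / 2}"
  have openH: "open H" unfolding H_def by (rule open_halfspace_Re_gt)
  define zz where "zz = (\<lambda>s. zeta_reg (2 * s) / (2 * s - 1))"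
  define is_T where "is_T = (\<lambda>Tt. Tt holomorphic_on H \<and> (\<forall>s\<in>H. zeta_reg s * Tt s = (s - 1) * U s * zz s))"
  obtain c0 where c0: "c0 > 0" "\<And>s. Re s \<ge> 1 / 2 \<Longrightarrow> c0 * norm (W (2 powr (-s))) \<le> norm (U s)"
    using U_lower by blast
  \<comment> \<open>The disc of radius \<open>2 powr (-1/2)\<close> contains
    \<open>2 powr (-s)\<close> for all \<open>Re s \<ge> 1 / 2\<close> and is a compact part of the
    unit disc.\<close>
  obtain P :: "complex poly" where P: "P \<noteq> 0" "\<And>z. norm z \<le> 2 powr (-1/2) \<Longrightarrow> norm (poly P z) \<le> norm (W z)"
  proof -
    have "W 0 \<noteq> 0" using W_bound[of 0] by auto
    have q: "2 powr (-1/2) < (1::real)" using powr_less_mono[of "-1/2" 0 "2::real"] by simp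
    have "\<exists>P. P \<noteq> 0 \<and> (\<forall>z\<in>cball 0 (2 powr (-1/2)). norm (poly P z) \<le> norm (W z))"
      by (rule poly_minorant[OF holomorphic_W]) (use \<open>W 0 \<noteq> 0\<close> q in \<open>auto intro!: bexI[of _ 0]\<close>)
    thus ?thesis using that by auto
  qed
  have P_le: "c0 * norm (poly P (2 powr (-s))) \<le> norm (U s)" if "Re s \<ge> 1 / 2" for s
  proof -
    have "norm ((2::complex) powr (-s)) \<le> 2 powr (-1/2)"
      using that by (simp add: norm_powr_real_powr)
    hence "norm (poly P (2 powr (-s))) \<le> norm (W (2 powr (-s)))" by (rule P(2))
    hence "c0 * norm (poly P (2 powr (-s))) \<le> c0 * norm (W (2 powr (-s)))" using c0 by (intro mult_left_mono) auto
    thus ?thesis using c0(2)[OF that] by linarith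
  qed
  define E where "E = (\<lambda>s. poly P (2 powr (-s)) * poly P (2 powr (s - 1)))"
  define q where "q = (\<lambda>s. E s / Xi s)"
  have E_sym: "E (1 - s) = E s" for s by (simp add: E_def)
  have q_sym: "q (1 - s) = q s" for s by (simp add: q_def E_sym Xi_functional)
  have powr2: "(\<lambda>s. (2::complex) powr (a * s + b)) holomorphic_on A" for a b A
    by (intro holomorphic_intros) auto
  have poly_hol: "(\<lambda>s. poly P (g s)) holomorphic_on A" if "g holomorphic_on A" for g A
    using that unfolding poly_altdef by (intro holomorphic_intros) 
  have E_hol: "E holomorphic_on A" for A
    unfolding E_def using powr2[of "-1" 0 A] powr2[of 1 "-1" A] by (intro holomorphic_intros poly_hol) auto
  have zz_lower: "norm (zz s) * norm (zz (of_real (Re s))) \<ge> 1" if "s \<in> H" for s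
    using norm_zeta_reg_lower[of "2 * s"] that by (simp add: zz_def H_def)
  have zz_nz: "zz s \<noteq> 0" if "s \<in> H" for s using zz_lower[OF that] by auto
  \<comment> \<open>After \<open>P_le\<close> and the identity for \<open>T\<close>, the factor
    \<open>norm (zeta_reg s)\<close> cancels from the estimate of \<open>q\<close>; \<open>G\<close>
    collects what remains and stays finite at the zeros of \<open>Xi\<close> in question.\<close>
  define G where "G = (\<lambda>s. norm (poly P (2 powr (s - 1))) * norm (of_real pi powr (s / 2) :: complex) * norm (rGamma (s / 2 + 1))
      / (c0 * norm (s - 1) * norm (zz s)))"
  have q_le: "norm (q s) \<le> G s * norm (Tt s)" if T: "is_T Tt" and s: "s \<in> H" "s \<noteq> 1" "Xi s \<noteq> 0" for Tt s
  proof -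
    have Re: "Re s > 1 / 2" using s by (simp add: H_def)
    have Z: "zeta_reg s \<noteq> 0" using s Re by (simp add: Xi_nonzero_iff)
    have Gnz: "Gamma (s / 2 + 1) \<noteq> 0" using Re Re_pos_not_nonpos_Ints[of "s / 2 + 1"] by (simp add: Gamma_eq_zero_iff)
    have inv: "1 / Xi s = of_real pi powr (s / 2) * rGamma (s / 2 + 1) / zeta_reg s"
      using Re Gnz by (simp add: Xi_eq xi_half_def Gamma_def powr_minus field_simps)
    have "q s = E s * (1 / Xi s)" by (simp add: q_def)
    hence q: "norm (q s) = norm (poly P (2 powr (-s))) * (norm (poly P (2 powr (s - 1))) * norm (of_real pi powr (s / 2) :: complex) * norm (rGamma (s / 2 + 1)) / norm (zeta_reg s))"
      unfolding inv E_def by (simp add: norm_mult norm_divide)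
    have "zeta_reg s * Tt s = (s - 1) * U s * zz s" using T s by (simp add: is_T_def)
    hence "norm (zeta_reg s) * norm (Tt s) = norm (s - 1) * norm (U s) * norm (zz s)"
      by (metis norm_mult)
    hence Us: "norm (U s) = norm (zeta_reg s) * norm (Tt s) / (norm (s - 1) * norm (zz s))"
      using s zz_nz[OF s(1)] by simp
    have "norm (poly P (2 powr (-s))) \<le> norm (U s) / c0"
      using P_le[of s] Re c0(1) by (simp add: field_simps)
    also have "\<dots> = norm (zeta_reg s) * norm (Tt s) / (c0 * norm (s - 1) * norm (zz s))"
      unfolding Us by (simp add: mult_ac)
    finally have "norm (poly P (2 powr (-s))) \<le> norm (zeta_reg s) * norm (Tt s) / (c0 * norm (s - 1) * norm (zz s))" .
    hence "norm (q s) \<le> norm (zeta_reg s) * norm (Tt s) / (c0 * norm (s - 1) * norm (zz s)) *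
       (norm (poly P (2 powr (s - 1))) * norm (of_real pi powr (s / 2) :: complex) * norm (rGamma (s / 2 + 1)) / norm (zeta_reg s))"
      unfolding q by (intro mult_right_mono) auto
    also have "\<dots> = G s * norm (Tt s)" using Z by (simp add: G_def mult_ac)
    finally show ?thesis .
  qed
  have exT: "\<exists>Tt. is_T Tt \<and>
     (\<exists>K. \<forall>s. Re s > 1 / 2 \<longrightarrow> norm (Tt s) \<le> K * (1 + norm s)\<^sup>2 * (1 + 1 / (Re s - 1 / 2))) \<and>
     (\<forall>y. y \<noteq> 0 \<longrightarrow> eventually (\<lambda>x. (x - 1 / 2) * norm (Tt (Complex x y)) \<le> (norm (Complex (1 / 2) y) + 1) * \<kappa>) (at_right (1 / 2)))"
    if "\<kappa> > 0" for \<kappa>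
    using one_sided_continuation[OF \<delta> that ev[OF that]] unfolding is_T_def H_def zz_def by simp
  obtain T1 K where T1: "is_T T1" and K: "\<And>s. Re s > 1 / 2 \<Longrightarrow> norm (T1 s) \<le> K * (1 + norm s)\<^sup>2 * (1 + 1 / (Re s - 1 / 2))"
    using exT[of 1] by auto

  have entire_cont: "isCont g z" if "g holomorphic_on UNIV" for g :: "complex \<Rightarrow> complex" and z
    using holomorphic_on_imp_continuous_on[OF that] by (simp add: continuous_on_eq_continuous_at)
  have G_cont: "isCont G z" if z: "z \<noteq> 1" "Re z > 0" "2 * z \<noteq> 1" "zeta_reg (2 * z) \<noteq> 0" for z
  proof -
    have "isCont zeta_reg (2 * z)" by (rule isCont_holomorphic_Re_gt[OF holomorphic_zeta_reg]) (use z in auto)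
    moreover have "isCont (\<lambda>s. 2 * s) z" by (intro continuous_intros)
    ultimately have "isCont (\<lambda>s. zeta_reg (2 * s)) z" by (rule isCont_o2[rotated])
    hence "isCont zz z" unfolding zz_def using z
      by (intro isCont_divide isCont_diff isCont_mult continuous_ident continuous_const) auto
    moreover have "zz z \<noteq> 0" using z by (simp add: zz_def)
    moreover have "isCont (\<lambda>s. poly P (2 powr (s - 1))) z"
      using powr2[of 1 "-1" UNIV] by (intro entire_cont poly_hol) simp
    moreover have "isCont (\<lambda>s. complex_of_real pi powr (s / 2)) z"
      by (intro entire_cont holomorphic_intros) auto
    moreover have "isCont (\<lambda>s::complex. rGamma (s / 2 + 1)) z"
      by (intro entire_cont holomorphic_intros) auto
    ultimately show ?thesis unfolding G_def using z c0(1)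
      by (intro isCont_divide isCont_mult isCont_norm isCont_diff continuous_ident continuous_const) auto
  qed
  have T_cont: "isCont Tt z" if "is_T Tt" "z \<in> H" for Tt z
    using that openH unfolding is_T_def
    by (intro continuous_on_interior[OF holomorphic_on_imp_continuous_on]) (auto simp: interior_open)

  have q_mero: "q meromorphic_on UNIV"
    unfolding q_def by (intro meromorphic_on_divide analytic_on_imp_meromorphic_on)
      (simp_all add: analytic_on_open E_hol holomorphic_Xi)
  have q_iso: "isolated_singularity_at q z" for z
    using q_mero by (intro meromorphic_on_isolated_singularity) (auto intro: meromorphic_on_subset)
  have q_ness: "not_essential q z" for z
    using q_mero by (intro meromorphic_on_not_essential) (auto intro: meromorphic_on_subset)
  have q_cont: "isCont q z" if "Xi z \<noteq> 0" for z
    unfolding q_def using that by (intro continuous_intros entire_cont E_hol holomorphic_Xi)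
  have np_nz: "\<not> is_pole q z" if "Xi z \<noteq> 0" for z
  proof (rule not_is_pole_if_bounded)
    have "((\<lambda>s. norm (q s)) \<longlongrightarrow> norm (q z)) (at z)"
      using q_cont[OF that] unfolding isCont_def by (rule tendsto_norm)
    hence "eventually (\<lambda>s. norm (q s) < norm (q z) + 1) (at z)" by (rule order_tendstoD) auto
    thus "eventually (\<lambda>s. norm (q s) \<le> norm (q z) + 1) (at z)" by eventually_elim auto
  qed
  have np_right: "\<not> is_pole q z" if z: "z \<in> H" for z
  proof (cases "Xi z = 0")
    case True
    have z1: "z \<noteq> 1" using True Xi_real_nonzero[of 1] by auto
    show ?thesis
    proof (rule not_is_pole_if_bounded)
      have "isCont G z"
        using z z1 zz_nz[OF z] by (intro G_cont) (auto simp: H_def zz_def)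
      hence "isCont (\<lambda>s. G s * norm (T1 s)) z"
        by (intro continuous_intros T_cont T1 z)
      hence "((\<lambda>s. G s * norm (T1 s)) \<longlongrightarrow> G z * norm (T1 z)) (at z)" by (simp add: isCont_def)
      hence "eventually (\<lambda>s. G s * norm (T1 s) < G z * norm (T1 z) + 1) (at z)" by (rule order_tendstoD) auto
      moreover have "eventually (\<lambda>s. s \<in> H - {z}) (at z)" using openH z by (intro eventually_at_in_open) auto
      moreover have "eventually (\<lambda>s. s \<in> - {1}) (at z)" using z1 by (intro eventually_at_in_open') auto
      ultimately show "eventually (\<lambda>s. norm (q s) \<le> G z * norm (T1 z) + 1) (at z)"
        using eventually_Xi_nonzero[of z]
      proof eventually_elim
        case (elim s)
        thus ?case using q_le[OF T1, of s] by auto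
      qed
    qed
  qed (rule np_nz)
  have np_line: "\<not> is_pole q z" if z: "Re z = 1 / 2" for z
  proof (cases "Xi z = 0")
    case True
    define y where "y = Im z"
    have zc: "z = Complex (1 / 2) y" using z by (simp add: y_def complex_eq_iff)
    have y: "y \<noteq> 0"
    proof
      assume "y = 0"
      hence "z = of_real (1 / 2)" using zc by (simp add: complex_eq_iff)
      hence "Xi z = Xi (of_real (1 / 2))" by (rule arg_cong)
      thus False using True Xi_real_nonzero[of "1 / 2"] by simp
    qed
    \<comment> \<open>Non-vanishing of zeta on \<open>Re s = 1\<close>, read off from the
      continuation: for \<open>s = 2 * z\<close> the side \<open>(s - 1) * U s * zz s\<close> is
      nonzero by \<open>W_half_circle\<close>, hence so is \<open>zeta_reg s\<close>.\<close>
    have z2: "zeta_reg (2 * z) \<noteq> 0"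
    proof -
      define s where "s = 2 * z"
      have s: "Re s = 1" "s \<noteq> 1" using z y zc by (auto simp: s_def complex_eq_iff)
      have sH: "s \<in> H" using s by (simp add: H_def)
      have "norm ((2::complex) powr (-s)) = 2 powr (-Re s)"
        using norm_powr_of_nat[of 2 "-s"] by simp
      hence "norm ((2::complex) powr (-s)) = 1 / 2" using s by (simp add: powr_minus_divide)
      hence "W (2 powr (-s)) \<noteq> 0" by (rule W_half_circle)
      hence "U s \<noteq> 0" using c0(1) c0(2)[of s] s by (auto simp: mult_le_0_iff)
      moreover have "zeta_reg s * T1 s = (s - 1) * U s * zz s" using T1 sH by (simp add: is_T_def)
      ultimately show ?thesis using zz_nz[OF sH] s by (auto simp: s_def)
    qed
    have Gz: "isCont G z" using z y zc z2 by (intro G_cont) (auto simp: complex_eq_iff)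
    have Clim: "filterlim (\<lambda>x. Complex x y) (at z) (at_right (1 / 2))"
    proof (rule filterlim_atI)
      show "((\<lambda>x. Complex x y) \<longlongrightarrow> z) (at_right (1 / 2))"
        unfolding zc by (intro tendsto_Complex tendsto_const tendsto_ident_at)
      show "eventually (\<lambda>x. Complex x y \<noteq> z) (at_right (1 / 2))"
        unfolding zc by (auto simp: eventually_at_filter)
    qed
    show ?thesis
    proof
      assume "is_pole q z"
      then obtain c where c: "c > 0" "eventually (\<lambda>s. norm (s - z) * norm (q s) \<ge> c) (at z)"
        using pole_lower_bound[OF q_iso] by blast
      define B where "B = G z + 1"
      have G0: "G z \<ge> 0" unfolding G_def using c0(1) by auto
      \<comment> \<open>On the horizontal approach to \<open>z\<close>,
        \<open>norm (s - z) * norm (q s)\<close> is at least \<open>c\<close> by the pole and at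
        most \<open>B * (norm z + 1) * \<kappa>\<close> by the continuation. This
        \<open>\<kappa>\<close> makes the latter \<open>c / 2\<close>.\<close>
      define \<kappa> where "\<kappa> = c / (2 * B * (norm z + 1))"
      have \<kappa>: "\<kappa> > 0" using c G0 by (auto simp: \<kappa>_def B_def intro!: divide_pos_pos mult_pos_pos add_nonneg_pos)
      obtain Tt where Tt: "is_T Tt" "eventually (\<lambda>x. (x - 1 / 2) * norm (Tt (Complex x y)) \<le> (norm z + 1) * \<kappa>) (at_right (1 / 2))"
        using exT[OF \<kappa>] y unfolding zc by blast
      have "(G \<longlongrightarrow> G z) (at z)" using Gz by (simp add: isCont_def)
      hence "eventually (\<lambda>s. G s < B) (at z)" by (rule order_tendstoD) (simp add: B_def)
      hence 1: "eventually (\<lambda>x. G (Complex x y) < B) (at_right (1 / 2))"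
        by (rule eventually_compose_filterlim[OF _ Clim])
      have 2: "eventually (\<lambda>x. norm (Complex x y - z) * norm (q (Complex x y)) \<ge> c) (at_right (1 / 2))"
        by (rule eventually_compose_filterlim[OF c(2) Clim])
      have 3: "eventually (\<lambda>x. Xi (Complex x y) \<noteq> 0) (at_right (1 / 2))"
        by (rule eventually_compose_filterlim[OF eventually_Xi_nonzero Clim])
      have 4: "eventually (\<lambda>x::real. x > 1 / 2) (at_right (1 / 2))" by (simp add: eventually_at_filter)
      have "eventually (\<lambda>x. False) (at_right (1 / 2 :: real))"
        using 1 2 3 4 Tt(2)
      proof eventually_elim
        case (elim x)
        have sH: "Complex x y \<in> H" "Complex x y \<noteq> 1" using elim(4) y by (auto simp: H_def complex_eq_iff)
        have "Complex x y - z = of_real (x - 1 / 2)" by (simp add: zc complex_eq_iff)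
        hence n: "norm (Complex x y - z) = x - 1 / 2" using elim(4) by (simp only: norm_of_real)
        have G0': "G (Complex x y) \<ge> 0" unfolding G_def using c0(1) by auto
        have "c \<le> (x - 1 / 2) * norm (q (Complex x y))" using elim(2) unfolding n .
        also have "\<dots> \<le> (x - 1 / 2) * (G (Complex x y) * norm (Tt (Complex x y)))"
          using q_le[OF Tt(1) sH elim(3)] elim(4) by (intro mult_left_mono) auto
        also have "\<dots> = G (Complex x y) * ((x - 1 / 2) * norm (Tt (Complex x y)))" by (simp only: mult_ac)
        also have "\<dots> \<le> B * ((norm z + 1) * \<kappa>)"
          by (rule mult_mono) (use elim(1,4,5) G0' in auto)
        also have "\<dots> = c / 2"
        proof -
          have "B * (norm z + 1) \<noteq> 0" using G0 norm_ge_zero[of z] unfolding B_def by (auto simp: add_nonneg_eq_0_iff)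
          thus ?thesis by (simp add: \<kappa>_def field_simps)
        qed
        finally show False using c(1) by simp
      qed
      thus False by simp
    qed
  qed (rule np_nz)
  have np: "\<not> is_pole q z" for z
  proof (cases "Re z \<ge> 1 / 2")
    case True
    thus ?thesis using np_right[of z] np_line[of z] by (cases "Re z = 1 / 2") (auto simp: H_def)
  next
    case False
    show ?thesis
    proof
      assume "is_pole q z"
      hence "filterlim q at_infinity (at z)" by (simp add: is_pole_def)
      moreover have "filterlim (\<lambda>s. 1 - s) (at z) (at (1 - z))"
      proof (rule filterlim_atI)
        have "((\<lambda>s. 1 - s) \<longlongrightarrow> 1 - (1 - z)) (at (1 - z))" by (intro tendsto_intros)
        thus "((\<lambda>s. 1 - s) \<longlongrightarrow> z) (at (1 - z))" by simp
        have "1 - s \<noteq> z" if "s \<noteq> 1 - z" for s using that by (auto simp: algebra_simps)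
        thus "eventually (\<lambda>s. 1 - s \<noteq> z) (at (1 - z))" by (auto simp: eventually_at_filter)
      qed
      ultimately have "filterlim (\<lambda>s. q (1 - s)) at_infinity (at (1 - z))" by (rule filterlim_compose)
      hence "is_pole q (1 - z)" by (simp add: is_pole_def q_sym)
      moreover have "1 - z \<in> H" using False by (simp add: H_def)
      ultimately show False using np_right by blast
    qed
  qed
  \<comment> \<open>At a zero of \<open>Xi\<close>, \<open>q\<close> has the default value
    \<open>0\<close> of division. As there are no poles, all these singularities are removable, and
    \<open>Q\<close> takes the limits instead.\<close>
  define Q where "Q = remove_sings q"
  have Q_hol: "Q holomorphic_on UNIV"
  proof -
    have "Q analytic_on {z}" for z
    proof -
      obtain c where "q \<midarrow>z\<rightarrow> c" using q_ness[of z] np[of z] by (auto simp: not_essential_def)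
      thus ?thesis unfolding Q_def using q_iso by (intro remove_sings_analytic_at)
    qed
    hence "Q analytic_on UNIV" using analytic_on_analytic_at by blast
    thus ?thesis by (rule analytic_imp_holomorphic)
  qed
  have Q_eq: "Q z = q z" if "Xi z \<noteq> 0" for z
    unfolding Q_def using q_cont[OF that] by (intro remove_sings_eqI) (simp add: isCont_def)
  have Q_cont: "isCont Q z" for z by (rule entire_cont[OF Q_hol])
  have Q_sym: "Q (1 - z) = Q z" for z
  proof -
    have "isCont (\<lambda>s. Q (1 - s)) z" by (rule isCont_o2[OF _ Q_cont]) (intro continuous_intros)
    hence "norm (Q (1 - z) - Q z) \<le> 0"
      using eventually_Xi_nonzero[of z]
      by (intro le_at_by_continuity[where g = "\<lambda>_. 0" and f = "\<lambda>s. norm (Q (1 - s) - Q s)"] continuous_intros Q_cont)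
         (auto elim!: eventually_mono simp: Q_eq Xi_functional q_sym)
    thus ?thesis by simp
  qed

  obtain CP where CP: "CP \<ge> 0" "\<And>z. norm (poly P z) \<le> CP * (1 + norm z) ^ degree P"
    using poly_growth[of P] by blast
  \<comment> \<open>By \<open>zz_lower\<close>, \<open>1 / norm (zz s)\<close> is bounded by
    \<open>zz\<close> at \<open>Re s\<close>. On the real axis \<open>zz\<close> is the decreasing
    series of \<open>\<zeta>(2x)\<close> with a simple pole at \<open>1 / 2\<close>, so
    \<open>pole_bound\<close> applies.\<close>
  obtain K2 where K2: "K2 \<ge> 0" "\<And>x. x > 1 / 2 \<Longrightarrow> norm (zz (of_real x)) \<le> K2 * (1 + 1 / (x - 1 / 2))"
  proof -
    define h where "h = (\<lambda>x. \<Sum>n. real (Suc n) powr (- (2 * x)))"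
    have sm: "summable (\<lambda>n. real (Suc n) powr (- (2 * x)))" if "x > 1 / 2" for x
      by (rule summable_Suc_powr) (use that in auto)
    have zzh: "zz (of_real x) = of_real (h x)" if x: "x > 1 / 2" for x
    proof -
      have "(\<lambda>n. of_nat (Suc n) powr (- (2 * of_real x))) sums zz (of_real x)"
        unfolding zz_def by (rule zeta_reg_sums) (use x in auto)
      moreover have "of_nat (Suc n) powr (- (2 * of_real x)) = complex_of_real (real (Suc n) powr (- (2 * x)))" for n
        using powr_of_real[of "real (Suc n)" "- (2 * x)"] by simp
      ultimately have "(\<lambda>n. complex_of_real (real (Suc n) powr (- (2 * x)))) sums zz (of_real x)" by (simp only:)
      moreover have "(\<lambda>n. complex_of_real (real (Suc n) powr (- (2 * x)))) sums of_real (h x)"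
        unfolding h_def by (intro sums_of_real summable_sums sm x)
      ultimately show ?thesis by (rule sums_unique2)
    qed
    have h0: "h x \<ge> 0" if "x > 1 / 2" for x unfolding h_def by (intro suminf_nonneg sm that) auto
    have "\<exists>K\<ge>0. \<forall>x>1 / 2. h x \<le> K * (1 + 1 / (x - 1 / 2))"
    proof (rule pole_bound)
      show "h y \<le> h x" if "1 / 2 < x" "x \<le> y" for x y
        unfolding h_def using that by (intro suminf_le sm powr_mono) auto
      have "isCont zeta_reg 1" by (rule isCont_holomorphic_Re_gt[OF holomorphic_zeta_reg]) simp
      moreover have "((\<lambda>x. complex_of_real (2 * x)) \<longlongrightarrow> complex_of_real (2 * (1 / 2))) (at_right (1 / 2))"
        by (intro tendsto_of_real tendsto_mult tendsto_const tendsto_ident_at)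
      ultimately have "((\<lambda>x. zeta_reg (complex_of_real (2 * x))) \<longlongrightarrow> zeta_reg 1) (at_right (1 / 2))"
        by (intro isCont_tendsto_compose[of 1 zeta_reg]) auto
      hence "((\<lambda>x. norm (zeta_reg (complex_of_real (2 * x))) / 2) \<longlongrightarrow> norm (zeta_reg 1) / 2) (at_right (1 / 2))"
        by (intro tendsto_divide tendsto_norm tendsto_const) auto
      moreover have "eventually (\<lambda>x. norm (zeta_reg (complex_of_real (2 * x))) / 2 = (x - 1 / 2) * h x) (at_right (1 / 2))"
      proof -
        have "eventually (\<lambda>x::real. x > 1 / 2) (at_right (1 / 2))" by (simp add: eventually_at_filter)
        thus ?thesis
        proof eventually_elim
          case (elim x)
          have "h x = norm (zz (of_real x))" using zzh[OF elim] h0[OF elim] by simp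
          also have "\<dots> = norm (zeta_reg (complex_of_real (2 * x))) / norm (complex_of_real (2 * x - 1))"
            by (simp add: zz_def norm_divide)
          also have "norm (complex_of_real (2 * x - 1)) = 2 * x - 1" using elim by (simp only: norm_of_real)
          finally show ?case using elim by (simp add: field_simps)
        qed
      qed
      ultimately show "((\<lambda>x. (x - 1 / 2) * h x) \<longlongrightarrow> norm (zeta_reg 1) / 2) (at_right (1 / 2))"
        by (simp add: tendsto_cong)
    qed
    then obtain K where "K \<ge> 0" "\<And>x. x > 1 / 2 \<Longrightarrow> h x \<le> K * (1 + 1 / (x - 1 / 2))" by blast
    thus ?thesis using zzh h0 by (intro that[of K]) auto
  qed
  have K0: "K \<ge> 0"
  proof -
    have "0 \<le> K * (1 + norm (1::complex))\<^sup>2 * (1 + 1 / (Re 1 - 1 / 2))"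
      by (rule order_trans[OF norm_ge_zero K]) auto
    thus ?thesis by (simp add: zero_le_mult_iff)
  qed
  define d where "d = real (degree P)"
  \<comment> \<open>The square collects two singular factors, one from \<open>T1\<close> and one
    from \<open>1 / zz s\<close>. The disc around \<open>1\<close> is left out because
    \<open>G\<close> divides by \<open>norm (s - 1)\<close>.\<close>
  have Q_bound: "\<exists>C. \<forall>s. Re s > 1 / 2 \<longrightarrow> norm (s - 1) > 1 \<longrightarrow>
      norm (Q s) \<le> C * exp (- M * Re s + 3 * \<bar>Im s\<bar>) * (1 + 1 / (Re s - 1 / 2))\<^sup>2" for M
  proof -
    \<comment> \<open>\<open>rGamma\<close> is evaluated at \<open>s / 2 + 1\<close>, which halves
      the rate and explains the factor \<open>2\<close>. The decay must beat \<open>d\<close> from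
      the polynomial, \<open>1\<close> from the power of \<open>pi\<close> and \<open>2\<close> from
      \<open>(1 + norm s) ^ 2\<close>, and still leave \<open>M\<close>.\<close>
    define M' where "M' = 2 * (M + d + 3)"
    obtain Cr where Cr: "Cr > 0" "\<And>x. x \<ge> 1 \<Longrightarrow> rGamma x \<le> Cr * exp (- M' * x)"
      using rGamma_superexponential[of M'] by blast
    define C where "C = CP * exp d * Cr * exp (2 - M') * K2 * K / c0"
    have pre: "norm (q s) \<le> C * exp (- M * Re s + 3 * \<bar>Im s\<bar>) * (1 + 1 / (Re s - 1 / 2))\<^sup>2"
      if s: "Re s > 1 / 2" "norm (s - 1) > 1" "Xi s \<noteq> 0" for s
    proof -
      define \<sigma> t where "\<sigma> = Re s" and "t = Im s"
      define m where "m = 1 + 1 / (\<sigma> - 1 / 2)"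
      have \<sigma>: "\<sigma> > 1 / 2" using s by (simp add: \<sigma>_def)
      have m: "m \<ge> 1" using \<sigma> by (simp add: m_def)
      have sH: "s \<in> H" "s \<noteq> 1" using s by (auto simp: H_def)
      have b1: "norm (poly P (2 powr (s - 1))) \<le> CP * exp (d * (\<sigma> + 1))"
      proof -
        have "norm ((2::complex) powr (s - 1)) = 2 powr (\<sigma> - 1)" by (simp add: norm_powr_real_powr \<sigma>_def)
        also have "1 + \<dots> \<le> exp (\<sigma> + 1)"
        proof -
          have "2 powr (\<sigma> - 1) \<le> (2::real) powr \<sigma>" by (intro powr_mono) auto
          moreover have "1 \<le> (2::real) powr \<sigma>" using \<sigma> by (intro ge_one_powr_ge_zero) auto
          moreover have "(2::real) powr \<sigma> \<le> exp 1 powr \<sigma>" 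
            using exp_ge_add_one_self[of 1] \<sigma> by (intro powr_mono2) auto
          moreover have "exp 1 powr \<sigma> = exp \<sigma>" by (simp add: powr_def)
          moreover have "2 * exp \<sigma> \<le> exp 1 * exp \<sigma>" using exp_ge_add_one_self[of 1] by (intro mult_right_mono) auto
          moreover have "exp (\<sigma> + 1) = exp 1 * exp \<sigma>" by (simp add: exp_add)
          ultimately show ?thesis by linarith
        qed
        finally have "(1 + norm ((2::complex) powr (s - 1))) ^ degree P \<le> exp (\<sigma> + 1) ^ degree P"
          by (intro power_mono) auto
        also have "\<dots> = exp (d * (\<sigma> + 1))" by (simp add: d_def exp_of_nat_mult)
        finally have "CP * (1 + norm ((2::complex) powr (s - 1))) ^ degree P \<le> CP * exp (d * (\<sigma> + 1))"
          using CP(1) by (intro mult_left_mono)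
        thus ?thesis using CP(2) order_trans by blast
      qed
      have b2: "norm (of_real pi powr (s / 2) :: complex) \<le> exp \<sigma>"
      proof -
        have "norm (of_real pi powr (s / 2) :: complex) = pi powr (\<sigma> / 2)" by (simp add: norm_powr_real_powr \<sigma>_def)
        also have "\<dots> \<le> (exp 2) powr (\<sigma> / 2)"
        proof (rule powr_mono2)
          have "(2::real) * 2 \<le> exp 1 * exp 1" using exp_ge_add_one_self[of 1] by (intro mult_mono) auto
          also have "exp 1 * exp 1 = exp (2::real)" by (simp flip: exp_add)
          finally show "pi \<le> exp 2" using pi_less_4 by simp
        qed (use \<sigma> in auto)
        also have "\<dots> = exp \<sigma>" by (simp add: powr_def)
        finally show ?thesis .
      qed
      have b3: "norm (rGamma (s / 2 + 1)) \<le> Cr * exp (- M' * (\<sigma> / 2 + 1)) * exp (2 + \<bar>t\<bar>)"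
      proof -
        have "norm (rGamma (s / 2 + 1)) \<le> rGamma (Re (s / 2 + 1)) * exp (2 * (1 + \<bar>Im (s / 2 + 1)\<bar>))"
          by (rule norm_rGamma_le) (use s in auto)
        also have "\<dots> = rGamma (\<sigma> / 2 + 1) * exp (2 + \<bar>t\<bar>)" by (simp add: \<sigma>_def t_def algebra_simps)
        also have "\<dots> \<le> Cr * exp (- M' * (\<sigma> / 2 + 1)) * exp (2 + \<bar>t\<bar>)"
          using \<sigma> by (intro mult_right_mono Cr(2)) auto
        finally show ?thesis .
      qed
      have b4: "1 / norm (zz s) \<le> K2 * m"
      proof -
        have "1 / norm (zz s) \<le> norm (zz (of_real \<sigma>))"
          using zz_lower[OF sH(1)] zz_nz[OF sH(1)] by (simp add: \<sigma>_def field_simps)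
        thus ?thesis using K2(2)[OF \<sigma>] by (simp add: m_def)
      qed
      have b5: "norm (T1 s) \<le> K * exp (2 * \<sigma> + 2 * \<bar>t\<bar>) * m"
      proof -
        have "norm s \<le> \<sigma> + \<bar>t\<bar>" using cmod_le[of s] \<sigma> by (simp add: \<sigma>_def t_def)
        hence "1 + norm s \<le> exp (\<sigma> + \<bar>t\<bar>)" using exp_ge_add_one_self[of "\<sigma> + \<bar>t\<bar>"] by linarith
        hence "(1 + norm s)\<^sup>2 \<le> (exp (\<sigma> + \<bar>t\<bar>))\<^sup>2" by (intro power_mono) auto
        also have "\<dots> = exp (2 * \<sigma> + 2 * \<bar>t\<bar>)" by (simp add: power2_eq_square flip: exp_add)
        finally have "K * (1 + norm s)\<^sup>2 * m \<le> K * exp (2 * \<sigma> + 2 * \<bar>t\<bar>) * m"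
          using K0 m by (intro mult_right_mono mult_left_mono) auto
        thus ?thesis using K[of s] s(1) by (simp add: m_def \<sigma>_def)
      qed
      have b6: "1 / norm (s - 1) \<le> 1" using s(2) by (subst divide_le_eq_1_pos) auto
      have "norm (q s) \<le> G s * norm (T1 s)" by (rule q_le[OF T1 sH s(3)])
      also have "G s = norm (poly P (2 powr (s - 1))) * norm (of_real pi powr (s / 2) :: complex) * norm (rGamma (s / 2 + 1))
          * ((1 / norm (s - 1)) * (1 / norm (zz s))) / c0" by (simp add: G_def)
      also have "\<dots> * norm (T1 s) \<le> (CP * exp (d * (\<sigma> + 1))) * exp \<sigma> * (Cr * exp (- M' * (\<sigma> / 2 + 1)) * exp (2 + \<bar>t\<bar>))
          * (1 * (K2 * m)) / c0 * (K * exp (2 * \<sigma> + 2 * \<bar>t\<bar>) * m)"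
        using b1 b2 b3 b4 b5 b6 CP(1) Cr(1) K2(1) m c0(1)
        by (intro mult_mono divide_right_mono mult_nonneg_nonneg divide_nonneg_nonneg) auto
      also have "\<dots> = CP * Cr * K2 * K / c0 * (exp (d * (\<sigma> + 1)) * exp \<sigma> * exp (- M' * (\<sigma> / 2 + 1)) * exp (2 + \<bar>t\<bar>) * exp (2 * \<sigma> + 2 * \<bar>t\<bar>)) * m\<^sup>2"
        by (simp add: power2_eq_square mult_ac)
      also have "exp (d * (\<sigma> + 1)) * exp \<sigma> * exp (- M' * (\<sigma> / 2 + 1)) * exp (2 + \<bar>t\<bar>) * exp (2 * \<sigma> + 2 * \<bar>t\<bar>) =
          exp d * exp (2 - M') * exp (- M * \<sigma> + 3 * \<bar>t\<bar>)"
        by (simp only: exp_add [symmetric]) (simp add: M'_def algebra_simps)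
      finally show ?thesis by (simp add: C_def m_def \<sigma>_def t_def mult_ac)
    qed
    have "norm (Q s) \<le> C * exp (- M * Re s + 3 * \<bar>Im s\<bar>) * (1 + 1 / (Re s - 1 / 2))\<^sup>2"
      if s: "Re s > 1 / 2" "norm (s - 1) > 1" for s
    proof (rule le_at_by_continuity)
      show "isCont (\<lambda>s. norm (Q s)) s" by (intro continuous_intros Q_cont)
      show "isCont (\<lambda>s. C * exp (- M * Re s + 3 * \<bar>Im s\<bar>) * (1 + 1 / (Re s - 1 / 2))\<^sup>2) s"
        using s by (intro continuous_intros) auto
      have "open {s. norm (s - 1) > 1}" by (intro open_Collect_less continuous_intros)
      hence "eventually (\<lambda>z. z \<in> H \<inter> {s. norm (s - 1) > 1}) (at s)"
        using s openH by (intro eventually_at_in_open') (auto simp: H_def)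
      thus "eventually (\<lambda>s. norm (Q s) \<le> C * exp (- M * Re s + 3 * \<bar>Im s\<bar>) * (1 + 1 / (Re s - 1 / 2))\<^sup>2) (at s)"
        using eventually_Xi_nonzero[of s]
      proof eventually_elim
        case (elim z)
        thus ?case using pre[of z] by (simp add: Q_eq H_def)
      qed
    qed
    thus ?thesis by blast
  qed
  \<comment> \<open>Centring at \<open>1 / 2\<close> turns the functional equation into evenness,
    which carries the bounds to the left half-plane. Outside \<open>norm w \<le> 3 / 2\<close>, the
    point \<open>1 / 2 + w\<close> is at distance more than \<open>1\<close> from
    \<open>1\<close>.\<close>
  define Q1 where "Q1 = (\<lambda>w. Q (1 / 2 + w))"
  have Q1_hol: "Q1 holomorphic_on UNIV"
    unfolding Q1_def by (rule holomorphic_on_compose_gen[OF _ Q_hol, unfolded o_def]) (auto intro!: holomorphic_intros)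
  have Q1_bound: "\<exists>C. \<forall>w. Re w \<noteq> 0 \<longrightarrow> norm w > 3 / 2 \<longrightarrow>
      norm (Q1 w) \<le> C * exp (- M * \<bar>Re w\<bar> + 3 * \<bar>Im w\<bar>) * (1 + 1 / \<bar>Re w\<bar>)\<^sup>2" for M
  proof -
    obtain C where C: "\<And>s. Re s > 1 / 2 \<Longrightarrow> norm (s - 1) > 1 \<Longrightarrow>
        norm (Q s) \<le> C * exp (- M * Re s + 3 * \<bar>Im s\<bar>) * (1 + 1 / (Re s - 1 / 2))\<^sup>2"
      using Q_bound[of M] by blast
    have pos: "norm (Q1 w) \<le> (C * exp (- M / 2)) * exp (- M * \<bar>Re w\<bar> + 3 * \<bar>Im w\<bar>) * (1 + 1 / \<bar>Re w\<bar>)\<^sup>2"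
      if w: "Re w > 0" "norm w > 3 / 2" for w
    proof -
      have "norm (1 / 2 + w - 1) > 1" using norm_diff_ineq[of w "-1/2"] w(2) by (simp add: algebra_simps)
      hence "norm (Q (1 / 2 + w)) \<le> C * exp (- M * Re (1 / 2 + w) + 3 * \<bar>Im (1 / 2 + w)\<bar>) * (1 + 1 / (Re (1 / 2 + w) - 1 / 2))\<^sup>2"
        using w by (intro C) auto
      also have "exp (- M * Re (1 / 2 + w) + 3 * \<bar>Im (1 / 2 + w)\<bar>) = exp (- M / 2) * exp (- M * \<bar>Re w\<bar> + 3 * \<bar>Im w\<bar>)"
        using w by (simp add: algebra_simps flip: exp_add)
      finally show ?thesis using w by (simp add: Q1_def mult_ac)
    qed
    have sym: "Q1 (- w) = Q1 w" for w using Q_sym[of "1 / 2 + w"] by (simp add: Q1_def)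
    have "norm (Q1 w) \<le> (C * exp (- M / 2)) * exp (- M * \<bar>Re w\<bar> + 3 * \<bar>Im w\<bar>) * (1 + 1 / \<bar>Re w\<bar>)\<^sup>2"
      if w: "Re w \<noteq> 0" "norm w > 3 / 2" for w
      using pos[of w] pos[of "- w"] w by (cases "Re w > 0") (auto simp: sym)
    thus ?thesis by blast
  qed
  \<comment> \<open>The rate \<open>M = 0\<close> suffices here: \<open>strip_bound\<close> removes
    the singularity on the imaginary axis, and the result is exponential type.\<close>
  obtain D where D: "\<And>w. norm (Q1 w) \<le> D * exp (3 * \<bar>Im w\<bar>)"
  proof -
    obtain C where "\<forall>w. Re w \<noteq> 0 \<longrightarrow> norm w > 3 / 2 \<longrightarrow> norm (Q1 w) \<le> C * exp (- 0 * \<bar>Re w\<bar> + 3 * \<bar>Im w\<bar>) * (1 + 1 / \<bar>Re w\<bar>)\<^sup>2"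
      using Q1_bound[of 0] by blast
    thus ?thesis using strip_bound[OF Q1_hol, of 3 C] that by auto
  qed
  have D0: "D \<ge> 0" using order_trans[OF norm_ge_zero D[of 0]] by simp
  have "Q1 w = 0" for w
  proof (rule entire_eq_zero_if_sectorial_decay[OF Q1_hol])
    fix w
    have "D * exp (3 * \<bar>Im w\<bar>) \<le> D * exp (3 * norm w)"
      using D0 abs_Im_le_cmod[of w] by (intro mult_left_mono) auto
    thus "norm (Q1 w) \<le> D * exp (3 * norm w)" using D[of w] by linarith
  next
    fix M :: real
    \<comment> \<open>In the sector, \<open>norm w \<le> 3 * \<bar>Re w\<bar>\<close> and
      \<open>3 * \<bar>Im w\<bar> \<le> 6 * \<bar>Re w\<bar>\<close>; the two parts of the rate
      \<open>3 * \<bar>M\<bar> + 6\<close> match these inequalities.\<close>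
    obtain C where C: "\<And>w. Re w \<noteq> 0 \<Longrightarrow> norm w > 3 / 2 \<Longrightarrow>
        norm (Q1 w) \<le> C * exp (- (3 * \<bar>M\<bar> + 6) * \<bar>Re w\<bar> + 3 * \<bar>Im w\<bar>) * (1 + 1 / \<bar>Re w\<bar>)\<^sup>2"
      using Q1_bound[of "3 * \<bar>M\<bar> + 6"] by blast
    have "norm (Q1 w) \<le> max (4 * \<bar>C\<bar>) (D * exp (9 + 3 * \<bar>M\<bar>)) * exp (- M * norm w)" if w: "\<bar>Im w\<bar> \<le> 2 * \<bar>Re w\<bar>" for w
    proof -
      have nw: "norm w \<le> 3 * \<bar>Re w\<bar>" using cmod_le[of w] w by linarith
      have Mn: "- \<bar>M\<bar> * norm w \<le> - M * norm w" by (simp add: mult_right_mono)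
      show ?thesis
      proof (cases "\<bar>Re w\<bar> \<ge> 1 \<and> norm w > 3 / 2")
        case True
        have "norm (Q1 w) \<le> C * exp (- (3 * \<bar>M\<bar> + 6) * \<bar>Re w\<bar> + 3 * \<bar>Im w\<bar>) * (1 + 1 / \<bar>Re w\<bar>)\<^sup>2"
          using True by (intro C) auto
        also have "\<dots> \<le> \<bar>C\<bar> * exp (- M * norm w) * 2\<^sup>2"
        proof (intro mult_mono power_mono)
          have "\<bar>M\<bar> * norm w \<le> \<bar>M\<bar> * (3 * \<bar>Re w\<bar>)" using nw by (intro mult_left_mono) auto
          hence "- (3 * \<bar>M\<bar> + 6) * \<bar>Re w\<bar> + 3 * \<bar>Im w\<bar> \<le> - M * norm w"
            using w Mn by (simp add: algebra_simps)
          thus "exp (- (3 * \<bar>M\<bar> + 6) * \<bar>Re w\<bar> + 3 * \<bar>Im w\<bar>) \<le> exp (- M * norm w)" by simp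
          show "1 + 1 / \<bar>Re w\<bar> \<le> 2" using True by (simp add: divide_le_eq)
        qed auto
        also have "\<dots> = 4 * \<bar>C\<bar> * exp (- M * norm w)" by simp
        also have "\<dots> \<le> max (4 * \<bar>C\<bar>) (D * exp (9 + 3 * \<bar>M\<bar>)) * exp (- M * norm w)"
          by (intro mult_right_mono) auto
        finally show ?thesis .
      next
        case False
        hence n3: "norm w \<le> 3" using nw by linarith
        have "\<bar>M\<bar> * norm w \<le> \<bar>M\<bar> * 3" using n3 by (intro mult_left_mono) auto
        hence "0 \<le> 3 * \<bar>M\<bar> + (- M * norm w)" using Mn by (simp add: algebra_simps)
        moreover have "\<bar>Im w\<bar> \<le> 3" using abs_Im_le_cmod[of w] n3 by linarith
        ultimately have "exp (3 * \<bar>Im w\<bar>) \<le> exp (9 + 3 * \<bar>M\<bar> + (- M * norm w))" by simp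
        hence "D * exp (3 * \<bar>Im w\<bar>) \<le> D * exp (9 + 3 * \<bar>M\<bar> + (- M * norm w))" using D0 by (intro mult_left_mono)
        also have "\<dots> = D * exp (9 + 3 * \<bar>M\<bar>) * exp (- M * norm w)" by (simp only: exp_add mult.assoc)
        also have "\<dots> \<le> max (4 * \<bar>C\<bar>) (D * exp (9 + 3 * \<bar>M\<bar>)) * exp (- M * norm w)"
          by (intro mult_right_mono) auto
        finally show ?thesis using D[of w] by linarith
      qed
    qed
    thus "\<exists>C. \<forall>w. \<bar>Im w\<bar> \<le> 2 * \<bar>Re w\<bar> \<longrightarrow> norm (Q1 w) \<le> C * exp (- M * norm w)" by blast
  qed simp
  hence Q0: "Q s = 0" for s using Q1_def by (metis add.commute diff_add_cancel)
  have E0: "E (of_real x) = 0" if "x > 0" for x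
    using Q_eq[OF Xi_real_nonzero[OF that]] Q0 Xi_real_nonzero[OF that] by (simp add: q_def)
  \<comment> \<open>\<open>Xi\<close> has no zero on the positive real axis, so \<open>Q = 0\<close>
    forces one of the two polynomial factors of \<open>E\<close> to vanish at each
    \<open>x > 0\<close>, although each can do so for finitely many \<open>x\<close> only.\<close>
  have "{0<..} \<subseteq> {x::real. poly P (2 powr (-1 * of_real x + 0)) = 0} \<union> {x::real. poly P (2 powr (1 * of_real x + (-1))) = 0}"
    using E0 by (auto simp: E_def)
  hence "finite {0::real<..}"
    by (rule finite_subset) (intro finite_UnI finite_real_powr_poly P(1); simp)
  thus False by (simp add: infinite_Ioi)
qed

end

section \<open>Translation into limits inferior and superior\<close>

lemma (in fake_mu) apparent_bias_eq: "apparent_bias \<epsilon> = bias"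
proof -
  have "zeta (1 / 2) = zeta_reg (1 / 2) / (1 / 2 - 1)" by (rule zeta_eq_zeta_reg) auto
  hence "zeta (1 / 2) = - 2 * zeta_reg (1 / 2)" by simp
  thus ?thesis unfolding apparent_bias_def bias_def U_half by simp
qed

lemma (in fake_mu) summatory_of_nat: "summatory f (real n) = F n"
  by (simp add: summatory_def F_def)

theorem theorem3:
  fixes f \<epsilon> :: "nat \<Rightarrow> real"
  assumes "multiplicative f"
    and "\<And>p. prime p \<Longrightarrow> f p = -1"
    and "\<And>p. prime p \<Longrightarrow> f (p ^ 2) = 1"
    and "\<And>p k. prime p \<Longrightarrow> k \<ge> 3 \<Longrightarrow> f (p ^ k) = \<epsilon> k"
    and "\<And>k. k \<ge> 3 \<Longrightarrow> \<epsilon> k \<in> {-1, 0, 1}"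
    and "\<epsilon> 2 = 1"
  shows "Liminf at_top (\<lambda>x::real. ereal (summatory f x / sqrt x)) < ereal (apparent_bias \<epsilon>)
       \<and> Limsup at_top (\<lambda>x::real. ereal (summatory f x / sqrt x)) > ereal (apparent_bias \<epsilon>)"
proof -
  interpret fake_mu f \<epsilon> by unfold_locales (use assms in auto)
  \<comment> \<open>Passing to integer arguments loses nothing, since the Dirichlet series involves
    \<open>F\<close> only there; \<open>n > 0\<close> permits clearing the denominator
    \<open>sqrt n\<close>.\<close>
  have to_nat: "eventually (\<lambda>n. P (real n) \<and> n > 0) sequentially" if "eventually P at_top" for P :: "real \<Rightarrow> bool"
    using eventually_compose_filterlim[OF that filterlim_real_sequentially] eventually_gt_at_top[of "0::nat"]
    by (rule eventually_conj)
  show ?thesis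
  proof (intro conjI; rule ccontr)
    assume "\<not> Liminf at_top (\<lambda>x::real. ereal (summatory f x / sqrt x)) < ereal (apparent_bias \<epsilon>)"
    hence L: "ereal bias \<le> Liminf at_top (\<lambda>x::real. ereal (summatory f x / sqrt x))"
      by (simp add: apparent_bias_eq)
    show False
    proof (rule no_one_sided_bound[of "-1"])
      fix \<kappa> :: real assume "\<kappa> > 0"
      \<comment> \<open>The negated claim is a non-strict inequality for the lower limit. Giving up
        \<open>\<kappa>\<close> makes it strict, and a strict inequality persists eventually; so
        every positive margin is available, but not the margin \<open>0\<close>.\<close>
      hence "ereal (bias - \<kappa>) < Liminf at_top (\<lambda>x::real. ereal (summatory f x / sqrt x))"
        by (intro less_le_trans[OF _ L]) simp
      hence "eventually (\<lambda>x::real. ereal (bias - \<kappa>) < ereal (summatory f x / sqrt x)) at_top"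
        by (rule less_LiminfD)
      from to_nat[OF this]
      show "eventually (\<lambda>n. 0 \<le> \<kappa> * sqrt (real n) + -1 * (bias * sqrt (real n) - F n)) sequentially"
      proof eventually_elim
        case (elim n)
        hence "(bias - \<kappa>) * sqrt (real n) < F n"
          by (simp add: summatory_of_nat flip: pos_less_divide_eq)
        thus ?case by (simp add: algebra_simps)
      qed
    qed simp
  next
    assume "\<not> ereal (apparent_bias \<epsilon>) < Limsup at_top (\<lambda>x::real. ereal (summatory f x / sqrt x))"
    hence L: "Limsup at_top (\<lambda>x::real. ereal (summatory f x / sqrt x)) \<le> ereal bias"
      by (simp add: apparent_bias_eq)
    show False
    proof (rule no_one_sided_bound[of 1])
      fix \<kappa> :: real assume "\<kappa> > 0"
      hence "Limsup at_top (\<lambda>x::real. ereal (summatory f x / sqrt x)) < ereal (bias + \<kappa>)"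
        by (intro le_less_trans[OF L]) simp
      hence "eventually (\<lambda>x::real. ereal (summatory f x / sqrt x) < ereal (bias + \<kappa>)) at_top"
        by (rule Limsup_lessD)
      from to_nat[OF this]
      show "eventually (\<lambda>n. 0 \<le> \<kappa> * sqrt (real n) + 1 * (bias * sqrt (real n) - F n)) sequentially"
      proof eventually_elim
        case (elim n)
        hence "F n < (bias + \<kappa>) * sqrt (real n)"
          by (simp add: summatory_of_nat flip: pos_divide_less_eq)
        thus ?case by (simp add: algebra_simps)
      qed
    qed simp
  qed
qed

end
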